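(* Let $m>1$, $1\le p<m$, and assume that $\sigma_1>-2$, $\sigma_2>-2$ if $N\ge2$, or $\sigma_1\ge0$, $\sigma_2>-1$ if $N=1$, are such that $$L(\sigma_1,\sigma_2):=\sigma_2(m-1)+2(p-1)-\sigma_1(m-p)>0.$$ Then there exist compactly supported, radially symmetric self-similar solutions to $$|x|^{\sigma_1}\partial_tu=\Delta u^m+|x|^{\sigma_2}u^p$$ in the backward form $u(x,t)=(T-t)^{-\alpha}f(|x|(T-t)^{\beta})$, $(x,t)\in\mathbb{R}^N\times(0,T)$, $T>0$, with positive self-similar exponents $$\alpha=\frac{\sigma_2+2}{L(\sigma_1,\sigma_2)},\qquad \beta=\frac{m-p}{L(\sigma_1,\sigma_2)}.$$
   Context: Solutions are nonnegative, non-trivial weak solutions; "compactly supported" refers to the profile $f$. *)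

theory Defs
  imports "HOL-Analysis.Analysis"
begin

definition space_time :: "real \<Rightarrow> ('a::euclidean_space \<times> real) set" where
  "space_time T = UNIV \<times> {0<..<T}"

definition locally_integrable_on ::
  "('a::euclidean_space \<Rightarrow> 'b::{banach, second_countable_topology}) \<Rightarrow> 'a set \<Rightarrow> bool" where
  "locally_integrable_on w Q \<longleftrightarrow> (\<forall>K. compact K \<and> K \<subseteq> Q \<longrightarrow> set_integrable lborel K w)"

text \<open>
  \<open>phi\<close> is a \<open>C\<^sup>1\<close> test function with compact support in \<open>Q\<close> and \<open>g\<close> is its space-time gradient,
  so \<open>fst (g z)\<close> is the spatial gradient and \<open>snd (g z)\<close> the time derivative of \<open>phi\<close> at \<open>z\<close>.
\<close>
definition test_function ::
  "('a::euclidean_space \<times> real) set \<Rightarrow> ('a \<times> real \<Rightarrow> real) \<Rightarrow> ('a \<times> real \<Rightarrow> 'a \<times> real) \<Rightarrow> bool" where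
  "test_function Q phi g \<longleftrightarrow>
     (\<forall>z. GDERIV phi z :> g z) \<and> continuous_on UNIV g \<and>
     compact (closure {z. phi z \<noteq> 0}) \<and> closure {z. phi z \<noteq> 0} \<subseteq> Q"

definition weak_spatial_gradient ::
  "('a::euclidean_space \<times> real) set \<Rightarrow> ('a \<times> real \<Rightarrow> real) \<Rightarrow> ('a \<times> real \<Rightarrow> 'a) \<Rightarrow> bool" where
  "weak_spatial_gradient Q v G \<longleftrightarrow>
     locally_integrable_on v Q \<and> locally_integrable_on G Q \<and>
     (\<forall>phi g. test_function Q phi g \<longrightarrow>
        (LINT z:Q|lborel. v z *\<^sub>R fst (g z)) = - (LINT z:Q|lborel. phi z *\<^sub>R G z))"

text \<open>
  Nonnegative, non-trivial weak solutions of
  \<open>|x|^s1 \<partial>\<^sub>t u = \<Delta> u^m + |x|^s2 u^p\<close> in \<open>\<real>\<^sup>N \<times> (0,T)\<close>: \<open>u^m\<close> has a weak spatial gradient in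
  \<open>L\<^sup>2\<close> locally, and the equation holds after one integration by parts in space and in time.
  The value \<open>0 powr s = 0\<close> of the weights at \<open>x = 0\<close> only concerns a null set; \<open>0 powr m = 0\<close> and
  \<open>0 powr p = 0\<close> are the intended values of the powers of \<open>u\<close>.
\<close>
definition weak_solution ::
  "real \<Rightarrow> real \<Rightarrow> real \<Rightarrow> real \<Rightarrow> real \<Rightarrow> ('a::euclidean_space \<times> real \<Rightarrow> real) \<Rightarrow> bool" where
  "weak_solution m p s1 s2 T u \<longleftrightarrow>
     (\<forall>z \<in> space_time T. 0 \<le> u z) \<and>
     \<not> (AE z in lborel. z \<in> space_time T \<longrightarrow> u z = 0) \<and>
     locally_integrable_on (\<lambda>z. norm (fst z) powr s1 * u z) (space_time T) \<and>
     locally_integrable_on (\<lambda>z. norm (fst z) powr s2 * u z powr p) (space_time T) \<and>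
     (\<exists>G. weak_spatial_gradient (space_time T) (\<lambda>z. u z powr m) G \<and>
          locally_integrable_on (\<lambda>z. (norm (G z))\<^sup>2) (space_time T) \<and>
          (\<forall>phi g. test_function (space_time T) phi g \<longrightarrow>
             (LINT z:space_time T|lborel.
                norm (fst z) powr s1 * u z * snd (g z) - G z \<bullet> fst (g z)
                + norm (fst z) powr s2 * u z powr p * phi z) = 0))"

definition backward_self_similar ::
  "real \<Rightarrow> real \<Rightarrow> real \<Rightarrow> (real \<Rightarrow> real) \<Rightarrow> 'a::euclidean_space \<times> real \<Rightarrow> real" where
  "backward_self_similar T \<alpha> \<beta> f =
     (\<lambda>(x, t). (T - t) powr (- \<alpha>) * f (norm x * (T - t) powr \<beta>))"

text \<open>Profiles are functions on \<open>[0,\<infinity>)\<close>; their values at negative arguments are irrelevant.\<close>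
definition compactly_supported_profile :: "(real \<Rightarrow> real) \<Rightarrow> bool" where
  "compactly_supported_profile f \<longleftrightarrow>
     continuous_on {0..} f \<and> compact (closure {r \<in> {0..}. f r \<noteq> 0})"

definition L_exponent :: "real \<Rightarrow> real \<Rightarrow> real \<Rightarrow> real \<Rightarrow> real" where
  "L_exponent m p s1 s2 = s2 * (m - 1) + 2 * (p - 1) - s1 * (m - p)"

end

theory Submission
  imports Defs "HOL-Complex_Analysis.Great_Picard"
begin

text \<open>With \<open>v = f\<^sup>m\<close> the profile equation has the first integral form
  \<open>v' = s powr (1 - N) * y - \<beta> * s powr (1 + \<sigma>1) * f\<close> and
  \<open>y' = s powr (N - 1) * (c * s powr \<sigma>1 * f - l * s powr \<sigma>2 * f powr p)\<close>,
  where a scaling has moved the interface to \<open>s = 1\<close> at the price of the parameter \<open>l\<close>.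
  One shoots from the interface towards the origin. For \<open>l = 0\<close> the flux \<open>y\<close> arrives nonpositive,
  while for large \<open>l\<close> the reaction term drives \<open>v\<close> below zero, which leaves a positive flux. The
  intermediate value theorem, applied to Lipschitz regularisations on \<open>[a, 1]\<close>, yields parameters with
  \<open>y a = 0\<close>; since \<open>y\<close> and the oscillation of \<open>v\<close> are bounded uniformly by powers of
  \<open>s\<close>, the Arzela--Ascoli theorem provides a limit profile with vanishing flux at the origin.
  The self-similar function built from it is a weak solution: the time derivative is integrated along the
  curves \<open>|x| (T - t)\<^sup>\<beta> = const\<close> and the remaining spatial flux is integrated by parts on every
  time slice, with a cut-off at the possibly singular origin.\<close>

section \<open>Terminal value problems depending on a parameter\<close>

text \<open>The profile equation contains \<open>f'\<close> in its transport term, but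
  \<open>f\<close> need not be differentiable at the interface. The flux \<open>y = s powr (N - 1) *
  v' + \<beta> * s powr (N + \<sigma>1) * f\<close> absorbs this term: its equation involves
  \<open>f\<close> only, and the constant becomes
  \<open>c = \<alpha> + \<beta> * (N + \<sigma>1)\<close>. Two degeneracies shape the proof. At the
  interface the exponents \<open>1 / m\<close> and \<open>p / m\<close> are below one, so the
  terminal data \<open>v = y = 0\<close> also admit the zero solution; starting from
  \<open>v 1 = e > 0\<close> selects the other branch, and a lower bound near the interface that is
  uniform in \<open>e\<close> has to keep it alive in the limit. At the origin the coefficients are
  singular, which forces the cut at \<open>a\<close>; there \<open>p < m\<close> makes the system
  sublinear in \<open>v\<close>, and integration from the zero-flux end gives bounds independent of
  \<open>a\<close>. The parameter must also remain bounded and its limit must not vanish, since a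
  final dilation converts \<open>l\<close> into \<open>1\<close>; the exponent of that dilation has
  \<open>L_exponent\<close> as denominator, so the sign condition of the theorem enters there as
  well as in \<open>\<alpha>, \<beta> > 0\<close>.\<close>

lemma volterra_contraction_bound:
  fixes L b t :: real
  assumes "L > 0" "t \<le> b"
  shows "exp (- (2 * L * (b - t))) * integral {t..b} (\<lambda>s. L * exp (2 * L * (b - s))) \<le> 1 / 2"
proof -
  have "((\<lambda>s. L * exp (2 * L * (b - s))) has_integral
      (- exp (2 * L * (b - b)) / 2 - - exp (2 * L * (b - t)) / 2)) {t..b}"
    by (rule fundamental_theorem_of_calculus)
       (use assms in \<open>auto intro!: derivative_eq_intros simp flip: has_real_derivative_iff_has_vector_derivative\<close>)
  then have "integral {t..b} (\<lambda>s. L * exp (2 * L * (b - s))) = (exp (2 * L * (b - t)) - 1) / 2"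
    by (simp only: integral_unique) (simp add: field_simps)
  then have "exp (- (2 * L * (b - t))) * integral {t..b} (\<lambda>s. L * exp (2 * L * (b - s)))
      = (exp (- (2 * L * (b - t))) * exp (2 * L * (b - t)) - exp (- (2 * L * (b - t)))) / 2"
    by (simp only: algebra_simps) (simp add: field_simps)
  also have "\<dots> = (1 - exp (- (2 * L * (b - t)))) / 2"
    by (simp only: flip: exp_add) simp
  finally show ?thesis by simp
qed

text \<open>Bielecki's weight \<open>exp (- 2 L (b - t))\<close> makes the Picard map a contraction of
  the space of continuous functions on the whole interval.\<close>

lemma terminal_value_problem:
  fixes f :: "real \<Rightarrow> real \<Rightarrow> 'b::euclidean_space \<Rightarrow> 'b" and a b L R :: real
  assumes "a \<le> b" and "L > 0" "R \<ge> 0"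
    and cont: "\<And>q. q \<in> Q \<Longrightarrow> continuous_on ({a..b} \<times> UNIV) (\<lambda>(t, x). f t q x)"
    and lip: "\<And>t q x y. t \<in> {a..b} \<Longrightarrow> q \<in> Q \<Longrightarrow> norm (f t q x - f t q y) \<le> L * norm (x - y)"
    and param: "\<And>t q r x. t \<in> {a..b} \<Longrightarrow> q \<in> Q \<Longrightarrow> r \<in> Q \<Longrightarrow>
      norm (f t q x - f t r x) \<le> R * \<bar>q - r\<bar> * norm x"
  obtains X where "\<And>t. t \<in> {a..b} \<Longrightarrow> continuous_on Q (\<lambda>q. X q t)"
    and "\<And>q. q \<in> Q \<Longrightarrow> X q b = x0"
    and "\<And>t q. t \<in> {a..b} \<Longrightarrow> q \<in> Q \<Longrightarrow>
      ((\<lambda>t. X q t) has_vector_derivative f t q (X q t)) (at t within {a..b})"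
proof -
  \<comment> \<open>The weight grows at rate \<open>2 * L\<close>, twice the Lipschitz constant;
    this gives the contraction factor \<open>1 / 2\<close> whatever the length of the
    interval.\<close>
  define E where "E t = exp (2 * L * (b - t))" for t
  have Epos: "E t > 0" for t by (simp add: E_def)
  have contE[continuous_intros]: "continuous_on A E" for A
    unfolding E_def by (intro continuous_intros)
  \<comment> \<open>The unknown is \<open>z = X / E\<close>, so the weighted norm of
    \<open>X\<close> becomes the plain supremum norm, for which bounded continuous functions form a
    complete space.\<close>
  define h where "h q z t = (1 / E t) *\<^sub>R (x0 - integral {t..b} (\<lambda>s. f s q (E s *\<^sub>R z s)))"
    for q and z :: "real \<Rightarrow> 'b" and t
  have contf: "continuous_on {a..b} (\<lambda>s. f s q (E s *\<^sub>R z s))"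
    if "q \<in> Q" "continuous_on {a..b} z" for q z
  proof -
    have "continuous_on {a..b} (\<lambda>s. (\<lambda>(t, x). f t q x) (s, E s *\<^sub>R z s))"
      by (rule continuous_on_compose2[OF cont[OF that(1)]]) (auto intro!: continuous_intros that)
    then show ?thesis by simp
  qed
  have conth: "continuous_on (cbox a b) (h q z)" if "q \<in> Q" "continuous_on {a..b} z" for q z
  proof -
    have "continuous_on {a..b} (\<lambda>t. integral {t..b} (\<lambda>s. f s q (E s *\<^sub>R z s)))"
      by (rule continuous_on_vector_derivative, rule integral_has_vector_derivative'[OF contf[OF that]])
    then have "continuous_on {a..b} (\<lambda>t. (1 / E t) *\<^sub>R (x0 - integral {t..b} (\<lambda>s. f s q (E s *\<^sub>R z s))))"
      by (intro continuous_intros) (auto simp: less_imp_neq[OF Epos, symmetric])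
    then show ?thesis by (simp add: h_def [abs_def])
  qed
  \<comment> \<open>Bounded continuous functions live on the whole line; \<open>clamp\<close>
    continues the image constantly outside \<open>{a..b}\<close>.\<close>
  have "\<exists>g :: real \<Rightarrow>\<^sub>C 'b. \<forall>t. g t = h q (apply_bcontfun z) (clamp a b t)" if "q \<in> Q" for q z
    using continuous_on_cbox_bcontfunE[OF conth[OF that, of "apply_bcontfun z"]]
    by (metis continuous_on_apply_bcontfun)
  then obtain T :: "real \<Rightarrow> (real \<Rightarrow>\<^sub>C 'b) \<Rightarrow> (real \<Rightarrow>\<^sub>C 'b)"
    where T: "\<And>q z t. q \<in> Q \<Longrightarrow> T q z t = h q z (clamp a b t)" by metis
  have clamp: "clamp a b t \<in> {a..b}" for t
    using clamp_in_interval[of a b t] \<open>a \<le> b\<close> by (simp add: box_real)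
  have contr: "dist (T q z) (T q w) \<le> (1 / 2) * dist z w" if q: "q \<in> Q" for q z w
  proof (rule dist_bound)
    fix t'
    define t where "t = clamp a b t'"
    have t: "t \<in> {a..b}" using clamp by (simp add: t_def)
    then have sub: "{t..b} \<subseteq> {a..b}" by auto
    have int: "(\<lambda>s. f s q (E s *\<^sub>R apply_bcontfun z s)) integrable_on {t..b}" for z
      by (intro integrable_continuous_real continuous_on_subset[OF contf sub] q) auto
    have "dist (T q z t') (T q w t') = norm ((1 / E t) *\<^sub>R
        integral {t..b} (\<lambda>s. f s q (E s *\<^sub>R z s) - f s q (E s *\<^sub>R w s)))"
      by (subst integral_diff[OF int int])
         (simp add: T q h_def dist_norm t_def norm_minus_commute flip: scaleR_diff_right)
    also have "\<dots> = (1 / E t) * norm (integral {t..b} (\<lambda>s. f s q (E s *\<^sub>R z s) - f s q (E s *\<^sub>R w s)))"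
      using Epos[of t] by simp
    also have "\<dots> \<le> (1 / E t) * integral {t..b} (\<lambda>s. (L * E s) * dist z w)"
    proof (intro mult_left_mono integral_norm_bound_integral integrable_diff int)
      show "(\<lambda>s. L * E s * dist z w) integrable_on {t..b}"
        by (intro integrable_continuous_real continuous_intros)
      fix s assume "s \<in> {t..b}"
      then have s: "s \<in> {a..b}" using sub by auto
      have "norm (f s q (E s *\<^sub>R z s) - f s q (E s *\<^sub>R w s)) \<le> L * norm (E s *\<^sub>R (z s - w s))"
        using lip[OF s q] by (simp add: scaleR_diff_right)
      also have "\<dots> = L * E s * dist (z s) (w s)" using Epos[of s] by (simp add: dist_norm)
      also have "\<dots> \<le> L * E s * dist z w"
        using Epos[of s] \<open>L > 0\<close> by (intro mult_left_mono dist_bounded) auto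
      finally show "norm (f s q (E s *\<^sub>R z s) - f s q (E s *\<^sub>R w s)) \<le> L * E s * dist z w" .
    qed (use Epos[of t] in auto)
    also have "\<dots> = ((1 / E t) * integral {t..b} (\<lambda>s. L * E s)) * dist z w" by simp
    also have "\<dots> \<le> 1 / 2 * dist z w"
      using volterra_contraction_bound[OF \<open>L > 0\<close>, of t b] t
      by (intro mult_right_mono) (auto simp only: E_def exp_minus inverse_eq_divide atLeastAtMost_iff zero_le_dist)
    finally show "dist (T q z t') (T q w t') \<le> 1 / 2 * dist z w" .
  qed
  have "\<exists>!z. T q z = z" if "q \<in> Q" for q
    by (rule banach_fix_type[of "1/2"]) (use contr[OF that] in auto)
  then obtain Z where Z: "\<And>q. q \<in> Q \<Longrightarrow> T q (Z q) = Z q" by metis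
  define X where "X q t = E t *\<^sub>R Z q t" for q t
  have Zh: "Z q t = h q (Z q) t" if "q \<in> Q" "t \<in> {a..b}" for q t
    using T[OF that(1), of "Z q" t] that Z by (simp add: clamp_cancel_cbox box_real)
  have X: "X q t = x0 - integral {t..b} (\<lambda>s. f s q (X q s))" if "q \<in> Q" "t \<in> {a..b}" for q t
    using Zh[OF that] Epos[of t] by (simp add: X_def h_def)
  show ?thesis
  proof (rule that[of X])
    fix q assume q: "q \<in> Q"
    then show "X q b = x0" using X[of q b] \<open>a \<le> b\<close> by simp
    fix t assume t: "t \<in> {a..b}"
    have "((\<lambda>t. x0 - integral {t..b} (\<lambda>s. f s q (X q s))) has_vector_derivative
        0 - - f t q (X q t)) (at t within {a..b})"
      unfolding X_def
      by (intro has_vector_derivative_diff has_vector_derivative_const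
          integral_has_vector_derivative' contf q t) auto
    then show "((\<lambda>t. X q t) has_vector_derivative f t q (X q t)) (at t within {a..b})"
      by (intro has_vector_derivative_transform[OF t X[OF q]]) simp_all
  next
    fix t assume t: "t \<in> {a..b}"
    show "continuous_on Q (\<lambda>q. X q t)"
      unfolding continuous_on_def
    proof
      fix r assume r: "r \<in> Q"
      define C where "C = (b - a) * R * E a * norm (Z r)"
      have par: "dist (T q (Z r)) (T r (Z r)) \<le> C * \<bar>q - r\<bar>" if q: "q \<in> Q" for q
      proof (rule dist_bound)
        fix t'
        define t where "t = clamp a b t'"
        have t: "t \<in> {a..b}" using clamp by (simp add: t_def)
        then have sub: "{t..b} \<subseteq> {a..b}" by auto
        have int: "(\<lambda>s. f s q (E s *\<^sub>R apply_bcontfun z s)) integrable_on {t..b}" if "q \<in> Q" for q z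
          by (intro integrable_continuous_real continuous_on_subset[OF contf sub] that) auto
        have "dist (T q (Z r) t') (T r (Z r) t') = norm ((1 / E t) *\<^sub>R
            integral {t..b} (\<lambda>s. f s q (E s *\<^sub>R Z r s) - f s r (E s *\<^sub>R Z r s)))"
          by (subst integral_diff[OF int int])
             (simp_all add: T q r h_def dist_norm t_def norm_minus_commute flip: scaleR_diff_right)
        also have "\<dots> = (1 / E t) * norm (integral {t..b} (\<lambda>s. f s q (E s *\<^sub>R Z r s) - f s r (E s *\<^sub>R Z r s)))"
          using Epos[of t] by simp
        also have "\<dots> \<le> 1 * ((R * \<bar>q - r\<bar> * (E a * norm (Z r))) * (b - t))"
        proof (intro mult_mono integral_bound)
          show "t \<le> b" using t by auto
          show "continuous_on {t..b} (\<lambda>s. f s q (E s *\<^sub>R Z r s) - f s r (E s *\<^sub>R Z r s))"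
            by (intro continuous_intros continuous_on_subset[OF contf sub] q r) auto
          fix s assume "s \<in> {t..b}"
          then have s: "s \<in> {a..b}" using sub by auto
          have "norm (f s q (E s *\<^sub>R Z r s) - f s r (E s *\<^sub>R Z r s)) \<le> R * \<bar>q - r\<bar> * (E s * norm (Z r s))"
            using param[OF s q r, of "E s *\<^sub>R Z r s"] Epos[of s] by simp
          also have "\<dots> \<le> R * \<bar>q - r\<bar> * (E a * norm (Z r))"
            using s \<open>L > 0\<close> \<open>R \<ge> 0\<close> Epos
            by (intro mult_left_mono mult_mono norm_bounded) (auto simp: E_def)
          finally show "norm (f s q (E s *\<^sub>R Z r s) - f s r (E s *\<^sub>R Z r s))
            \<le> R * \<bar>q - r\<bar> * (E a * norm (Z r))" .
        qed (use t \<open>L > 0\<close> in \<open>auto simp: E_def\<close>)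
        also have "\<dots> \<le> (R * \<bar>q - r\<bar> * (E a * norm (Z r))) * (b - a)"
          using t \<open>R \<ge> 0\<close> Epos[of a] by (simp, intro mult_left_mono) auto
        also have "\<dots> = C * \<bar>q - r\<bar>" by (simp add: C_def mult_ac)
        finally show "dist (T q (Z r) t') (T r (Z r) t') \<le> C * \<bar>q - r\<bar>" .
      qed
      \<comment> \<open>A contraction with factor \<open>1 / 2\<close> has its fixed point within
        twice the distance by which it moves a given point. The point is \<open>Z r\<close>, which
        the map for \<open>q\<close> moves by at most \<open>C * \<bar>q - r\<bar>\<close>.\<close>
      have le: "dist (Z q) (Z r) \<le> 2 * C * \<bar>q - r\<bar>" if q: "q \<in> Q" for q
      proof -
        have "dist (Z q) (Z r) = dist (T q (Z q)) (T r (Z r))" using Z q r by simp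
        also have "\<dots> \<le> dist (T q (Z q)) (T q (Z r)) + dist (T q (Z r)) (T r (Z r))"
          by (rule dist_triangle)
        also have "\<dots> \<le> (1 / 2) * dist (Z q) (Z r) + C * \<bar>q - r\<bar>"
          by (intro add_mono contr par q)
        finally show ?thesis by simp
      qed
      have "((\<lambda>q. Z q t) \<longlongrightarrow> Z r t) (at r within Q)"
      proof (rule metric_tendsto_imp_tendsto)
        show "((\<lambda>q. 2 * C * \<bar>q - r\<bar>) \<longlongrightarrow> 0) (at r within Q)"
          by (rule tendsto_eq_intros refl | simp)+
        show "\<forall>\<^sub>F q in at r within Q. dist (Z q t) (Z r t) \<le> dist (2 * C * \<bar>q - r\<bar>) 0"
          unfolding eventually_at_filter
          by (rule always_eventually) (auto intro!: order_trans[OF dist_bounded] order_trans[OF le])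
      qed
      then show "((\<lambda>q. X q t) \<longlongrightarrow> X r t) (at r within Q)"
        unfolding X_def by (intro tendsto_intros)
    qed
  qed
qed

section \<open>Regularised powers\<close>

text \<open>Agrees with \<open>x powr q\<close> for \<open>x \<ge> e\<close>, is linear on \<open>[0, e]\<close> and vanishes for negative \<open>x\<close>, hence is Lipschitz.\<close>

definition reg :: "real \<Rightarrow> real \<Rightarrow> real \<Rightarrow> real" where
  "reg q e x = max x 0 * max x e powr (q - 1)"

lemma reg_nonneg [simp]: "0 \<le> reg q e x"
  by (simp add: reg_def)

lemma reg_nonpos: "x \<le> 0 \<Longrightarrow> reg q e x = 0"
  by (simp add: reg_def)

lemma reg_eq_powr: "0 < e \<Longrightarrow> e \<le> x \<Longrightarrow> reg q e x = x powr q"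
  by (simp add: reg_def powr_diff)

lemma reg_eq_linear: "0 \<le> x \<Longrightarrow> x \<le> e \<Longrightarrow> reg q e x = x * e powr (q - 1)"
  by (simp add: reg_def max_def)

text \<open>The linear piece has slope \<open>e powr (q - 1)\<close>, and this is the largest slope
  because \<open>x powr q\<close> is concave; the constant blows up as \<open>e\<close> tends to
  \<open>0\<close>.\<close>

lemma reg_Lipschitz_aux:
  assumes "0 < e" "0 < q" "q < 1" "x \<le> y"
  shows "reg q e x \<le> reg q e y" and "reg q e y - reg q e x \<le> e powr (q - 1) * (y - x)"
proof -
  have seg: "reg q e x \<le> reg q e y \<and> reg q e y - reg q e x \<le> e powr (q - 1) * (y - x)"
    if "x \<le> y" "y \<le> 0 \<or> 0 \<le> x \<and> y \<le> e \<or> e \<le> x" for x y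
    using that(2)
  proof (elim disjE conjE)
    assume "y \<le> 0" then show ?thesis using that(1) by (simp add: reg_nonpos)
  next
    assume "0 \<le> x" "y \<le> e" then show ?thesis using that(1)
      by (simp add: reg_eq_linear algebra_simps mult_right_mono)
  next
    assume ex: "e \<le> x"
    have "y powr q = y * y powr (q - 1)"
      using ex that assms by (simp add: powr_diff)
    also have "\<dots> \<le> y * x powr (q - 1)"
      using ex that assms by (intro mult_left_mono powr_mono2') auto
    finally have "y powr q \<le> y * x powr (q - 1)" .
    moreover have "x powr q = x * x powr (q - 1)" using ex assms by (simp add: powr_diff)
    ultimately have "y powr q - x powr q \<le> x powr (q - 1) * (y - x)"
      by (simp add: algebra_simps)
    also have "\<dots> \<le> e powr (q - 1) * (y - x)"
      using ex that assms by (intro mult_right_mono powr_mono2') auto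
    finally show ?thesis
      using ex that assms by (auto simp: reg_eq_powr intro!: powr_mono2)
  qed
  \<comment> \<open>\<open>x1\<close> and \<open>y1\<close> are the breakpoints \<open>0\<close> and
    \<open>e\<close> moved into \<open>{x..y}\<close>; they split the interval into pieces each
    covered by one of the three cases.\<close>
  define x1 y1 where "x1 = min y (max x 0)" and "y1 = min y (max x e)"
  have "x \<le> x1" "x1 \<le> y1" "y1 \<le> y" using assms by (auto simp: x1_def y1_def)
  moreover have "reg q e x \<le> reg q e x1 \<and> reg q e x1 - reg q e x \<le> e powr (q - 1) * (x1 - x)"
    using assms by (cases "x \<le> 0") (auto simp: x1_def intro!: seg)
  moreover have "reg q e x1 \<le> reg q e y1 \<and> reg q e y1 - reg q e x1 \<le> e powr (q - 1) * (y1 - x1)"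
    using assms by (intro seg) (auto simp: x1_def y1_def)
  moreover have "reg q e y1 \<le> reg q e y \<and> reg q e y - reg q e y1 \<le> e powr (q - 1) * (y - y1)"
    using assms by (intro seg) (auto simp: x1_def y1_def)
  ultimately show "reg q e x \<le> reg q e y" and "reg q e y - reg q e x \<le> e powr (q - 1) * (y - x)"
    by (auto simp: algebra_simps)
qed

lemma reg_mono: "0 < e \<Longrightarrow> 0 < q \<Longrightarrow> q < 1 \<Longrightarrow> x \<le> y \<Longrightarrow> reg q e x \<le> reg q e y"
  by (rule reg_Lipschitz_aux)

lemma reg_Lipschitz:
  assumes "0 < e" "0 < q" "q < 1"
  shows "\<bar>reg q e x - reg q e y\<bar> \<le> e powr (q - 1) * \<bar>x - y\<bar>"
  using reg_Lipschitz_aux[OF assms, of x y] reg_Lipschitz_aux[OF assms, of y x]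
  by (cases "x \<le> y") auto

lemma continuous_on_reg [continuous_intros]:
  assumes "0 < e" "continuous_on S f"
  shows "continuous_on S (\<lambda>x. reg q e (f x))"
  unfolding reg_def by (intro continuous_intros assms) (use assms in \<open>auto simp: max_def\<close>)

lemma reg_le_powr:
  assumes "0 < e" "0 < q" "q < 1"
  shows "reg q e x \<le> max x 0 powr q"
proof (cases "0 < x")
  case True
  then have "x * max x e powr (q - 1) \<le> x * x powr (q - 1)"
    using assms by (intro mult_left_mono powr_mono2') auto
  then show ?thesis using True by (simp add: reg_def powr_diff)
qed (simp add: reg_def)

lemma powr_le_reg_add:
  assumes "0 < e" "0 < q" "q < 1"
  shows "max x 0 powr q \<le> reg q e x + e powr q"
proof (cases "x \<le> e")
  case True
  have "max x 0 powr q \<le> e powr q" using True assms by (intro powr_mono2) auto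
  then show ?thesis using reg_nonneg[of q e x] by linarith
qed (use assms in \<open>simp add: reg_eq_powr\<close>)

lemma reg_powr_le:
  assumes "0 < e" "1 \<le> p" "p < m"
  shows "reg (1 / m) e x powr p \<le> reg (p / m) e x"
proof (cases "0 < x")
  case True
  let ?M = "max x e"
  have M: "0 < ?M" "x \<le> ?M" using True by auto
  have "reg (1 / m) e x powr p = x powr p * ?M powr ((1 / m - 1) * p)"
    using True by (simp add: reg_def powr_mult powr_powr)
  also have "\<dots> = x * (x powr (p - 1) * ?M powr ((1 / m - 1) * p))"
    using True by (simp add: powr_diff)
  also have "\<dots> \<le> x * (?M powr (p - 1) * ?M powr ((1 / m - 1) * p))"
    using True M assms by (intro mult_left_mono mult_right_mono powr_mono2) auto
  also have "\<dots> = x * ?M powr (p / m - 1)"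
    by (simp add: powr_add [symmetric] algebra_simps)
  finally show ?thesis using True by (simp add: reg_def)
qed (simp add: reg_nonpos)

section \<open>Increment estimates and extremal points of sign conditions\<close>

lemma
  assumes "s \<le> t" "{s..t} \<subseteq> I"
    and der: "\<And>x. x \<in> I \<Longrightarrow> (f has_real_derivative f' x) (at x within I)"
  shows increment_le: "(\<And>x. s < x \<Longrightarrow> x < t \<Longrightarrow> f' x \<le> C) \<Longrightarrow> f t - f s \<le> C * (t - s)"
    and increment_ge: "(\<And>x. s < x \<Longrightarrow> x < t \<Longrightarrow> C \<le> f' x) \<Longrightarrow> C * (t - s) \<le> f t - f s"
proof -
  have "\<exists>x. s < x \<and> x < t \<and> f t - f s = f' x * (t - s)" if "s < t"
  proof -
    show ?thesis
    proof (rule mvt[OF that, where f = f and f' = "\<lambda>x h. f' x * h"])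
      show "continuous_on {s..t} f"
        using assms(2) by (intro DERIV_continuous_on[where D = f'] has_field_derivative_subset[OF der assms(2)]) auto
      fix x assume "s < x" "x < t"
      then have "(f has_real_derivative f' x) (at x within {s<..<t})"
        using assms(2) by (intro has_field_derivative_subset[OF der]) auto
      then have "(f has_real_derivative f' x) (at x)"
        using \<open>s < x\<close> \<open>x < t\<close> by (subst (asm) at_within_open) auto
      then show "(f has_derivative (\<lambda>h. f' x * h)) (at x)"
        by (simp add: has_field_derivative_def)
    qed auto
  qed
  then have ex: "s = t \<or> (\<exists>x. s < x \<and> x < t \<and> f t - f s = f' x * (t - s))"
    using \<open>s \<le> t\<close> by fastforce
  show "f t - f s \<le> C * (t - s)" if "\<And>x. s < x \<Longrightarrow> x < t \<Longrightarrow> f' x \<le> C"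
    using ex \<open>s \<le> t\<close> that by (auto intro!: mult_right_mono)
  show "C * (t - s) \<le> f t - f s" if "\<And>x. s < x \<Longrightarrow> x < t \<Longrightarrow> C \<le> f' x"
    using ex \<open>s \<le> t\<close> that by (auto intro!: mult_right_mono)
qed

text \<open>The nonnegative points in \<open>{x..b}\<close> form a compact set, so there is a
  largest one. This replaces continuation arguments: estimates that hold while a sign persists are
  applied on the maximal interval.\<close>

lemma last_nonneg_point:
  fixes g :: "real \<Rightarrow> real"
  assumes "continuous_on {c..b} g" "x \<in> {c..b}" "0 \<le> g x"
  obtains s where "x \<le> s" "s \<le> b" "0 \<le> g s" "\<And>t. s < t \<Longrightarrow> t \<le> b \<Longrightarrow> g t < 0"
proof -
  have "closed ({x..b} \<inter> g -` {0..})"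
    using assms by (intro continuous_closed_preimage continuous_on_subset[OF assms(1)]) auto
  then have "compact ({x..b} \<inter> g -` {0..})"
    using bounded_subset[OF bounded_closed_interval[of x b], of "{x..b} \<inter> g -` {0..}"]
    by (simp add: compact_eq_bounded_closed)
  moreover have "x \<in> {x..b} \<inter> g -` {0..}" using assms by auto
  ultimately obtain s where s: "s \<in> {x..b} \<inter> g -` {0..}" "\<forall>t\<in>{x..b} \<inter> g -` {0..}. t \<le> s"
    using compact_attains_sup[of "{x..b} \<inter> g -` {0..}"] by blast
  show ?thesis
  proof (rule that[of s])
    fix t assume "s < t" "t \<le> b"
    then show "g t < 0" using s(1) s(2)[rule_format, of t] by fastforce
  qed (use s in auto)
qed

lemma first_nonneg_point:
  fixes g :: "real \<Rightarrow> real"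
  assumes "continuous_on {c..b} g" "x \<in> {c..b}" "0 \<le> g x"
  obtains s where "c \<le> s" "s \<le> x" "0 \<le> g s" "\<And>t. c \<le> t \<Longrightarrow> t < s \<Longrightarrow> g t < 0"
proof -
  have "continuous_on {- b..- c} (\<lambda>t. g (- t))"
    by (intro continuous_on_compose2[OF assms(1)] continuous_intros) auto
  from last_nonneg_point[OF this, of "- x"] assms(2,3)
  obtain s where "- x \<le> s" "s \<le> - c" "0 \<le> g (- s)" "\<And>t. s < t \<Longrightarrow> t \<le> - c \<Longrightarrow> g (- t) < 0"
    by auto
  then show ?thesis
    by (intro that[of "- s"]) (auto simp: less_minus_iff intro!: \<open>\<And>t. s < t \<Longrightarrow> t \<le> - c \<Longrightarrow> g (- t) < 0\<close>[of "- _", simplified])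
qed

text \<open>Once \<open>v\<close> is negative both nonlinear terms vanish, so \<open>y\<close> is constant and
  \<open>v\<close> cannot return to zero further to the left.\<close>

lemma negative_imp_flux_constant:
  fixes v y A g h :: "real \<Rightarrow> real"
  assumes A: "\<And>s. s \<in> {a..1} \<Longrightarrow> 0 < A s"
    and v': "\<And>s. s \<in> {a..1} \<Longrightarrow> (v has_real_derivative A s * y s - g s) (at s within {a..1})"
    and y': "\<And>s. s \<in> {a..1} \<Longrightarrow> (y has_real_derivative h s) (at s within {a..1})"
    and zero: "\<And>s. s \<in> {a..1} \<Longrightarrow> v s \<le> 0 \<Longrightarrow> g s = 0 \<and> h s = 0"
    and "0 \<le> v 1" and s0: "s0 \<in> {a..1}" "v s0 < 0"
  shows "y a = y s0" "0 < y s0"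
proof -
  have cv: "continuous_on {a..1} v" by (rule DERIV_continuous_on[OF v'])
  have const: "y s = y t" if "a \<le> s" "s \<le> t" "t \<le> 1" "\<And>x. s < x \<Longrightarrow> x < t \<Longrightarrow> v x \<le> 0" for s t
  proof -
    have h: "h x = 0" if "s < x" "x < t" for x
      using zero[of x] \<open>a \<le> s\<close> \<open>t \<le> 1\<close> \<open>\<And>x. s < x \<Longrightarrow> x < t \<Longrightarrow> v x \<le> 0\<close>[OF that] that by auto
    have "y t - y s \<le> 0 * (t - s)"
      by (rule increment_le[OF that(2) _ y']) (use that h in auto)
    moreover have "0 * (t - s) \<le> y t - y s"
      by (rule increment_ge[OF that(2) _ y']) (use that h in auto)
    ultimately show ?thesis by simp
  qed
  show pos: "0 < y s0"
  proof (rule ccontr)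
    assume np: "\<not> 0 < y s0"
    \<comment> \<open>\<open>v\<close> must be nonnegative again at \<open>1\<close>; up to the
      first such point \<open>b\<close> the flux equals \<open>y s0 \<le> 0\<close>, so
      \<open>v\<close> cannot climb from its negative value.\<close>
    obtain b where b: "b \<in> {s0..1}" "0 \<le> v b" and neg: "\<And>s. s0 \<le> s \<Longrightarrow> s < b \<Longrightarrow> v s < 0"
    proof (rule first_nonneg_point[of s0 1 v 1])
      show "continuous_on {s0..1} v" using continuous_on_subset[OF cv, of "{s0..1}"] s0 by auto
      fix b assume "s0 \<le> b" "b \<le> 1" "0 \<le> v b" "\<And>t. s0 \<le> t \<Longrightarrow> t < b \<Longrightarrow> v t < 0"
      then show thesis using s0 by (intro that) auto
    qed (use s0 \<open>0 \<le> v 1\<close> in auto)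
    have "v b - v s0 \<le> 0 * (b - s0)"
    proof (rule increment_le[OF _ _ v'])
      fix x assume x: "s0 < x" "x < b"
      have "y s0 = y x"
        by (rule const) (use x b s0 neg in \<open>auto simp: less_imp_le\<close>)
      with np show "A x * y x - g x \<le> 0"
        using x neg[of x] zero[of x] A[of x] b s0 by (auto simp: mult_le_0_iff)
    qed (use b s0 in auto)
    then show False using b s0 by simp
  qed
  have neg: "v s < 0" if s: "s \<in> {a..s0}" for s
  proof (rule ccontr)
    assume nn: "\<not> v s < 0"
    obtain b where b: "b \<in> {a..s0}" "0 \<le> v b" and neg: "\<And>s. b < s \<Longrightarrow> s \<le> s0 \<Longrightarrow> v s < 0"
    proof (rule last_nonneg_point[of a s0 v s])
      show "continuous_on {a..s0} v" using continuous_on_subset[OF cv, of "{a..s0}"] s0 by auto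
      fix b assume "s \<le> b" "b \<le> s0" "0 \<le> v b" "\<And>t. b < t \<Longrightarrow> t \<le> s0 \<Longrightarrow> v t < 0"
      then show thesis using that s s0 by (intro that) auto
    qed (use s nn in auto)
    have "0 * (s0 - b) \<le> v s0 - v b"
    proof (rule increment_ge[OF _ _ v'])
      fix x assume x: "b < x" "x < s0"
      have "y x = y s0"
        by (rule const) (use x b s0 neg in \<open>auto simp: less_imp_le\<close>)
      with pos show "0 \<le> A x * y x - g x"
        using x neg[of x] zero[of x] A[of x] b s0 by auto
    qed (use b s0 in auto)
    then show False using b s0 by simp
  qed
  show "y a = y s0"
    by (rule const) (use neg s0 in \<open>auto simp: less_imp_le\<close>)
qed

section \<open>Shooting from the interface\<close>

lemma has_real_derivative_powr_comp:
  assumes "(v has_real_derivative D) (at s within I)" "0 < v s"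
  shows "((\<lambda>s. v s powr r) has_real_derivative r * v s powr (r - 1) * D) (at s within I)"
  using DERIV_chain2[OF has_real_derivative_powr[OF assms(2)] assms(1)] .

text \<open>Abstract coefficients of the first integral form; in \<open>sol\<close> the function \<open>v\<close> stands for \<open>f\<^sup>m\<close>,
  \<open>l\<close> is the shooting parameter and \<open>e\<close> both regularises the powers and replaces the interface value \<open>0\<close>.\<close>

locale shooting =
  fixes A B P Q :: "real \<Rightarrow> real" and m p k K :: real
  assumes m: "1 < m" and p: "1 \<le> p" "p < m" and k: "0 < k" "k \<le> 1" and K: "1 \<le> K"
    and bnd: "\<And>s. s \<in> {1/2..1} \<Longrightarrow> k \<le> A s \<and> A s \<le> K \<and> k \<le> B s \<and> B s \<le> K \<and>
      k \<le> P s \<and> P s \<le> K \<and> k \<le> Q s \<and> Q s \<le> K"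
    and pos: "\<And>s. 0 < s \<Longrightarrow> s \<le> 1 \<Longrightarrow> 0 < A s \<and> 0 < B s \<and> 0 < P s \<and> 0 < Q s"
    and cont: "continuous_on {0<..1} A" "continuous_on {0<..1} B"
      "continuous_on {0<..1} P" "continuous_on {0<..1} Q"
    and ratio: "\<And>s t. 0 < s \<Longrightarrow> s \<le> t \<Longrightarrow> t \<le> 1 \<Longrightarrow> B s / A s \<le> B t / A t"
begin

abbreviation F :: "real \<Rightarrow> real \<Rightarrow> real" where "F \<equiv> reg (1 / m)"
abbreviation G :: "real \<Rightarrow> real \<Rightarrow> real" where "G \<equiv> reg (p / m)"

definition sol :: "real \<Rightarrow> real \<Rightarrow> real \<Rightarrow> (real \<Rightarrow> real) \<Rightarrow> (real \<Rightarrow> real) \<Rightarrow> bool" where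
  "sol l e a v y \<longleftrightarrow> v 1 = e \<and> y 1 = 0 \<and> (\<forall>s\<in>{a..1}.
     (v has_real_derivative A s * y s - B s * F e (v s)) (at s within {a..1}) \<and>
     (y has_real_derivative P s * F e (v s) - l * Q s * G e (v s)) (at s within {a..1}))"

lemma exponents: "0 < 1 / m" "1 / m < 1" "0 < p / m" "p / m < 1"
  using m p by auto

lemma solD:
  assumes "sol l e a v y"
  shows "v 1 = e" "y 1 = 0"
    and "\<And>s. s \<in> {a..1} \<Longrightarrow> (v has_real_derivative A s * y s - B s * F e (v s)) (at s within {a..1})"
    and "\<And>s. s \<in> {a..1} \<Longrightarrow> (y has_real_derivative P s * F e (v s) - l * Q s * G e (v s)) (at s within {a..1})"
    and "continuous_on {a..1} v" "continuous_on {a..1} y"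
proof -
  show "v 1 = e" "y 1 = 0" using assms by (auto simp: sol_def)
  show v: "(v has_real_derivative A s * y s - B s * F e (v s)) (at s within {a..1})"
    and y: "(y has_real_derivative P s * F e (v s) - l * Q s * G e (v s)) (at s within {a..1})"
    if "s \<in> {a..1}" for s using assms that unfolding sol_def by blast+
  show "continuous_on {a..1} v" "continuous_on {a..1} y"
    by (rule DERIV_continuous_on, erule v, rule DERIV_continuous_on, erule y)
qed

lemma F_mono: "0 < e \<Longrightarrow> x \<le> y \<Longrightarrow> F e x \<le> F e y"
  using exponents by (simp add: reg_mono)

lemma F_powr_m_le: "0 < e \<Longrightarrow> 0 \<le> x \<Longrightarrow> F e x powr m \<le> x"
proof -
  assume "0 < e" "0 \<le> x"
  then have "F e x powr m \<le> (x powr (1 / m)) powr m"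
    using reg_le_powr[of e "1/m" x] exponents m by (intro powr_mono2) auto
  then show ?thesis using m \<open>0 \<le> x\<close> by (simp add: powr_powr)
qed

text \<open>Serves in contraposed form: a solution whose flux at \<open>a\<close> is negative keeps
  \<open>v \<ge> 0\<close> on all of \<open>{a..1}\<close>.\<close>

lemma negative_imp_positive_flux:
  assumes "sol l e a v y" "0 < e" "0 < a" "s \<in> {a..1}" "v s < 0"
  shows "0 < y a"
proof -
  note * = negative_imp_flux_constant[of a A v y "\<lambda>s. B s * F e (v s)"
      "\<lambda>s. P s * F e (v s) - l * Q s * G e (v s)" s, OF _ solD(3)[OF assms(1)] solD(4)[OF assms(1)]]
  have "0 \<le> v 1" "\<And>r. r \<in> {a..1} \<Longrightarrow> 0 < A r" "a \<le> s" "s \<le> 1"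
    using assms(2-5) pos solD(1)[OF assms(1)] by simp_all
  then have "y a = y s" "0 < y s"
    using \<open>v s < 0\<close> by (auto intro!: * simp: reg_nonpos)
  then show ?thesis by simp
qed

text \<open>Estimates on an interval \<open>[s1, 1]\<close> on which \<open>v\<close> decreases (prefix \<open>decr\<close>); the pressure
  \<open>v powr (1 - 1 / m)\<close> is the quantity with bounded slope there.\<close>

context
  fixes l e a v y s1
  assumes sol: "sol l e a v y" and e: "0 < e" "e \<le> 1" and l: "0 \<le> l" and a: "0 < a" "a \<le> 1/2"
    and s1: "1/2 \<le> s1" "s1 \<le> 1"
    and dec: "\<And>s. s1 < s \<Longrightarrow> s < 1 \<Longrightarrow> A s * y s \<le> B s * F e (v s)"
begin

lemma decr_mono:
  assumes "s1 \<le> s" "s \<le> t" "t \<le> 1"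
  shows "v t \<le> v s"
proof -
  have "v t - v s \<le> 0 * (t - s)"
    by (rule increment_le[OF \<open>s \<le> t\<close> _ solD(3)[OF sol]])
      (use assms s1 a dec in \<open>auto simp: less_imp_le\<close>)
  then show ?thesis by simp
qed

lemma decr_ge: "s1 \<le> s \<Longrightarrow> s \<le> 1 \<Longrightarrow> e \<le> v s"
  using decr_mono[of s 1] solD[OF sol] by simp

text \<open>As \<open>v\<close> decreases to the value \<open>e\<close> at \<open>1\<close>, it
  stays at or above \<open>e\<close> on \<open>{s1..1}\<close>; the regularisation is inactive there
  and \<open>F\<close>, \<open>G\<close> are true powers, with \<open>F (v)\<close> in the role of
  \<open>f\<close>.\<close>

lemma decr_F:
  assumes "s1 \<le> s" "s \<le> 1"
  shows "F e (v s) = v s powr (1 / m)" "G e (v s) = F e (v s) powr p" "0 < F e (v s)"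
    and "F e (v s) powr (m - 1) = v s powr (1 - 1 / m)"
proof -
  have v: "e \<le> v s" "0 < v s" using decr_ge[OF assms] e by auto
  have "1 / m * (m - 1) = 1 - 1 / m" "1 / m * p = p / m" using m by (auto simp: diff_divide_distrib)
  with v e show "F e (v s) = v s powr (1 / m)" "G e (v s) = F e (v s) powr p" "0 < F e (v s)"
    "F e (v s) powr (m - 1) = v s powr (1 - 1 / m)"
    by (simp_all add: reg_eq_powr powr_powr)
qed

lemma decr_F_mono: "s1 \<le> s \<Longrightarrow> s \<le> t \<Longrightarrow> t \<le> 1 \<Longrightarrow> F e (v t) \<le> F e (v s)"
  by (intro F_mono e decr_mono)

text \<open>The derivative of \<open>y\<close> is integrated from \<open>s\<close> to
  \<open>1\<close>, where \<open>y\<close> vanishes; the reaction term is discarded and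
  \<open>F (v)\<close> is largest at the left end. Discarding the other term instead gives the
  companion upper bound.\<close>

lemma decr_y_ge:
  assumes "s1 \<le> s" "s \<le> 1"
  shows "- (K * (1 - s) * F e (v s)) \<le> y s"
proof -
  have "y 1 - y s \<le> (K * F e (v s)) * (1 - s)"
  proof (rule increment_le[OF \<open>s \<le> 1\<close> _ solD(4)[OF sol]])
    fix x assume x: "s < x" "x < 1"
    have "P x * F e (v x) \<le> K * F e (v s)"
      using bnd[of x] x assms s1 K by (intro mult_mono decr_F_mono) auto
    moreover have "0 \<le> l * Q x * G e (v x)"
      using pos[of x] x assms s1 l by simp
    ultimately show "P x * F e (v x) - l * Q x * G e (v x) \<le> K * F e (v s)" by simp
  qed (use assms s1 a in auto)
  then show ?thesis using solD[OF sol] by (simp add: algebra_simps)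
qed

lemma decr_y_le:
  assumes "s1 \<le> s" "s \<le> 1"
  shows "y s \<le> l * K * (1 - s) * F e (v s) powr p"
proof -
  have "(- (l * K * F e (v s) powr p)) * (1 - s) \<le> y 1 - y s"
  proof (rule increment_ge[OF \<open>s \<le> 1\<close> _ solD(4)[OF sol]])
    fix x assume x: "s < x" "x < 1"
    have "l * Q x * G e (v x) \<le> l * K * F e (v s) powr p"
      using bnd[of x] pos[of x] x assms s1 K l p decr_F(2)[of x] decr_F_mono[of s x]
      by (intro mult_mono) (auto intro!: powr_mono2)
    moreover have "0 \<le> P x * F e (v x)"
      using pos[of x] x assms s1 by simp
    ultimately show "- (l * K * F e (v s) powr p) \<le> P x * F e (v x) - l * Q x * G e (v x)" by simp
  qed (use assms s1 a in auto)
  then show ?thesis using solD[OF sol] by (simp add: algebra_simps)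
qed

lemma decr_slope_ge:
  assumes "s1 \<le> s" "s \<le> 1"
  shows "- (2 * K\<^sup>2 * F e (v s)) \<le> A s * y s - B s * F e (v s)"
proof -
  have s: "s \<in> {1/2..1}" using assms s1 by auto
  have "- (K * F e (v s)) \<le> y s"
  proof -
    have "K * (1 - s) * F e (v s) \<le> K * 1 * F e (v s)"
      using s K decr_F(3)[OF assms] by (intro mult_right_mono mult_left_mono) auto
    then show ?thesis using decr_y_ge[OF assms] by simp
  qed
  then have "A s * - (K * F e (v s)) \<le> A s * y s"
    using bnd[OF s] k by (intro mult_left_mono) auto
  moreover have "A s * (K * F e (v s)) \<le> K * (K * F e (v s))"
    using bnd[OF s] K decr_F(3)[OF assms] by (intro mult_right_mono) auto
  moreover have "B s * F e (v s) \<le> K * F e (v s)"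
    using bnd[OF s] decr_F(3)[OF assms] by (intro mult_right_mono) auto
  moreover have "K * F e (v s) \<le> K * (K * F e (v s))"
    using K decr_F(3)[OF assms] by (simp add: mult_left_le_imp_le)
  ultimately show ?thesis by (simp add: power2_eq_square)
qed

text \<open>The chain rule produces \<open>v powr (- 1 / m) = 1 / F (v)\<close>, which cancels the
  factor \<open>F (v)\<close> in the slope bounds and leaves constants.\<close>

lemma pressure_derivative:
  assumes "s1 \<le> s" "s \<le> 1"
  shows "((\<lambda>s. v s powr (1 - 1 / m)) has_real_derivative
    (1 - 1 / m) * ((A s * y s - B s * F e (v s)) / F e (v s))) (at s within {a..1})"
proof -
  have "0 < v s" using decr_ge[OF assms] e by simp
  then have "((\<lambda>s. v s powr (1 - 1 / m)) has_real_derivative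
      (1 - 1 / m) * v s powr (1 - 1 / m - 1) * (A s * y s - B s * F e (v s))) (at s within {a..1})"
    using assms s1 a by (intro has_real_derivative_powr_comp solD(3)[OF sol]) auto
  moreover have "v s powr (1 - 1 / m - 1) = inverse (F e (v s))"
    using decr_F(1)[OF assms] by (simp add: powr_minus)
  ultimately show ?thesis by (simp only: divide_inverse mult.assoc mult.commute[of "inverse _"])
qed

lemma decr_pressure_le:
  assumes "s1 \<le> s" "s \<le> 1"
  shows "v s powr (1 - 1 / m) \<le> e powr (1 - 1 / m) + 2 * K\<^sup>2 * (1 - s)"
proof -
  have "(- (2 * K\<^sup>2)) * (1 - s) \<le> v 1 powr (1 - 1 / m) - v s powr (1 - 1 / m)"
  proof (rule increment_ge[OF \<open>s \<le> 1\<close> order_refl])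
    fix x assume "x \<in> {s..1}"
    then show "((\<lambda>s. v s powr (1 - 1 / m)) has_real_derivative
        (1 - 1 / m) * ((A x * y x - B x * F e (v x)) / F e (v x))) (at x within {s..1})"
      using pressure_derivative[of x] assms s1 a by (auto intro: has_field_derivative_subset)
  next
    fix x assume x: "s < x" "x < 1"
    have "(- (2 * K\<^sup>2)) \<le> (A x * y x - B x * F e (v x)) / F e (v x)"
      using decr_slope_ge[of x] decr_F(3)[of x] x assms by (simp add: pos_le_divide_eq)
    then have "(1 - 1 / m) * (- (2 * K\<^sup>2)) \<le> (1 - 1 / m) * ((A x * y x - B x * F e (v x)) / F e (v x))"
      using m by (intro mult_left_mono) auto
    moreover have "- (2 * K\<^sup>2) \<le> (1 - 1 / m) * (- (2 * K\<^sup>2))"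
      using m by (simp add: mult_left_le_one_le)
    ultimately show "- (2 * K\<^sup>2) \<le> (1 - 1 / m) * ((A x * y x - B x * F e (v x)) / F e (v x))"
      by linarith
  qed
  then show ?thesis using solD[OF sol] by simp
qed

text \<open>Where the reaction accumulated over the distance \<open>1 - s\<close> is small,
  \<open>A * y\<close> consumes at most \<open>k / 2 * F (v)\<close> out of
  \<open>B * F (v) \<ge> k * F (v)\<close>.\<close>

lemma decr_slope_le:
  assumes s: "s1 \<le> s" "s \<le> 1"
    and small: "l * K\<^sup>2 * (1 - s) * F e (v s) powr (p - 1) \<le> k / 2"
  shows "A s * y s - B s * F e (v s) \<le> - (k / 2) * F e (v s)"
proof -
  have s': "s \<in> {1/2..1}" using s s1 by auto
  note Fpos = decr_F(3)[OF s]
  have "A s * y s \<le> A s * (l * K * (1 - s) * F e (v s) powr p)"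
    using decr_y_le[OF s] bnd[OF s'] k by (intro mult_left_mono) auto
  also have "\<dots> \<le> K * (l * K * (1 - s) * F e (v s) powr p)"
    using bnd[OF s'] l K s by (intro mult_right_mono) auto
  also have "\<dots> = l * K\<^sup>2 * (1 - s) * F e (v s) powr (p - 1) * F e (v s)"
    using Fpos by (simp add: power2_eq_square powr_diff)
  also have "\<dots> \<le> k / 2 * F e (v s)"
    using small Fpos by (intro mult_right_mono) auto
  finally have "A s * y s \<le> k / 2 * F e (v s)" .
  moreover have "k * F e (v s) \<le> B s * F e (v s)"
    using bnd[OF s'] Fpos by (intro mult_right_mono) auto
  ultimately show ?thesis by (simp add: algebra_simps)
qed

text \<open>Integrating the bound on the slope of the pressure gives the interface behaviour
  \<open>v \<ge> const * (1 - s) powr (m / (m - 1))\<close>, with a constant that does not depend on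
  \<open>e\<close>.\<close>

lemma decr_pressure_ge:
  assumes s: "s1 \<le> s" "s \<le> 1"
    and small: "\<And>x. s \<le> x \<Longrightarrow> x \<le> 1 \<Longrightarrow> l * K\<^sup>2 * (1 - x) * F e (v x) powr (p - 1) \<le> k / 2"
  shows "(1 - 1 / m) * (k / 2) * (1 - s) \<le> v s powr (1 - 1 / m)"
proof -
  have "v 1 powr (1 - 1 / m) - v s powr (1 - 1 / m) \<le> (- ((1 - 1 / m) * (k / 2))) * (1 - s)"
  proof (rule increment_le[OF \<open>s \<le> 1\<close> order_refl])
    fix x assume "x \<in> {s..1}"
    then show "((\<lambda>s. v s powr (1 - 1 / m)) has_real_derivative
        (1 - 1 / m) * ((A x * y x - B x * F e (v x)) / F e (v x))) (at x within {s..1})"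
      using pressure_derivative[of x] s s1 a by (auto intro: has_field_derivative_subset)
  next
    fix x assume x: "s < x" "x < 1"
    have "(A x * y x - B x * F e (v x)) / F e (v x) \<le> - (k / 2)"
      using decr_slope_le[OF _ _ small, of x] decr_F(3)[of x] x s by (simp add: pos_divide_le_eq)
    then have "(1 - 1 / m) * ((A x * y x - B x * F e (v x)) / F e (v x)) \<le> (1 - 1 / m) * (- (k / 2))"
      using m by (intro mult_left_mono) auto
    then show "(1 - 1 / m) * ((A x * y x - B x * F e (v x)) / F e (v x)) \<le> - ((1 - 1 / m) * (k / 2))"
      by simp
  qed
  moreover have "0 \<le> v 1 powr (1 - 1 / m)" by simp
  ultimately show ?thesis unfolding mult_minus_left by linarith
qed

end

text \<open>Since neither \<open>d\<close> nor the bound depends on \<open>e\<close>,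
  \<open>a\<close> or \<open>l \<le> L\<close>, a limit of solutions cannot vanish next to the
  interface. The decrease of \<open>v\<close> near \<open>1\<close> is obtained by bootstrapping: as
  long as it lasts, the reaction is too small to stop it.\<close>

lemma lower_bound_near_one:
  assumes "0 \<le> L"
  obtains d where "0 < d" "d \<le> 1 / 2"
    "\<And>l e a v y s. sol l e a v y \<Longrightarrow> 0 < e \<Longrightarrow> e \<le> 1 \<Longrightarrow> 0 \<le> l \<Longrightarrow> l \<le> L \<Longrightarrow> 0 < a \<Longrightarrow> a \<le> 1/2 \<Longrightarrow>
       1 - d \<le> s \<Longrightarrow> s \<le> 1 \<Longrightarrow> e \<le> v s \<and> (1 - 1 / m) * (k / 2) * (1 - s) \<le> v s powr (1 - 1 / m)"
proof -
  \<comment> \<open>\<open>C\<close> bounds \<open>F (v) powr (p - 1)\<close>: while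
    \<open>v\<close> decreases, the pressure \<open>F (v) powr (m - 1)\<close> is at most
    \<open>1 + 2 * K\<^sup>2\<close> on \<open>{1/2..1}\<close>.\<close>
  define C where "C = (1 + 2 * K\<^sup>2) powr ((p - 1) / (m - 1))"
  have "0 < 1 + 2 * K\<^sup>2" by (intro add_pos_nonneg) auto
  then have C: "0 < C" by (simp add: C_def)
  define d where "d = min (1/2) (k / 2 / (L * K\<^sup>2 * C + 1))"
  have den: "0 < L * K\<^sup>2 * C + 1" using assms C by (intro add_nonneg_pos mult_nonneg_nonneg) auto
  then have d: "0 < d" using k by (simp add: d_def)
  have d2: "d \<le> 1/2" unfolding d_def by (rule min.cobounded1)
  note d = d d2
  have dL: "L * K\<^sup>2 * d * C \<le> k / 2"
  proof -
    have "d \<le> k / 2 / (L * K\<^sup>2 * C + 1)" unfolding d_def by (rule min.cobounded2)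
    then have "d * (L * K\<^sup>2 * C + 1) \<le> k / 2" by (simp only: pos_le_divide_eq[OF den])
    then show ?thesis using d by (simp add: algebra_simps)
  qed
  show ?thesis
  proof (rule that[OF d])
    fix l e a v y s
    assume sol: "sol l e a v y" and e: "0 < e" "e \<le> 1" and l: "0 \<le> l" "l \<le> L" and a: "0 < a" "a \<le> 1/2"
      and s: "1 - d \<le> s" "s \<le> 1"
    define g where "g x = A x * y x - B x * F e (v x)" for x
    have small: "l * K\<^sup>2 * (1 - x) * F e (v x) powr (p - 1) \<le> k / 2"
      if s1: "1 - d \<le> s1" "s1 \<le> x" "x \<le> 1" and dec: "\<And>s. s1 < s \<Longrightarrow> s < 1 \<Longrightarrow> A s * y s \<le> B s * F e (v s)"
      for s1 x
    proof -
      have h: "1/2 \<le> s1" "s1 \<le> 1" using d s1 by auto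
      note dp = sol e l(1) a h dec
      have "F e (v x) powr (m - 1) \<le> e powr (1 - 1 / m) + 2 * K\<^sup>2 * (1 - x)"
        using decr_pressure_le[OF dp s1(2,3)] decr_F(4)[OF dp s1(2,3)] by simp
      also have "\<dots> \<le> 1 + 2 * K\<^sup>2 * 1"
        using e m s1 h by (intro add_mono mult_left_mono powr_le1) auto
      finally have "(F e (v x) powr (m - 1)) powr ((p - 1) / (m - 1)) \<le> C"
        unfolding C_def using p m by (intro powr_mono2) auto
      then have FC: "F e (v x) powr (p - 1) \<le> C" using m by (simp add: powr_powr)
      have "l * K\<^sup>2 * (1 - x) * F e (v x) powr (p - 1) \<le> L * K\<^sup>2 * d * C"
        using l s1 assms d C FC by (intro mult_mono) auto
      with dL show ?thesis by simp
    qed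
    have "continuous_on {1 - d..1} g"
    proof -
      have "{1 - d..1} \<subseteq> {0<..1}" "{1 - d..1} \<subseteq> {a..1}" using d a by auto
      then show ?thesis unfolding g_def
        by (intro continuous_intros e continuous_on_subset[OF cont(1)] continuous_on_subset[OF cont(2)]
            continuous_on_subset[OF solD(5)[OF sol]] continuous_on_subset[OF solD(6)[OF sol]])
    qed
    \<comment> \<open>To the right of the last point \<open>s1\<close> with nonnegative slope
      \<open>v\<close> decreases, so the estimates hold on the closed interval and force a strictly
      negative slope at \<open>s1\<close> itself.\<close>
    have neg: "g x < 0" if x: "1 - d \<le> x" "x \<le> 1" for x
    proof (rule ccontr)
      assume "\<not> g x < 0"
      then obtain s1 where s1: "x \<le> s1" "s1 \<le> 1" "0 \<le> g s1" "\<And>t. s1 < t \<Longrightarrow> t \<le> 1 \<Longrightarrow> g t < 0"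
        using last_nonneg_point[OF \<open>continuous_on {1 - d..1} g\<close>, of x] x by auto
      have h: "1/2 \<le> s1" "s1 \<le> 1" using d s1 x by auto
      have dec: "\<And>s. s1 < s \<Longrightarrow> s < 1 \<Longrightarrow> A s * y s \<le> B s * F e (v s)"
        using s1(4) by (auto simp: g_def less_imp_le)
      have "g s1 \<le> - (k / 2) * F e (v s1)" unfolding g_def
        using s1 x by (intro decr_slope_le[OF sol e l(1) a h dec] small[of s1] dec) auto
      then show False using decr_F(3)[OF sol e l(1) a h dec, of s1] k s1(3)
        by (auto simp: h) (smt (verit) mult_pos_pos zero_less_divide_iff)
    qed
    have h: "1/2 \<le> 1 - d" "1 - d \<le> 1" using d by auto
    have dec: "\<And>s. 1 - d < s \<Longrightarrow> s < 1 \<Longrightarrow> A s * y s \<le> B s * F e (v s)"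
      using neg by (auto simp: g_def less_imp_le)
    show "e \<le> v s \<and> (1 - 1 / m) * (k / 2) * (1 - s) \<le> v s powr (1 - 1 / m)"
      using s by (intro conjI decr_ge[OF sol e l(1) a h dec] decr_pressure_ge[OF sol e l(1) a h dec] small[of "1 - d"] dec) auto
  qed
qed

text \<open>The reaction is integrated against \<open>v\<close> instead of \<open>s\<close>: as
  \<open>v' \<ge> - (2 * K\<^sup>2 * F)\<close>, one has
  \<open>F powr p \<ge> - F powr (p - 1) * v' / (2 * K\<^sup>2)\<close>, and the right side is a
  multiple of the derivative of \<open>v powr h\<close>. The result
  \<open>l * f powr (m + p - 1) = O(f)\<close>, up to the term with \<open>e\<close>, gives
  \<open>f = O(l powr (- 1 / (m + p - 2)))\<close> and explains the later choice of \<open>l\<close>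
  as a power of \<open>t\<close>.\<close>

lemma decr_flux_bounds:
  assumes sol: "sol l e a v y" and e: "0 < e" "e \<le> 1" and l: "0 \<le> l" and a: "0 < a" "a \<le> 1/2"
    and r: "0 < r" "r \<le> 1/2"
    and dec: "\<And>s. 1 - r \<le> s \<Longrightarrow> s \<le> 1 \<Longrightarrow> A s * y s \<le> B s * F e (v s)"
  defines "f \<equiv> F e (v (1 - r))" and "h \<equiv> (m + p - 1) / m"
  shows "y (1 - r) \<le> K / k * f"
    and "l * k / (2 * K\<^sup>2 * h) * (f powr (m + p - 1) - e powr h) \<le> 2 * K / k * f"
proof -
  have s1: "1 / 2 \<le> 1 - r" "1 - r \<le> 1" using r by auto
  note dp = sol e l a s1 dec[OF less_imp_le less_imp_le]
  have v0: "0 < v s" if "1 - r \<le> s" "s \<le> 1" for s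
    using decr_ge[OF dp that] e by simp
  have f: "0 < f" "f = v (1 - r) powr (1 / m)" using decr_F[OF dp, of "1 - r"] s1 by (auto simp: f_def)
  have h: "0 < h" "h - 1 = (p - 1) / m" using m p by (auto simp: h_def field_simps)
  show y0: "y (1 - r) \<le> K / k * f"
  proof (cases "0 \<le> y (1 - r)")
    case True
    have "k * y (1 - r) \<le> A (1 - r) * y (1 - r)"
      using bnd[of "1 - r"] s1 True by (intro mult_right_mono) auto
    also have "\<dots> \<le> B (1 - r) * f" using dec[of "1 - r"] r by (simp add: f_def)
    also have "\<dots> \<le> K * f" using bnd[of "1 - r"] s1 f by (intro mult_right_mono) auto
    finally show ?thesis using k by (simp add: field_simps)
  next
    case False
    moreover have "0 \<le> K / k * f" using K k f by simp
    ultimately show ?thesis by linarith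
  qed
  define c where "c = l * k / (2 * K\<^sup>2 * h)"
  \<comment> \<open>\<open>\<Phi>\<close> is nonincreasing: \<open>K * f * s\<close> dominates the
    source term of \<open>y\<close>, and \<open>c\<close> is fixed by
    \<open>c * h * 2 * K\<^sup>2 = l * k\<close>, so that the last term is paid for by the
    reaction.\<close>
  define \<Phi> where "\<Phi> s = y s - K * f * s - c * v s powr h" for s
  have "\<Phi> 1 - \<Phi> (1 - r) \<le> 0 * (1 - (1 - r))"
  proof (rule increment_le[where I = "{1 - r..1}"])
    fix s assume s: "s \<in> {1 - r..1}"
    then have sub: "{1 - r..1} \<subseteq> {a..1}" "s \<in> {a..1}" using s1 a by auto
    note dv = has_field_derivative_subset[OF solD(3)[OF sol sub(2)] sub(1)]
    note dy = has_field_derivative_subset[OF solD(4)[OF sol sub(2)] sub(1)]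
    have dx: "((\<lambda>s. K * f * s) has_real_derivative K * f) (at s within {1 - r..1})"
      using DERIV_cmult_Id by blast
    show "(\<Phi> has_real_derivative ((P s * F e (v s) - l * Q s * G e (v s)) - K * f -
        c * (h * v s powr (h - 1) * (A s * y s - B s * F e (v s))))) (at s within {1 - r..1})"
      unfolding \<Phi>_def
      by (intro DERIV_diff dy dx DERIV_cmult has_real_derivative_powr_comp dv v0) (use s in auto)
  next
    fix s assume "1 - r < s" "s < 1"
    then have s: "1 - r \<le> s" "s \<le> 1" "s \<in> {1/2..1}" using s1 by auto
    note F = decr_F[OF dp s(1,2)]
    have "P s * F e (v s) \<le> K * f"
      unfolding f_def using bnd[OF s(3)] K F(3) decr_F_mono[OF dp _ s(1,2)] by (intro mult_mono) auto
    moreover have "l * k * F e (v s) powr p \<le> l * Q s * G e (v s)"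
      using bnd[OF s(3)] l k F by (simp add: mult_left_mono mult_right_mono)
    moreover have "- (l * k * F e (v s) powr p) \<le> c * (h * v s powr (h - 1) * (A s * y s - B s * F e (v s)))"
    proof -
      have vF: "v s powr (h - 1) = F e (v s) powr (p - 1)" using F h by (simp add: powr_powr)
      have ch: "c * h = l * k / (2 * K\<^sup>2)" using h by (simp add: c_def)
      have "(c * h * F e (v s) powr (p - 1)) * (- (2 * K\<^sup>2 * F e (v s))) \<le>
          (c * h * F e (v s) powr (p - 1)) * (A s * y s - B s * F e (v s))"
        using l k K h by (intro mult_left_mono decr_slope_ge[OF dp s(1,2)]) (auto simp: ch)
      moreover have "(c * h * F e (v s) powr (p - 1)) * (- (2 * K\<^sup>2 * F e (v s))) =
          - (l * k * (F e (v s) powr (p - 1) * F e (v s)))"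
        using K by (simp add: ch)
      moreover have "F e (v s) powr (p - 1) * F e (v s) = F e (v s) powr p"
        using F(3) by (simp add: powr_diff)
      ultimately show ?thesis by (simp add: vF mult.assoc)
    qed
    ultimately show "(P s * F e (v s) - l * Q s * G e (v s)) - K * f -
        c * (h * v s powr (h - 1) * (A s * y s - B s * F e (v s))) \<le> 0" by linarith
  qed (use s1 in auto)
  moreover have "v (1 - r) powr h = f powr (m + p - 1)"
    using f m by (simp add: powr_powr h_def)
  ultimately have "c * (f powr (m + p - 1) - e powr h) \<le> y (1 - r) + K * f * r"
    using solD(1,2)[OF sol] by (simp add: \<Phi>_def algebra_simps)
  also have "\<dots> \<le> K / k * f + K / k * f"
  proof -
    have "K * f * r \<le> K / k * f * 1"
      using K k f r by (intro mult_mono) (auto simp: pos_le_divide_eq mult_left_le)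
    with y0 show ?thesis by simp
  qed
  finally show "c * (f powr (m + p - 1) - e powr h) \<le> 2 * K / k * f" by simp
qed

text \<open>While \<open>v\<close> decreases, \<open>F (v)\<close> stays \<open>O(t)\<close>, but it is at least of order \<open>t\<close> beyond a distance
  \<open>O(t powr (m - 1))\<close> from the interface. The reaction term is then of order \<open>t powr (2 - m)\<close> and pushes
  \<open>y\<close> above \<open>B F (v) / A = O(t)\<close>.\<close>

lemma large_parameter_slope_positive:
  assumes r: "0 < r" "r \<le> 1/2"
  obtains t0 where "0 < t0"
    "\<And>t e a v y. 0 < t \<Longrightarrow> t \<le> t0 \<Longrightarrow> sol (t powr - (m + p - 2)) e a v y \<Longrightarrow> 0 < e \<Longrightarrow> e \<le> 1 \<Longrightarrow>
      e powr (1 / m) \<le> t \<Longrightarrow> 0 < a \<Longrightarrow> a \<le> 1/2 \<Longrightarrow> \<exists>s\<in>{1 - r..1}. B s * F e (v s) < A s * y s"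
proof -
  \<comment> \<open>The constants follow the argument: \<open>f \<le> C1 * t\<close> for the value
    \<open>f\<close> of \<open>F (v)\<close> at \<open>1 - r\<close>;
    \<open>g * t powr (m - 1)\<close> is a distance from the interface on which the reaction stays
    small; \<open>b * t\<close> bounds \<open>F (v)\<close> from below beyond that distance;
    \<open>X\<close> bounds \<open>t powr (m - 1)\<close> so that this distance is at most
    \<open>r / 2\<close> and the closing inequality fails.\<close>
  define q where "q = m + p - 2"
  define h where "h = (m + p - 1) / m"
  define C2 where "C2 = 4 * K ^ 3 * h / k\<^sup>2"
  define C1 where "C1 = 2 + (2 * C2) powr (1 / q)"
  define g where "g = k / (2 * K\<^sup>2 * C1 powr (p - 1))"
  define b where "b = ((1 - 1 / m) * (k / 2) * g) powr (1 / (m - 1))"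
  define X where "X = min (r / (2 * g)) (r * k\<^sup>2 * b powr p / (8 * K * C1))"
  have q: "0 < q" and h: "0 < h" using m p by (auto simp: q_def h_def)
  have C2: "0 < C2" using K k h by (simp add: C2_def)
  have C1: "2 \<le> C1" by (simp add: C1_def)
  have C1q: "2 * C2 \<le> C1 powr q"
  proof -
    have "((2 * C2) powr (1 / q)) powr q \<le> C1 powr q"
      using q by (intro powr_mono2) (auto simp: C1_def)
    then show ?thesis using q C2 by (simp add: powr_powr)
  qed
  have g: "0 < g" using k K C1 by (simp add: g_def)
  have b: "0 < b" using k m g by (simp add: b_def)
  have X: "0 < X" using r g b k K C1 by (simp add: X_def)
  show ?thesis
  proof (rule that[of "X powr (1 / (m - 1))"])
    show "0 < X powr (1 / (m - 1))" using X by simp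
    fix t e a v y
    assume t: "0 < t" "t \<le> X powr (1 / (m - 1))" and sol': "sol (t powr - (m + p - 2)) e a v y"
      and e: "0 < e" "e \<le> 1" "e powr (1 / m) \<le> t" and a: "0 < a" "a \<le> 1/2"
    define l where "l = t powr - q"
    have l: "0 < l" using t by (simp add: l_def)
    have sol: "sol l e a v y" using sol' by (simp add: l_def q_def)
    have tX: "t powr (m - 1) \<le> X"
      using powr_mono2[of "m - 1" t "X powr (1 / (m - 1))"] t m X by (simp add: powr_powr)
    show "\<exists>s\<in>{1 - r..1}. B s * F e (v s) < A s * y s"
    proof (rule ccontr)
      assume "\<not> ?thesis"
      then have dec: "A s * y s \<le> B s * F e (v s)" if "1 - r \<le> s" "s \<le> 1" for s
        using that by force
      have s1: "1 / 2 \<le> 1 - r" "1 - r \<le> 1" using r by auto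
      note dp = sol e(1,2) less_imp_le[OF l] a s1 dec[OF less_imp_le less_imp_le]
      define f where "f = F e (v (1 - r))"
      have f: "0 < f" using decr_F(3)[OF dp, of "1 - r"] s1 by (simp add: f_def)
      note slope = decr_flux_bounds[OF sol e(1,2) less_imp_le[OF l] a r dec, folded f_def h_def]
      have fC: "f \<le> C1 * t"
      proof (rule ccontr)
        assume "\<not> f \<le> C1 * t"
        then have ft: "C1 * t < f" by simp
        have "2 * t \<le> C1 * t" using C1 t by simp
        with ft have "t \<le> f / 2" by simp
        \<comment> \<open>With \<open>t \<le> f / 2\<close> and
          \<open>e powr (1 / m) \<le> t\<close>, the interface value costs at most half of
          \<open>f powr (m + p - 1)\<close>.\<close>
        have "e powr h = (e powr (1 / m)) powr (m + p - 1)"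
          by (simp add: powr_powr h_def)
        also have "\<dots> \<le> (f / 2) powr (m + p - 1)"
          using e \<open>t \<le> f / 2\<close> m p by (intro powr_mono2) auto
        also have "\<dots> = f powr (m + p - 1) / 2 powr (m + p - 1)"
          using f by (simp add: powr_divide)
        also have "\<dots> \<le> f powr (m + p - 1) / 2 powr 1"
          using m p by (intro divide_left_mono powr_mono) auto
        finally have "f powr (m + p - 1) / 2 \<le> f powr (m + p - 1) - e powr h" by simp
        then have "l * k / (2 * K\<^sup>2 * h) * (f powr (m + p - 1) / 2) \<le>
            l * k / (2 * K\<^sup>2 * h) * (f powr (m + p - 1) - e powr h)"
          using l k K h by (intro mult_left_mono) auto
        also note slope(2)
        finally have "l * k / (2 * K\<^sup>2 * h) * (f powr (q + 1) / 2) \<le> 2 * K / k * f" by (simp add: q_def)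
        moreover have "f powr (q + 1) / 2 = f powr q / 2 * f" using f by (simp add: powr_add)
        ultimately have "(l * k / (2 * K\<^sup>2 * h) * (f powr q / 2)) * f \<le> (2 * K / k) * f"
          by (simp only: mult.assoc)
        then have "l * k / (2 * K\<^sup>2 * h) * (f powr q / 2) \<le> 2 * K / k"
          using f by (rule mult_right_le_imp_le)
        then have "f powr q \<le> 2 * C2 / l"
          using l k K h by (simp add: C2_def field_simps power2_eq_square power3_eq_cube)
        also have "\<dots> = 2 * C2 * t powr q" by (simp add: l_def powr_minus divide_inverse)
        also have "\<dots> \<le> C1 powr q * t powr q" by (intro mult_right_mono C1q) auto
        also have "\<dots> = (C1 * t) powr q" using C1 t by (simp add: powr_mult)
        also have "\<dots> < f powr q" using ft q C1 t by (intro powr_less_mono2) auto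
        finally show False by simp
      qed
      define d where "d = g * t powr (m - 1)"
      have d: "0 < d" "d \<le> r / 2"
      proof -
        show "0 < d" using g t by (simp add: d_def)
        have "t powr (m - 1) \<le> r / (2 * g)" using tX unfolding X_def by linarith
        then show "d \<le> r / 2" using g by (simp add: d_def field_simps)
      qed
      have dr: "1 - r \<le> 1 - d" "1 - d \<le> 1" using d r by auto
      have Ff: "F e (v s) \<le> f" if "1 - r \<le> s" "s \<le> 1" for s
        unfolding f_def using that by (intro decr_F_mono[OF dp]) auto
      have small: "l * K\<^sup>2 * (1 - s) * F e (v s) powr (p - 1) \<le> k / 2" if "1 - d \<le> s" "s \<le> 1" for s
      proof -
        have "F e (v s) \<le> C1 * t" using Ff[of s] that dr fC by simp
        then have "l * K\<^sup>2 * (1 - s) * F e (v s) powr (p - 1) \<le> l * K\<^sup>2 * d * (C1 * t) powr (p - 1)"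
          using l that d p by (intro mult_mono powr_mono2) auto
        also have "\<dots> = K\<^sup>2 * g * C1 powr (p - 1) * (t powr - q * t powr (m - 1) * t powr (p - 1))"
          using C1 t by (simp add: powr_mult l_def d_def)
        also have "t powr - q * t powr (m - 1) * t powr (p - 1) = 1"
          using t by (simp add: q_def flip: powr_add)
        also have "K\<^sup>2 * g * C1 powr (p - 1) * 1 = k / 2" using K C1 by (simp add: g_def)
        finally show ?thesis .
      qed
      have low: "b * t \<le> F e (v (1 - d))"
      proof -
        have "(1 - 1 / m) * (k / 2) * (1 - (1 - d)) \<le> v (1 - d) powr (1 - 1 / m)"
          by (rule decr_pressure_ge[OF dp dr small])
        also have "\<dots> = F e (v (1 - d)) powr (m - 1)" using decr_F(4)[OF dp dr] by simp
        finally have "((1 - 1 / m) * (k / 2) * g * t powr (m - 1)) powr (1 / (m - 1)) \<le>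
            (F e (v (1 - d)) powr (m - 1)) powr (1 / (m - 1))"
          using m k g by (intro powr_mono2) (auto simp: d_def)
        moreover have "0 < (1 - 1 / m) * (k / 2) * g" using m k g by simp
        then have "((1 - 1 / m) * (k / 2) * g * t powr (m - 1)) powr (1 / (m - 1)) = b * t"
          unfolding b_def using t m by (subst powr_mult) (auto simp: powr_powr)
        moreover have "(F e (v (1 - d)) powr (m - 1)) powr (1 / (m - 1)) = F e (v (1 - d))"
          using m decr_F(3)[OF dp dr] by (simp add: powr_powr)
        ultimately show ?thesis by simp
      qed
      have low': "b * t \<le> F e (v s)" if "1 - r \<le> s" "s \<le> 1 - d" for s
        using low decr_F_mono[OF dp that dr(2)] by simp
      have sub: "{1 - r..1} \<subseteq> {a..1}" using s1 a by auto
      \<comment> \<open>Between \<open>1 - r\<close> and \<open>1 - d\<close> the reaction is at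
        least \<open>l * k * (b * t) powr p\<close>; this lifts \<open>y (1 - r)\<close> above what
        the assumed decrease of \<open>v\<close> allows.\<close>
      have "y (1 - d) - y (1 - r) \<le> (K * f - l * k * (b * t) powr p) * ((1 - d) - (1 - r))"
      proof (rule increment_le[OF dr(1) _ solD(4)[OF sol]])
        fix s assume s: "1 - r < s" "s < 1 - d"
        then have s': "s \<in> {1/2..1}" using s1 d by auto
        have "P s * F e (v s) \<le> K * f"
          using bnd[OF s'] K s d Ff[of s] by (intro mult_mono) auto
        moreover have "l * k * (b * t) powr p \<le> l * Q s * G e (v s)"
          using bnd[OF s'] k l s d low'[of s] p b t decr_F(2)[OF dp, of s]
          by (intro mult_mono) (auto intro!: powr_mono2)
        ultimately show "P s * F e (v s) - l * Q s * G e (v s) \<le> K * f - l * k * (b * t) powr p" by simp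
      qed (use dr sub in auto)
      moreover have "- (K * d * f) \<le> y (1 - d)"
      proof -
        have "K * (1 - (1 - d)) * F e (v (1 - d)) \<le> K * d * f"
          using K d Ff[OF dr] by simp
        then show ?thesis using decr_y_ge[OF dp dr] by simp
      qed
      ultimately have "l * k * (b * t) powr p * (r - d) \<le> y (1 - r) + K * f * r"
        by (simp add: algebra_simps)
      also have "\<dots> \<le> K / k * f + K / k * f"
      proof -
        have "K * f * r \<le> K / k * f * 1"
          using K k f r by (intro mult_mono) (auto simp: pos_le_divide_eq mult_left_le)
        with slope(1) show ?thesis by simp
      qed
      also have "\<dots> \<le> 2 * K / k * (C1 * t)"
        using fC K k by (simp add: mult_left_mono divide_right_mono)
      finally have "l * k * (b * t) powr p * (r - d) \<le> 2 * K / k * (C1 * t)" .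
      moreover have "l * k * (b * t) powr p * (r / 2) \<le> l * k * (b * t) powr p * (r - d)"
        using l k d by (intro mult_left_mono) auto
      ultimately have "l * k * (b powr p * t powr p) * (r / 2) \<le> 2 * K / k * (C1 * t)"
        using b t by (simp add: powr_mult)
      then have "k * b powr p * (r / 2) * (l * t powr p) \<le> 2 * K / k * C1 * t" by (simp add: mult_ac)
      \<comment> \<open>By the choice of \<open>l\<close>,
        \<open>l * t powr p = t powr (2 - m)\<close>; multiplication by
        \<open>t powr (m - 2)\<close> isolates a fixed positive number on the left and
        \<open>t powr (m - 1)\<close> on the right.\<close>
      then have "(k * b powr p * (r / 2) * (l * t powr p)) * t powr (m - 2) \<le> (2 * K / k * C1 * t) * t powr (m - 2)"
        by (rule mult_right_mono) simp
      moreover have "l * t powr p * t powr (m - 2) = 1"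
        using t by (simp add: l_def q_def flip: powr_add)
      moreover have "t * t powr (m - 2) = t powr (m - 1)"
        using t powr_add[of t 1 "m - 2"] by simp
      ultimately have "k * b powr p * (r / 2) \<le> 2 * K / k * C1 * t powr (m - 1)"
        by (simp add: mult.assoc)
      also have "\<dots> \<le> 2 * K / k * C1 * (r * k\<^sup>2 * b powr p / (8 * K * C1))"
        using tX K k C1 unfolding X_def by (intro mult_left_mono) auto
      also have "\<dots> = k * b powr p * (r / 4)" using K k C1 by (simp add: power2_eq_square)
      finally show False using k b r by simp
    qed
  qed
qed

section \<open>Behaviour to the left of a point with positive slope\<close>

lemma flux_ratio_bounds:
  assumes "s \<in> {1/2..1}"
  shows "k / K \<le> B s / A s" "B s / A s \<le> K / k"
  using bnd[OF assms] k K by (auto intro!: frac_le)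

text \<open>The supremum \<open>s1\<close> of the points with positive slope borders an interval on
  which \<open>v\<close> decreases, so the estimates hold at \<open>s1\<close>; but the slope may
  vanish at \<open>s1\<close>. Continuity carries them to a nearby point \<open>s\<close> of
  strictly positive slope, at the price of the powers of \<open>2\<close>.\<close>

lemma last_positive_slope:
  assumes sol: "sol l e a v y" and e: "0 < e" "e \<le> 1" and l: "0 \<le> l" and a: "0 < a" "a \<le> 1/2"
    and r: "0 < r" "r \<le> 1/2" and er: "e powr (1 - 1 / m) \<le> K\<^sup>2 * r"
    and x: "x \<in> {1 - r..1}" "B x * F e (v x) < A x * y x"
  obtains s where "s \<in> {1 - r..1}" "B s * F e (v s) < A s * y s" "0 < F e (v s)"
    "v s \<le> 2 powr (m + 1) * F e (v s) powr m"
    "k / 2 < l * K\<^sup>2 * r * (2 * F e (v s)) powr (p - 1)"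
    "F e (v s) powr (m - 1) \<le> 2 powr (m - 1) * (3 * K\<^sup>2 * r)"
proof -
  define g where "g s = A s * y s - B s * F e (v s)" for s
  define S where "S = {s \<in> {1 - r..1}. 0 < g s}"
  define s1 where "s1 = Sup S"
  have S: "x \<in> S" "bdd_above S" "S \<subseteq> {1 - r..1}" using x by (auto simp: S_def g_def bdd_above_def)
  have "x \<le> s1" unfolding s1_def by (rule cSup_upper[OF S(1,2)])
  moreover have "s1 \<le> 1" unfolding s1_def using S by (intro cSup_least) auto
  ultimately have s1: "1 - r \<le> s1" "s1 \<le> 1" using x by auto
  have h: "1/2 \<le> s1" using s1 r by simp
  have dec: "A s * y s \<le> B s * F e (v s)" if "s1 < s" "s < 1" for s
  proof (rule ccontr)
    assume "\<not> ?thesis"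
    then have "s \<in> S" using that s1 by (auto simp: S_def g_def)
    then have "s \<le> s1" unfolding s1_def by (rule cSup_upper) fact
    with that show False by simp
  qed
  note dp = sol e l a h s1(2) dec
  have sub: "{1 - r..1} \<subseteq> {0<..1}" "{1 - r..1} \<subseteq> {a..1}" using r a by auto
  have cv: "continuous_on {1 - r..1} v" by (rule continuous_on_subset[OF solD(5)[OF sol] sub(2)])
  have cg: "continuous_on {1 - r..1} g"
    unfolding g_def by (intro continuous_intros e cv continuous_on_subset[OF cont(1) sub(1)]
      continuous_on_subset[OF cont(2) sub(1)] continuous_on_subset[OF solD(6)[OF sol] sub(2)])
  have near: "\<exists>s\<in>S. P s" if P: "\<forall>\<^sub>F s in at s1 within {1 - r..1}. P s" "P s1" for P
  proof -
    obtain d where d: "0 < d" "\<And>s. s \<in> {1 - r..1} \<Longrightarrow> dist s s1 < d \<Longrightarrow> P s"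
      using P unfolding eventually_at by metis
    obtain s where "s \<in> S" "s1 - d < s"
      using less_cSupE[of "s1 - d" S] S d(1) by (auto simp: s1_def)
    moreover have "s \<le> s1" unfolding s1_def by (rule cSup_upper) fact+
    ultimately show ?thesis using d(2)[of s] S(3) by (auto simp: dist_real_def intro!: bexI[of _ s])
  qed
  have g1: "0 \<le> g s1"
  proof (rule ccontr)
    assume "\<not> 0 \<le> g s1"
    then have "\<forall>\<^sub>F s in at s1 within {1 - r..1}. g s < 0" "g s1 < 0"
      using cg s1 by (auto simp: continuous_on_def intro!: order_tendstoD(2)[where a = 0])
    from near[OF this] show False by (auto simp: S_def)
  qed
  define f where "f = F e (v s1)"
  have f: "0 < f" "f powr m = v s1"
    using decr_F[OF dp order_refl s1(2)] decr_ge[OF dp order_refl s1(2)] e m by (auto simp: f_def powr_powr)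
  \<comment> \<open>If the reaction were smaller, \<open>decr_slope_le\<close> would make the slope
    at \<open>s1\<close> strictly negative.\<close>
  have A1: "k / 2 < l * K\<^sup>2 * r * f powr (p - 1)"
  proof (rule ccontr)
    assume "\<not> ?thesis"
    then have le: "l * K\<^sup>2 * r * f powr (p - 1) \<le> k / 2" by (simp only: not_less)
    have "l * K\<^sup>2 * (1 - s1) * f powr (p - 1) \<le> l * K\<^sup>2 * r * f powr (p - 1)"
      using l s1 by (intro mult_left_mono mult_right_mono) auto
    then have "l * K\<^sup>2 * (1 - s1) * f powr (p - 1) \<le> k / 2" using le by (rule order_trans)
    then have "g s1 \<le> - (k / 2) * f"
      unfolding g_def f_def by (intro decr_slope_le[OF dp order_refl s1(2)])
    moreover have "0 < k / 2 * f" using k f by simp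
    ultimately show False using g1 by simp
  qed
  have A2: "f powr (m - 1) \<le> 3 * K\<^sup>2 * r"
  proof -
    have "f powr (m - 1) \<le> e powr (1 - 1 / m) + 2 * K\<^sup>2 * (1 - s1)"
      using decr_pressure_le[OF dp order_refl s1(2)] decr_F(4)[OF dp order_refl s1(2)] by (simp add: f_def)
    also have "\<dots> \<le> K\<^sup>2 * r + 2 * K\<^sup>2 * r"
      using er s1 by (intro add_mono mult_left_mono) auto
    finally show ?thesis by (simp add: mult_ac)
  qed
  have "continuous_on {1 - r..1} (\<lambda>s. F e (v s))" by (intro continuous_intros e cv)
  then have "\<forall>\<^sub>F s in at s1 within {1 - r..1}. f / 2 < F e (v s)"
    using s1 f by (intro order_tendstoD(1)[where y = f]) (auto simp: continuous_on_def f_def)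
  moreover have "\<forall>\<^sub>F s in at s1 within {1 - r..1}. v s < 2 * v s1"
  proof (rule order_tendstoD(2))
    show "(v \<longlongrightarrow> v s1) (at s1 within {1 - r..1})" using cv s1 by (auto simp: continuous_on_def)
    have "0 < v s1" using f by (metis powr_gt_zero less_irrefl)
    then show "v s1 < 2 * v s1" by simp
  qed
  ultimately have "\<forall>\<^sub>F s in at s1 within {1 - r..1}. f / 2 < F e (v s) \<and> v s < 2 * v s1"
    by (rule eventually_conj)
  moreover have "0 < v s1" using f by (metis powr_gt_zero less_irrefl)
  ultimately obtain s where s: "s \<in> S" "f / 2 < F e (v s)" "v s < 2 * v s1"
    using near[of "\<lambda>s. f / 2 < F e (v s) \<and> v s < 2 * v s1"] f by (auto simp: f_def)
  define G' where "G' = F e (v s)"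
  have G': "0 < G'" "f < 2 * G'" using s f by (auto simp: G'_def)
  have "0 < v s" using G' reg_nonpos[of "v s" "1 / m" e] by (cases "v s \<le> 0") (auto simp: G'_def)
  show ?thesis
  proof (rule that[of s])
    show "s \<in> {1 - r..1}" "B s * F e (v s) < A s * y s" "0 < F e (v s)"
      using s G' by (auto simp: S_def g_def G'_def)
    have "v s \<le> 2 * f powr m" using s f by simp
    also have "\<dots> \<le> 2 * (2 * G') powr m" using f G' m by (intro mult_left_mono powr_mono2) auto
    also have "\<dots> = 2 powr (m + 1) * G' powr m" using G' by (simp add: powr_mult powr_add)
    finally show "v s \<le> 2 powr (m + 1) * F e (v s) powr m" by (simp add: G'_def)
    have "l * K\<^sup>2 * r * f powr (p - 1) \<le> l * K\<^sup>2 * r * (2 * G') powr (p - 1)"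
      using l r f G' p by (intro mult_left_mono powr_mono2) auto
    with A1 show "k / 2 < l * K\<^sup>2 * r * (2 * F e (v s)) powr (p - 1)" by (simp add: G'_def)
    have "G' powr m \<le> v s" unfolding G'_def using \<open>0 < v s\<close> e by (intro F_powr_m_le) auto
    also have "\<dots> \<le> 2 powr 1 * f powr m" using s f by simp
    also have "\<dots> \<le> 2 powr m * f powr m" using m by (intro mult_right_mono powr_mono) auto
    also have "\<dots> = (2 * f) powr m" using f by (simp add: powr_mult)
    finally have "G' powr m \<le> (2 * f) powr m" .
    moreover have "(2 * f) powr m < G' powr m" if "2 * f < G'"
      using that m f by (intro powr_less_mono2) auto
    ultimately have "G' \<le> 2 * f" by force
    then have "G' powr (m - 1) \<le> (2 * f) powr (m - 1)" using G' m by (intro powr_mono2) auto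
    also have "\<dots> = 2 powr (m - 1) * f powr (m - 1)" using f by (simp add: powr_mult)
    also have "\<dots> \<le> 2 powr (m - 1) * (3 * K\<^sup>2 * r)" using A2 by (intro mult_left_mono) auto
    finally show "F e (v s) powr (m - 1) \<le> 2 powr (m - 1) * (3 * K\<^sup>2 * r)" by (simp add: G'_def)
  qed
qed

text \<open>To the left of a point with \<open>v' > 0\<close> the monotone ratio \<open>B / A\<close> keeps \<open>v' > 0\<close>. Either \<open>F (v)\<close> becomes small
  compared with its value \<open>f\<close> at that point, and then \<open>y\<close> of order \<open>f\<close> removes more than the available height
  \<open>O(f powr m)\<close> of \<open>v\<close>; or it stays comparable with \<open>f\<close>, and \<open>y\<close> becomes large with \<open>l\<close>.\<close>

lemma positive_slope_imp_crossing:
  obtains r L0 where "0 < r" "r \<le> 1/4" "0 < L0"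
    "\<And>l e a v y x. sol l e a v y \<Longrightarrow> 0 < e \<Longrightarrow> e \<le> 1 \<Longrightarrow> e powr (1 - 1 / m) \<le> K\<^sup>2 * r \<Longrightarrow> L0 \<le> l \<Longrightarrow>
      0 < a \<Longrightarrow> a \<le> 1/2 \<Longrightarrow> (\<And>s. s \<in> {1/2..1} \<Longrightarrow> 0 \<le> v s) \<Longrightarrow> x \<in> {1 - r..1} \<Longrightarrow>
      B x * F e (v x) < A x * y x \<Longrightarrow> False"
proof -
  define h where "h = k\<^sup>2 / (4 * K\<^sup>2)"
  \<comment> \<open>\<open>h\<close> separates small from comparable values of \<open>F (v)\<close>:
    the flux never falls below \<open>k / (2 * K) * f\<close> on \<open>{1/2..s'}\<close>, while
    \<open>B / A * F (v)\<close> is at most half of that once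
    \<open>F (v) \<le> h * f\<close>.\<close>
  have h: "0 < h" using k K by (simp add: h_def)
  have kK: "k * k \<le> k" using k mult_left_mono[of k 1 k] by simp
  \<comment> \<open>The three bounds on \<open>r\<close> give \<open>s' \<ge> 3 / 4\<close>, a
    reaction at least twice the source wherever \<open>F (v) \<ge> h * f\<close>, and a height of
    order \<open>f powr m\<close> that is small compared with \<open>f\<close>.\<close>
  define r where "r = Min {1/4, (h / 2) powr (p - 1) * k\<^sup>2 / (4 * K ^ 3), k\<^sup>2 / (100 * K ^ 3 * 4 powr m)}"
  have r: "0 < r" "r \<le> 1/4" "r \<le> (h / 2) powr (p - 1) * k\<^sup>2 / (4 * K ^ 3)"
      "r \<le> k\<^sup>2 / (100 * K ^ 3 * 4 powr m)"
    using h k K by (auto simp: r_def)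
  define L0 where "L0 = 1 + 512 * 2 powr (m + 1) / (k\<^sup>2 * h powr p)"
  have L0: "0 < L0" using k h by (auto simp: L0_def intro!: add_pos_nonneg)
  show ?thesis
  proof (rule that[OF r(1,2) L0])
    fix l e a v y x
    assume sol: "sol l e a v y" and e: "0 < e" "e \<le> 1" and er: "e powr (1 - 1 / m) \<le> K\<^sup>2 * r"
      and l: "L0 \<le> l" and a: "0 < a" "a \<le> 1/2" and v0: "\<And>s. s \<in> {1/2..1} \<Longrightarrow> 0 \<le> v s"
      and x: "x \<in> {1 - r..1}" "B x * F e (v x) < A x * y x"
    have l0: "0 < l" using l L0 by simp
    have r2: "r \<le> 1/2" using r by simp
    obtain s' where s': "s' \<in> {1 - r..1}" "B s' * F e (v s') < A s' * y s'" "0 < F e (v s')"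
      "v s' \<le> 2 powr (m + 1) * F e (v s') powr m"
      "k / 2 < l * K\<^sup>2 * r * (2 * F e (v s')) powr (p - 1)"
      "F e (v s') powr (m - 1) \<le> 2 powr (m - 1) * (3 * K\<^sup>2 * r)"
      using last_positive_slope[OF sol e less_imp_le[OF l0] a r(1) r2 er x] .
    define f where "f = F e (v s')"
    note s' = s'[folded f_def]
    have s3: "3/4 \<le> s'" "s' \<le> 1" using s' r by auto
    define D where "D s = B s / A s" for s
    have D: "k / K \<le> D s" "D s \<le> K / k" if "s \<in> {1/2..1}" for s
      using flux_ratio_bounds[OF that] by (auto simp: D_def)
    have Dm: "D s \<le> D t" if "1/2 \<le> s" "s \<le> t" "t \<le> 1" for s t
      using ratio[of s t] that by (simp add: D_def)
    \<comment> \<open>\<open>E\<close> is the slope of \<open>v\<close> divided by \<open>A\<close>;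
      the monotonicity of \<open>D\<close> is what controls its sign.\<close>
    define E where "E s = y s - D s * F e (v s)" for s
    have AE: "A s * y s - B s * F e (v s) = A s * E s" if "s \<in> {1/2..1}" for s
      using bnd[OF that] k by (simp add: E_def D_def right_diff_distrib)
    have Es': "0 < E s'"
    proof -
      have "0 < A s' * E s'" using AE[of s'] s'(2) s3 by (simp add: f_def)
      then show ?thesis using bnd[of s'] k s3 by (simp add: zero_less_mult_iff)
    qed
    have sub: "{1/2..1} \<subseteq> {a..1}" using a by auto
    have slope_y: "P s * F e (v s) - l * Q s * G e (v s) \<le> K * F e (v s) - l * k * F e (v s) powr p"
      if s: "s \<in> {1/2..1}" for s
    proof -
      have "P s * F e (v s) \<le> K * F e (v s)" using bnd[OF s] by (intro mult_right_mono) auto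
      moreover have "l * k * F e (v s) powr p \<le> l * Q s * G e (v s)"
        using bnd[OF s] l0 k reg_powr_le[OF e(1) p, of "v s"] by (intro mult_mono) auto
      ultimately show ?thesis by simp
    qed
    have growth: "K * F e (v s) - l * k * F e (v s) powr p \<le> - (l * k * F e (v s) powr p / 2)"
      if "h * f \<le> F e (v s)" for s
    proof -
      define w where "w = F e (v s)"
      have w: "h * f \<le> w" "0 < w" using that h s'(3) by (auto simp: w_def intro: less_le_trans[of 0 "h * f"])
      have "2 * K * (2 * K\<^sup>2 * r) \<le> 2 * K * (2 * K\<^sup>2 * ((h / 2) powr (p - 1) * k\<^sup>2 / (4 * K ^ 3)))"
        using K r by (intro mult_left_mono) auto
      also have "\<dots> = (h / 2) powr (p - 1) * k * k"
        using K by (simp add: power2_eq_square power3_eq_cube)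
      also have "\<dots> \<le> (h / 2) powr (p - 1) * k * (2 * (l * K\<^sup>2 * r * (2 * f) powr (p - 1)))"
        using s'(5) h k by (intro mult_left_mono) auto
      also have "\<dots> = (l * k * ((h / 2) powr (p - 1) * (2 * f) powr (p - 1))) * (2 * K\<^sup>2 * r)" by simp
      also have "(h / 2) powr (p - 1) * (2 * f) powr (p - 1) = (h * f) powr (p - 1)"
        using h s'(3) by (simp add: powr_mult[symmetric])
      finally have "2 * K \<le> l * k * (h * f) powr (p - 1)" using K r by (simp add: mult_ac)
      also have "\<dots> \<le> l * k * w powr (p - 1)"
        using l0 k w h s'(3) p by (intro mult_left_mono powr_mono2) auto
      finally have "2 * K * w \<le> l * k * w powr (p - 1) * w" using w by simp
      also have "\<dots> = l * k * w powr p" using w by (simp add: powr_diff)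
      finally show ?thesis by (simp add: w_def)
    qed
    have slope_y': "P s * F e (v s) - l * Q s * G e (v s) \<le> K * h * f" if s: "s \<in> {1/2..1}" for s
    proof (cases "h * f \<le> F e (v s)")
      case True
      have "0 \<le> l * k * F e (v s) powr p / 2" "0 \<le> K * h * f" using l0 k K h s'(3) by auto
      then show ?thesis using slope_y[OF s] growth[OF True] by linarith
    next
      case False
      have "0 \<le> l * k * F e (v s) powr p" using l0 k by simp
      moreover have "K * F e (v s) \<le> K * (h * f)" using False K by (intro mult_left_mono) auto
      ultimately show ?thesis using slope_y[OF s] by simp
    qed
    \<comment> \<open>\<open>E s' > 0\<close> gives \<open>y s' \<ge> k / K * f\<close>; on the way
      left at most \<open>K * h * f / 2\<close> is lost, as \<open>y' \<le> K * h * f\<close>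
      whether \<open>F (v)\<close> is comparable with \<open>f\<close> or not.\<close>
    have ylow: "k / (2 * K) * f \<le> y s" if s: "1/2 \<le> s" "s \<le> s'" for s
    proof -
      have "y s' - y s \<le> (K * h * f) * (s' - s)"
        by (rule increment_le[OF s(2) _ solD(4)[OF sol]]) (use sub s s3 slope_y' a in auto)
      also have "\<dots> \<le> (K * h * f) * (1 / 2)"
        using K h s'(3) s s3 by (intro mult_left_mono) auto
      also have "K * h * f * (1 / 2) \<le> k / (8 * K) * f"
      proof -
        have "K * h * (1 / 2) = k * k / (8 * K)" using K by (simp add: h_def power2_eq_square)
        also have "\<dots> \<le> k / (8 * K)" using kK K by (intro divide_right_mono) auto
        finally have "K * h * (1 / 2) * f \<le> k / (8 * K) * f" using s'(3) by (intro mult_right_mono) auto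
        then show ?thesis by (simp only: mult_ac)
      qed
      finally have "y s' - k / (8 * K) * f \<le> y s" by simp
      moreover have "k / K * f \<le> y s'"
        using Es' mult_right_mono[OF D(1)[of s'], of f] s3 s'(3) by (simp add: E_def f_def)
      moreover have "k / (2 * K) * f \<le> k / K * f - k / (8 * K) * f"
        using k K s'(3) by (simp add: field_simps)
      ultimately show ?thesis by linarith
    qed
    have Ky: "K / k * (h * f) < k / (2 * K) * f"
    proof -
      have "K / k * h = k / (4 * K)" using k K by (simp add: h_def power2_eq_square)
      moreover have "k / (4 * K) < k / (2 * K)" using k K by (intro divide_strict_left_mono) auto
      ultimately have "K / k * h * f < k / (2 * K) * f" using s'(3) by (intro mult_strict_right_mono) auto
      then show ?thesis by (simp only: mult.assoc)
    qed
    have cont_E: "continuous_on {1/2..s'} (\<lambda>s. - E s)"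
    proof -
      have sub': "{1/2..s'} \<subseteq> {0<..1}" "{1/2..s'} \<subseteq> {a..1}" using s3 a by auto
      have "A s \<noteq> 0" if "s \<in> {1/2..s'}" for s using bnd[of s] k s3 that by auto
      then show ?thesis unfolding E_def D_def
        by (intro continuous_intros e continuous_on_subset[OF cont(1) sub'(1)]
            continuous_on_subset[OF cont(2) sub'(1)] continuous_on_subset[OF solD(5)[OF sol] sub'(2)]
            continuous_on_subset[OF solD(6)[OF sol] sub'(2)]) auto
    qed
    have vmono_gen: "v t1 \<le> v t2" if t: "1/2 \<le> t1" "t1 \<le> t2" "t2 \<le> s'"
      and E0: "\<And>s. t1 < s \<Longrightarrow> s < t2 \<Longrightarrow> 0 \<le> E s" for t1 t2
    proof -
      have "0 * (t2 - t1) \<le> v t2 - v t1"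
      proof (rule increment_ge[OF t(2) _ solD(3)[OF sol]])
        fix s assume s: "t1 < s" "s < t2"
        then have s': "s \<in> {1/2..1}" using t s3 by auto
        have "0 \<le> A s" using bnd[OF s'] k by linarith
        then show "0 \<le> A s * y s - B s * F e (v s)"
          unfolding AE[OF s'] by (intro mult_nonneg_nonneg E0 s)
      qed (use t s3 a in auto)
      then show ?thesis by simp
    qed
    have Epos: "0 < E s" if s: "1/2 \<le> s" "s \<le> s'" for s
    proof (rule ccontr)
      assume "\<not> 0 < E s"
      then obtain s2 where s2: "s \<le> s2" "s2 \<le> s'" "0 \<le> - E s2" "\<And>t. s2 < t \<Longrightarrow> t \<le> s' \<Longrightarrow> - E t < 0"
        using last_nonneg_point[OF cont_E, of s] s by auto
      have s2h: "s2 \<in> {1/2..1}" using s2 s s3 by auto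
      have yD: "y s2 \<le> D s2 * F e (v s2)" using s2(3) by (simp add: E_def)
      have vs2: "v s2 \<le> v t" if "s2 \<le> t" "t \<le> s'" for t
        using that s2 s by (intro vmono_gen) (auto simp: less_imp_le)
      \<comment> \<open>If \<open>F (v)\<close> is comparable with \<open>f\<close> at the last
        point \<open>s2\<close> with \<open>E \<le> 0\<close>, then from \<open>s2\<close> to
        \<open>s'\<close> the function \<open>v\<close> does not decrease and \<open>y\<close> does
        not increase, so \<open>y s' \<le> D s2 * F (v s2) \<le> D s' * f\<close> contradicts
        \<open>E s' > 0\<close>. Otherwise the lower bound on \<open>y\<close> already exceeds
        \<open>D * F (v)\<close>.\<close>
      show False
      proof (cases "h * f \<le> F e (v s2)")
        case True
        have "y s' - y s2 \<le> 0 * (s' - s2)"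
        proof (rule increment_le[OF s2(2) _ solD(4)[OF sol]])
          fix t assume t: "s2 < t" "t < s'"
          have "F e (v s2) \<le> F e (v t)" using vs2[of t] t e by (intro F_mono) auto
          then have "h * f \<le> F e (v t)" using True by linarith
          note growth[OF this]
          moreover have "P t * F e (v t) - l * Q t * G e (v t) \<le> K * F e (v t) - l * k * F e (v t) powr p"
            using t s2h s3 by (intro slope_y) auto
          moreover have "0 \<le> l * k * F e (v t) powr p" using l0 k by simp
          ultimately show "P t * F e (v t) - l * Q t * G e (v t) \<le> 0" by linarith
        qed (use s2h s3 a in auto)
        then have "y s' \<le> y s2" by simp
        moreover have "D s2 * F e (v s2) \<le> D s' * f"
        proof (intro mult_mono)
          show "F e (v s2) \<le> f" unfolding f_def using vs2[of s'] s2 e by (intro F_mono) auto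
          show "D s2 \<le> D s'" using s2h s2 s3 by (intro Dm) auto
          have "0 < k / K" using k K by simp
          then show "0 \<le> D s'" using D(1)[of s'] s3 by (auto intro: less_imp_le[OF less_le_trans])
        qed auto
        ultimately show False using yD Es' by (simp add: E_def f_def)
      next
        case False
        have "D s2 * F e (v s2) \<le> K / k * (h * f)"
          using D(2)[OF s2h] False K k by (intro mult_mono) auto
        then show False using ylow[of s2] s2 s yD Ky by simp
      qed
    qed
    have vmono: "v t1 \<le> v t2" if "1/2 \<le> t1" "t1 \<le> t2" "t2 \<le> s'" for t1 t2
      using that by (intro vmono_gen less_imp_le[OF Epos]) auto
    have Fle: "F e (v t) \<le> f" if "1/2 \<le> t" "t \<le> s'" for t
      unfolding f_def using vmono[OF that(1) that(2)] e by (intro F_mono) auto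
    have v_upper: "v t \<le> 2 powr (m + 1) * f powr m" if "1/2 \<le> t" "t \<le> s'" for t
      using vmono[OF that order_refl] s'(4) by (simp add: f_def)
    have fm: "f powr m = f powr (m - 1) * f" using s'(3) by (simp add: powr_diff)
    \<comment> \<open>The points \<open>5/8\<close> and \<open>11/16\<close> lie between
      \<open>1/2\<close> and \<open>s' \<ge> 3/4\<close> and leave fixed lengths for both
      alternatives. If \<open>F (v)\<close> is small at \<open>5/8\<close>, the slope on
      \<open>{1/2..5/8}\<close> is of order \<open>f\<close>; if not, on \<open>{5/8..11/16}\<close>
      the flux exceeds its value at \<open>s'\<close> by order \<open>l * f powr p\<close>. Either
      rise of \<open>v\<close> exceeds the available height.\<close>
    show False
    proof (cases "F e (v (5/8)) < h * f")
      case True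
      have "(k * (k / (4 * K) * f)) * (5/8 - 1/2) \<le> v (5/8) - v (1/2)"
      proof (rule increment_ge[OF _ _ solD(3)[OF sol]])
        fix s :: real assume s: "1/2 < s" "s < 5/8"
        then have s': "s \<in> {1/2..1}" by auto
        have "F e (v s) \<le> h * f"
          using F_mono[OF e(1) vmono[of s "5/8"]] s s3 True by simp
        then have "D s * F e (v s) \<le> K / k * (h * f)"
          using D(2)[OF s'] K k by (intro mult_mono) auto
        moreover have "K / k * (h * f) = k / (4 * K) * f" using k K by (simp add: h_def power2_eq_square)
        moreover have "k / (2 * K) * f \<le> y s" using s s3 by (intro ylow) auto
        ultimately have "k / (4 * K) * f \<le> E s" by (simp add: E_def field_simps)
        then have "k * (k / (4 * K) * f) \<le> A s * E s"
          using bnd[OF s'] k K \<open>0 < f\<close> by (intro mult_mono) auto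
        then show "k * (k / (4 * K) * f) \<le> A s * y s - B s * F e (v s)" by (simp add: AE[OF s'])
      qed (use a in auto)
      also have "\<dots> \<le> v (5/8)" using v0[of "1/2"] by simp
      also have "\<dots> \<le> 2 powr (m + 1) * f powr m" using s3 by (intro v_upper) auto
      finally have "(k\<^sup>2 / (32 * K)) * f \<le> (2 powr (m + 1) * f powr (m - 1)) * f"
        by (simp add: fm power2_eq_square)
      then have "k\<^sup>2 / (32 * K) \<le> 2 powr (m + 1) * f powr (m - 1)"
        using \<open>0 < f\<close> by (rule mult_right_le_imp_le)
      also have "\<dots> \<le> 2 powr (m + 1) * (2 powr (m - 1) * (3 * K\<^sup>2 * r))"
        using s'(6) by (intro mult_left_mono) (auto simp: f_def)
      also have "\<dots> = 4 powr m * (3 * K\<^sup>2 * r)"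
      proof -
        have "(2::real) powr (m + 1) * 2 powr (m - 1) = (2 powr 2) powr m"
          by (simp only: powr_powr flip: powr_add) simp
        then show ?thesis by simp
      qed
      also have "\<dots> \<le> 4 powr m * (3 * K\<^sup>2 * (k\<^sup>2 / (100 * K ^ 3 * 4 powr m)))"
        using r by (intro mult_left_mono) auto
      also have "\<dots> = 3 * k\<^sup>2 / (100 * K)" using K by (simp add: power2_eq_square power3_eq_cube)
      also have "\<dots> < k\<^sup>2 / (32 * K)" using k K by (simp add: divide_simps)
      finally show False by simp
    next
      case False
      have Fge: "h * f \<le> F e (v s)" if "5/8 \<le> s" "s \<le> s'" for s
        using F_mono[OF e(1) vmono[of "5/8" s]] that False by simp
      define c where "c = l * k * (h * f) powr p / 2"
      have c: "0 < c" using l0 k h \<open>0 < f\<close> by (simp add: c_def)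
      have "(k * (c / 16)) * (11/16 - 5/8) \<le> v (11/16) - v (5/8)"
      proof (rule increment_ge[OF _ _ solD(3)[OF sol]])
        fix s :: real assume s: "5/8 < s" "s < 11/16"
        then have sh: "s \<in> {1/2..1}" by auto
        have "y s' - y s \<le> (- c) * (s' - s)"
        proof (rule increment_le[OF _ _ solD(4)[OF sol]])
          fix t assume t: "s < t" "t < s'"
          then have "h * f \<le> F e (v t)" using s by (intro Fge) auto
          then have "(h * f) powr p \<le> F e (v t) powr p" using h \<open>0 < f\<close> p by (intro powr_mono2) auto
          then have "c \<le> l * k * F e (v t) powr p / 2"
            unfolding c_def using l0 k by (intro divide_right_mono mult_left_mono) auto
          then show "P t * F e (v t) - l * Q t * G e (v t) \<le> - c"
            using growth[OF \<open>h * f \<le> F e (v t)\<close>] slope_y[of t] t s s3 by auto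
        qed (use s s3 a in auto)
        also have "\<dots> \<le> (- c) * (1 / 16)" using c s s3 by (intro mult_left_mono_neg) auto
        finally have "y s' + c / 16 \<le> y s" by simp
        moreover have "D s * F e (v s) \<le> D s' * f"
        proof (intro mult_mono Fle Dm)
          have "0 < k / K" using k K by simp
          then show "0 \<le> D s'" using D(1)[of s'] s3 by (auto intro: less_imp_le[OF less_le_trans])
        qed (use s s3 in auto)
        ultimately have "c / 16 \<le> E s" using Es' by (simp add: E_def f_def)
        then have "k * (c / 16) \<le> A s * E s"
          using bnd[OF sh] k c by (intro mult_mono) auto
        then show "k * (c / 16) \<le> A s * y s - B s * F e (v s)" by (simp add: AE[OF sh])
      qed (use a in auto)
      also have "\<dots> \<le> v (11/16)" using v0[of "5/8"] by simp
      also have "\<dots> \<le> 2 powr (m + 1) * f powr m" using s3 by (intro v_upper) auto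
      finally have "k * c \<le> 256 * (2 powr (m + 1) * f powr m)" by simp
      \<comment> \<open>\<open>f \<le> 1\<close> by the third bound on \<open>r\<close>, so the
        height \<open>O(f powr m)\<close> is also \<open>O(f powr p)\<close>, and a large
        \<open>l\<close> suffices.\<close>
      moreover have "f powr m \<le> f powr p"
      proof -
        have "f powr (m - 1) \<le> 2 powr (m - 1) * (3 * K\<^sup>2 * r)" using s'(6) by (simp add: f_def)
        also have "\<dots> \<le> 4 powr m * (3 * K\<^sup>2 * r)"
        proof (rule mult_right_mono)
          have "(2::real) powr (m - 1) \<le> 2 powr m" by (rule powr_mono) auto
          also have "\<dots> \<le> 4 powr m" using m by (intro powr_mono2) auto
          finally show "(2::real) powr (m - 1) \<le> 4 powr m" .
        qed (use r in auto)
        also have "\<dots> \<le> 4 powr m * (3 * K\<^sup>2 * (k\<^sup>2 / (100 * K ^ 3 * 4 powr m)))"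
          using r by (intro mult_left_mono) auto
        also have "\<dots> = 3 * (k * k) / (100 * K)" using K by (simp add: power2_eq_square power3_eq_cube)
        also have "\<dots> \<le> 3 * 1 / (100 * 1)" using k K order_trans[OF kK k(2)] by (intro frac_le mult_left_mono) auto
        finally have "f powr (m - 1) \<le> 1" by simp
        then have "f \<le> 1" using powr_less_mono2[of "m - 1" 1 f] m by (auto simp: not_le[symmetric])
        then show ?thesis using \<open>0 < f\<close> p powr_mono'[of p m f] by simp
      qed
      ultimately have "k * c \<le> 256 * (2 powr (m + 1) * f powr p)"
        by (rule order_trans[OF _ mult_left_mono[OF mult_left_mono]]) auto
      then have "(l * (k\<^sup>2 * h powr p)) * f powr p \<le> (512 * 2 powr (m + 1)) * f powr p"
        using h \<open>0 < f\<close> by (simp add: c_def powr_mult power2_eq_square mult_ac)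
      then have "l * (k\<^sup>2 * h powr p) \<le> 512 * 2 powr (m + 1)"
        using \<open>0 < f\<close> by (simp add: mult_le_cancel_right)
      then have "l \<le> 512 * 2 powr (m + 1) / (k\<^sup>2 * h powr p)"
        using k h by (simp add: pos_le_divide_eq)
      then show False using l by (simp add: L0_def)
    qed
  qed
qed

text \<open>If \<open>y a < 0\<close>, then \<open>v \<ge> 0\<close> everywhere, and the two
  preceding results exclude each other. The order of choices matters: \<open>r\<close> comes from
  the crossing argument, \<open>t0\<close> depends on \<open>r\<close>, \<open>t\<close> is then
  lowered until \<open>l = t powr - q \<ge> L0\<close>, and \<open>e0\<close> is adapted to
  \<open>t\<close> last.\<close>

lemma large_parameter_flux_nonneg:
  obtains L e0 where "0 < L" "0 < e0" "e0 \<le> 1"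
    "\<And>e a v y. sol L e a v y \<Longrightarrow> 0 < e \<Longrightarrow> e \<le> e0 \<Longrightarrow> 0 < a \<Longrightarrow> a \<le> 1/2 \<Longrightarrow> 0 \<le> y a"
proof -
  obtain r L0 where r: "0 < r" "r \<le> 1/4" "0 < L0" and two: "\<And>l e a v y x. sol l e a v y \<Longrightarrow> 0 < e \<Longrightarrow>
      e \<le> 1 \<Longrightarrow> e powr (1 - 1 / m) \<le> K\<^sup>2 * r \<Longrightarrow> L0 \<le> l \<Longrightarrow>
      0 < a \<Longrightarrow> a \<le> 1/2 \<Longrightarrow> (\<And>s. s \<in> {1/2..1} \<Longrightarrow> 0 \<le> v s) \<Longrightarrow> x \<in> {1 - r..1} \<Longrightarrow>
      B x * F e (v x) < A x * y x \<Longrightarrow> False"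
    using positive_slope_imp_crossing by metis
  have r2: "r \<le> 1/2" using r by simp
  obtain t0 where t0: "0 < t0" and one: "\<And>t e a v y. 0 < t \<Longrightarrow> t \<le> t0 \<Longrightarrow>
      sol (t powr - (m + p - 2)) e a v y \<Longrightarrow> 0 < e \<Longrightarrow> e \<le> 1 \<Longrightarrow>
      e powr (1 / m) \<le> t \<Longrightarrow> 0 < a \<Longrightarrow> a \<le> 1/2 \<Longrightarrow> \<exists>s\<in>{1 - r..1}. B s * F e (v s) < A s * y s"
    using large_parameter_slope_positive[OF r(1) r2] by metis
  define q where "q = m + p - 2"
  have q: "0 < q" using m p by (simp add: q_def)
  define t where "t = min t0 (L0 powr (- 1 / q))"
  have t: "0 < t" "t \<le> t0" "t \<le> L0 powr (- 1 / q)" using t0 r by (auto simp: t_def)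
  have L0t: "L0 \<le> t powr - q"
  proof -
    have "(L0 powr (- 1 / q)) powr - q \<le> t powr - q" using t q by (intro powr_mono2') auto
    then show ?thesis using r q by (simp add: powr_powr)
  qed
  define e0 where "e0 = Min {1, t powr m, (K\<^sup>2 * r) powr (m / (m - 1))}"
  have e0: "0 < e0" "e0 \<le> 1" "e0 \<le> t powr m" "e0 \<le> (K\<^sup>2 * r) powr (m / (m - 1))"
    using t K r by (auto simp: e0_def)
  show ?thesis
  proof (rule that[of "t powr - q" e0])
    fix e a v y assume sol: "sol (t powr - q) e a v y" and e: "0 < e" "e \<le> e0" and a: "0 < a" "a \<le> 1/2"
    show "0 \<le> y a"
    proof (rule ccontr)
      assume ya: "\<not> 0 \<le> y a"
      have v0: "0 \<le> v s" if "s \<in> {1/2..1}" for s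
        using negative_imp_positive_flux[OF sol e(1) a(1), of s] that a ya by force
      have "e powr (1 / m) \<le> (t powr m) powr (1 / m)" using e e0 m by (intro powr_mono2) auto
      then have et: "e powr (1 / m) \<le> t" using m t by (simp add: powr_powr)
      have "e powr (1 - 1 / m) \<le> ((K\<^sup>2 * r) powr (m / (m - 1))) powr (1 - 1 / m)"
        using e e0 m by (intro powr_mono2) auto
      also have "\<dots> = (K\<^sup>2 * r) powr (m / (m - 1) * (1 - 1 / m))" by (simp add: powr_powr)
      also have "m / (m - 1) * (1 - 1 / m) = 1" using m by (simp add: field_simps)
      finally have er: "e powr (1 - 1 / m) \<le> K\<^sup>2 * r" using r K by simp
      obtain x where "x \<in> {1 - r..1}" "B x * F e (v x) < A x * y x"
        using one[OF t(1,2) sol[unfolded q_def] e(1) _ et a] e e0 by auto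
      then show False using two[OF sol e(1) _ er L0t a v0] e e0 by auto
    qed
  qed (use t e0 in auto)
qed

end

section \<open>Solutions for every parameter and the choice of a zero-flux parameter\<close>

lemma compact_Icc_pos_bounds:
  fixes f :: "real \<Rightarrow> real"
  assumes "continuous_on {a..b} f" "\<And>s. s \<in> {a..b} \<Longrightarrow> 0 < f s" "a \<le> b"
  obtains l u where "0 < l" "\<And>s. s \<in> {a..b} \<Longrightarrow> l \<le> f s \<and> f s \<le> u"
proof -
  obtain x where "x \<in> {a..b}" "\<forall>s\<in>{a..b}. f x \<le> f s"
    using continuous_attains_inf[OF compact_Icc _ assms(1)] assms(3) by auto
  moreover obtain z where "z \<in> {a..b}" "\<forall>s\<in>{a..b}. f s \<le> f z"
    using continuous_attains_sup[OF compact_Icc _ assms(1)] assms(3) by auto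
  ultimately show ?thesis using assms(2) by (intro that[of "f x" "f z"]) auto
qed

context shooting
begin

text \<open>The Lipschitz constants depend on \<open>e\<close> and \<open>a\<close> and degenerate
  with them; they serve only existence and continuity in \<open>l\<close> for fixed \<open>e\<close>
  and \<open>a\<close>.\<close>

lemma sol_exists:
  assumes e: "0 < e" and a: "0 < a" "a \<le> 1" and L: "0 \<le> L"
  obtains V Y where "\<And>l. l \<in> {0..L} \<Longrightarrow> sol l e a (V l) (Y l)" "continuous_on {0..L} (\<lambda>l. Y l a)"
proof -
  have sub: "{a..1} \<subseteq> {0<..1}" using a by auto
  have pos': "0 < A s" "0 < B s" "0 < P s" "0 < Q s" if "s \<in> {a..1}" for s
    using pos[of s] that a by auto
  obtain MA where MA: "\<And>s. s \<in> {a..1} \<Longrightarrow> A s \<le> MA"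
    using compact_Icc_pos_bounds[OF continuous_on_subset[OF cont(1) sub] pos'(1) a(2)] by metis
  obtain MB where MB: "\<And>s. s \<in> {a..1} \<Longrightarrow> B s \<le> MB"
    using compact_Icc_pos_bounds[OF continuous_on_subset[OF cont(2) sub] pos'(2) a(2)] by metis
  obtain MP where MP: "\<And>s. s \<in> {a..1} \<Longrightarrow> P s \<le> MP"
    using compact_Icc_pos_bounds[OF continuous_on_subset[OF cont(3) sub] pos'(3) a(2)] by metis
  obtain MQ where MQ: "\<And>s. s \<in> {a..1} \<Longrightarrow> Q s \<le> MQ"
    using compact_Icc_pos_bounds[OF continuous_on_subset[OF cont(4) sub] pos'(4) a(2)] by metis
  have one: "1 \<in> {a..1}" using a by simp
  have M0: "0 < MA" "0 < MB" "0 < MP" "0 < MQ"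
    using MA[OF one] MB[OF one] MP[OF one] MQ[OF one] pos'[OF one] by auto
  define cF where "cF = e powr (1 / m - 1)"
  define cG where "cG = e powr (p / m - 1)"
  have cF: "0 \<le> cF" "\<And>x z. \<bar>F e x - F e z\<bar> \<le> cF * \<bar>x - z\<bar>"
    using reg_Lipschitz[OF e exponents(1,2)] by (auto simp: cF_def)
  have cG: "0 \<le> cG" "\<And>x z. \<bar>G e x - G e z\<bar> \<le> cG * \<bar>x - z\<bar>"
    using reg_Lipschitz[OF e exponents(3,4)] by (auto simp: cG_def)
  define f :: "real \<Rightarrow> real \<Rightarrow> real \<times> real \<Rightarrow> real \<times> real" where
    "f t l z = (A t * snd z - B t * F e (fst z), P t * F e (fst z) - l * Q t * G e (fst z))" for t l z
  define K' where "K' = (MA + MB * cF) + (MP * cF + L * MQ * cG)"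
  have K': "0 < K'" using M0 cF(1) cG(1) L by (auto simp: K'_def intro!: add_pos_nonneg)
  have nrm: "\<bar>fst w\<bar> \<le> norm w" "\<bar>snd w\<bar> \<le> norm w" for w :: "real \<times> real"
    using norm_fst_le[of "fst w" "snd w"] norm_snd_le[of "snd w" "fst w"] by auto
  obtain X where X: "\<And>t. t \<in> {a..1} \<Longrightarrow> continuous_on {0..L} (\<lambda>l. X l t)"
    "\<And>l. l \<in> {0..L} \<Longrightarrow> X l 1 = (e, 0)"
    "\<And>t l. t \<in> {a..1} \<Longrightarrow> l \<in> {0..L} \<Longrightarrow>
      ((\<lambda>t. X l t) has_vector_derivative f t l (X l t)) (at t within {a..1})"
  proof (rule terminal_value_problem[of a 1 K' "MQ * cG" "{0..L}" f "(e, 0)"])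
    show "a \<le> 1" "0 < K'" "0 \<le> MQ * cG" using a K' M0 cG by auto
    fix l assume "l \<in> {0..L}"
    show "continuous_on ({a..1} \<times> UNIV) (\<lambda>(t, x). f t l x)"
      unfolding f_def split_beta
      by (intro continuous_intros e continuous_on_compose2[OF cont(1)] continuous_on_compose2[OF cont(2)]
          continuous_on_compose2[OF cont(3)] continuous_on_compose2[OF cont(4)]) (use a in auto)
  next
    fix t l and x z :: "real \<times> real" assume t: "t \<in> {a..1}" and l: "l \<in> {0..L}"
    have x: "\<bar>fst x - fst z\<bar> \<le> norm (x - z)" "\<bar>snd x - snd z\<bar> \<le> norm (x - z)"
      using nrm[of "x - z"] by auto
    note pt = pos'[OF t] and Mt = MA[OF t] MB[OF t] MP[OF t] MQ[OF t]
    have dF: "\<bar>F e (fst x) - F e (fst z)\<bar> \<le> cF * norm (x - z)"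
      by (rule order_trans[OF cF(2)]) (intro mult_left_mono x cF)
    have dG: "\<bar>G e (fst x) - G e (fst z)\<bar> \<le> cG * norm (x - z)"
      by (rule order_trans[OF cG(2)]) (intro mult_left_mono x cG)
    have "\<bar>A t * (snd x - snd z)\<bar> \<le> MA * norm (x - z)"
      unfolding abs_mult using pt Mt M0 x by (intro mult_mono) auto
    moreover have "\<bar>B t * (F e (fst x) - F e (fst z))\<bar> \<le> MB * (cF * norm (x - z))"
      unfolding abs_mult using pt Mt M0 dF by (intro mult_mono) auto
    moreover have "\<bar>P t * (F e (fst x) - F e (fst z))\<bar> \<le> MP * (cF * norm (x - z))"
      unfolding abs_mult using pt Mt M0 dF by (intro mult_mono) auto
    moreover have "\<bar>(l * Q t) * (G e (fst x) - G e (fst z))\<bar> \<le> (L * MQ) * (cG * norm (x - z))"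
    proof -
      have "l * Q t \<le> L * MQ" using l pt Mt by (intro mult_mono) auto
      moreover have "0 \<le> l * Q t" using l pt by simp
      ultimately have "\<bar>l * Q t\<bar> \<le> L * MQ" by (simp only: abs_of_nonneg)
      then show ?thesis unfolding abs_mult[of "l * Q t"] using dG L M0 by (intro mult_mono) auto
    qed
    moreover have "f t l x - f t l z = (A t * (snd x - snd z) - B t * (F e (fst x) - F e (fst z)),
        P t * (F e (fst x) - F e (fst z)) - (l * Q t) * (G e (fst x) - G e (fst z)))"
      by (simp add: f_def right_diff_distrib)
    ultimately have "norm (f t l x - f t l z) \<le> (MA * norm (x - z) + MB * (cF * norm (x - z))) +
        (MP * (cF * norm (x - z)) + (L * MQ) * (cG * norm (x - z)))"
      by (simp only:) (rule order_trans[OF norm_Pair_le], unfold real_norm_def, linarith)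
    then show "norm (f t l x - f t l z) \<le> K' * norm (x - z)"
      by (simp add: K'_def algebra_simps)
  next
    fix t l l' and x :: "real \<times> real" assume t: "t \<in> {a..1}"
    have G0: "G e 0 = 0" by (simp add: reg_nonpos)
    have "\<bar>G e (fst x)\<bar> \<le> cG * norm x"
    proof -
      have "\<bar>G e (fst x)\<bar> \<le> cG * \<bar>fst x\<bar>" using cG(2)[of "fst x" 0] G0 by simp
      also have "\<dots> \<le> cG * norm x" using nrm(1)[of x] cG by (intro mult_left_mono) auto
      finally show ?thesis .
    qed
    then have "\<bar>l - l'\<bar> * (Q t * \<bar>G e (fst x)\<bar>) \<le> \<bar>l - l'\<bar> * (MQ * (cG * norm x))"
      using pos'[OF t] MQ[OF t] M0 by (intro mult_left_mono mult_mono) auto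
    moreover have "norm (f t l x - f t l' x) = \<bar>(l' - l) * (Q t * G e (fst x))\<bar>"
      by (simp add: f_def norm_Pair algebra_simps)
    moreover have "\<dots> = \<bar>l - l'\<bar> * (Q t * \<bar>G e (fst x)\<bar>)"
      using pos'[OF t] by (simp add: abs_mult abs_minus_commute)
    ultimately show "norm (f t l x - f t l' x) \<le> MQ * cG * \<bar>l - l'\<bar> * norm x" by (simp add: mult_ac)
  qed (rule that, assumption+)
  show ?thesis
  proof (rule that[of "\<lambda>l t. fst (X l t)" "\<lambda>l t. snd (X l t)"])
    show "continuous_on {0..L} (\<lambda>l. snd (X l a))"
      using X(1)[of a] a by (intro continuous_intros) auto
    fix l assume l: "l \<in> {0..L}"
    have "((\<lambda>t. fst (X l t)) has_vector_derivative fst (f t l (X l t))) (at t within {a..1})"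
      "((\<lambda>t. snd (X l t)) has_vector_derivative snd (f t l (X l t))) (at t within {a..1})"
      if "t \<in> {a..1}" for t
      using X(3)[OF that l] bounded_linear.has_vector_derivative[OF bounded_linear_fst]
        bounded_linear.has_vector_derivative[OF bounded_linear_snd] by blast+
    then show "sol l e a (\<lambda>t. fst (X l t)) (\<lambda>t. snd (X l t))"
      using X(2)[OF l] by (simp add: sol_def has_real_derivative_iff_has_vector_derivative f_def)
  qed
qed

text \<open>The bound \<open>L\<close> does not depend on \<open>e\<close> or \<open>a\<close>,
  which later provides a convergent sequence of parameters.\<close>

lemma zero_flux_solution:
  obtains L e0 where "0 < L" "0 < e0" "e0 \<le> 1"
    "\<And>e a. 0 < e \<Longrightarrow> e \<le> e0 \<Longrightarrow> 0 < a \<Longrightarrow> a \<le> 1/2 \<Longrightarrow> \<exists>l\<in>{0..L}. \<exists>v y. sol l e a v y \<and> y a = 0"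
proof -
  obtain L e0 where L: "0 < L" and e0: "0 < e0" "e0 \<le> 1" and
    ge: "\<And>e a v y. sol L e a v y \<Longrightarrow> 0 < e \<Longrightarrow> e \<le> e0 \<Longrightarrow> 0 < a \<Longrightarrow> a \<le> 1/2 \<Longrightarrow> 0 \<le> y a"
    using large_parameter_flux_nonneg by metis
  show ?thesis
  proof (rule that[OF L e0])
    fix e a :: real assume e: "0 < e" "e \<le> e0" and a: "0 < a" "a \<le> 1/2"
    have a1: "a \<le> 1" using a by simp
    obtain V Y where sol: "\<And>l. l \<in> {0..L} \<Longrightarrow> sol l e a (V l) (Y l)"
      and Y: "continuous_on {0..L} (\<lambda>l. Y l a)"
      using sol_exists[OF e(1) a(1) a1 less_imp_le[OF L]] by metis
    have s0: "sol 0 e a (V 0) (Y 0)" using sol L by simp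
    have "0 * (1 - a) \<le> Y 0 1 - Y 0 a"
    proof (rule increment_ge[OF a1 order_refl solD(4)[OF s0]])
      fix s assume s: "a < s" "s < 1"
      then have "0 < P s" using pos[of s] a by auto
      then show "0 \<le> P s * F e (V 0 s) - 0 * Q s * G e (V 0 s)" by simp
    qed
    then have "Y 0 a \<le> 0" using solD(2)[OF s0] by simp
    moreover have "0 \<le> Y L a" using ge[OF sol e a] L by simp
    ultimately obtain l where "0 \<le> l" "l \<le> L" "Y l a = 0"
      using IVT'[of "\<lambda>l. Y l a" 0 0 L] Y L by auto
    then show "\<exists>l\<in>{0..L}. \<exists>v y. sol l e a v y \<and> y a = 0"
      using sol[of l] by (intro bexI[of _ l] exI[of _ "V l"] exI[of _ "Y l"]) auto
  qed
qed

end

section \<open>Existence of the profile\<close>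

text \<open>Taking for \<open>h\<close> the multiple of a power whose derivative majorises
  \<open>f'\<close> turns power bounds on derivatives into power bounds on increments, without
  integrals over singular weights.\<close>

lemma increment_abs_le:
  fixes f h :: "real \<Rightarrow> real"
  assumes "s \<le> t" "{s..t} \<subseteq> I"
    and "\<And>x. x \<in> I \<Longrightarrow> (f has_real_derivative f' x) (at x within I)"
    and "\<And>x. x \<in> I \<Longrightarrow> (h has_real_derivative h' x) (at x within I)"
    and "\<And>x. s < x \<Longrightarrow> x < t \<Longrightarrow> \<bar>f' x\<bar> \<le> h' x"
  shows "\<bar>f t - f s\<bar> \<le> h t - h s"
proof -
  have "(f t - h t) - (f s - h s) \<le> 0 * (t - s)"
    by (rule increment_le[OF assms(1,2) DERIV_diff[OF assms(3,4)]]) (use assms(5) in force)+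
  moreover have "0 * (t - s) \<le> (f t + h t) - (f s + h s)"
    by (rule increment_ge[OF assms(1,2) DERIV_add[OF assms(3,4)]]) (use assms(5) in force)+
  ultimately show ?thesis by simp
qed

lemma sublinear_bound:
  fixes M C q :: real
  assumes "M \<le> C * M powr q" "0 < M" "0 < C" "q < 1"
  shows "M \<le> C powr (1 / (1 - q))"
proof -
  have "M powr (1 - q) \<le> C" using assms by (simp add: powr_diff field_simps)
  then have "(M powr (1 - q)) powr (1 / (1 - q)) \<le> C powr (1 / (1 - q))"
    using assms by (intro powr_mono2) auto
  then show ?thesis using assms by (simp add: powr_powr)
qed

text \<open>\<open>N\<close> is kept as a real number. The inequalities
  \<open>0 < N + \<sigma>1\<close> and \<open>0 < N + \<sigma>2\<close> express that both weights
  are locally integrable in space; together with the bounds by \<open>-2\<close> they treat the two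
  dimension cases uniformly.\<close>

locale weighted_shooting =
  fixes N \<beta> c m p \<sigma>1 \<sigma>2 :: real
  assumes N: "1 \<le> N" and \<beta>: "0 < \<beta>" and c: "0 < c" and m: "1 < m" and p: "1 \<le> p" "p < m"
    and \<sigma>: "-2 < \<sigma>1" "-2 < \<sigma>2" "0 < N + \<sigma>1" "0 < N + \<sigma>2"
begin

definition "wA s = s powr (1 - N)"
definition "wB s = \<beta> * s powr (1 + \<sigma>1)"
definition "wP s = c * s powr (N - 1 + \<sigma>1)"
definition "wQ s = s powr (N - 1 + \<sigma>2)"

text \<open>On \<open>{0<..1}\<close> this is the exponent of the more singular weight, so a single
  power dominates both.\<close>

definition "\<mu> = min \<sigma>1 \<sigma>2"

lemma \<mu>: "0 < 2 + \<mu>" "0 < N + \<mu>" using \<sigma> by (auto simp: \<mu>_def)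

lemma w_pos: "0 < s \<Longrightarrow> 0 < wA s" "0 < s \<Longrightarrow> 0 < wB s" "0 < s \<Longrightarrow> 0 < wP s" "0 < s \<Longrightarrow> 0 < wQ s"
  using \<beta> c by (auto simp: wA_def wB_def wP_def wQ_def)

lemma w_cont: "0 \<notin> S \<Longrightarrow> continuous_on S wA" "0 \<notin> S \<Longrightarrow> continuous_on S wB"
  "0 \<notin> S \<Longrightarrow> continuous_on S wP" "0 \<notin> S \<Longrightarrow> continuous_on S wQ"
  unfolding wA_def wB_def wP_def wQ_def by (auto intro!: continuous_intros)

lemma w_le:
  assumes "0 < s" "s \<le> 1"
  shows "wP s \<le> c * s powr (N - 1 + \<mu>)" "wQ s \<le> s powr (N - 1 + \<mu>)" "wB s \<le> \<beta> * s powr (1 + \<mu>)"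
  using assms c \<beta> powr_mono'[of _ _ s]
  by (auto simp: wP_def wQ_def wB_def \<mu>_def)

lemma shooting_exists: "\<exists>k K. shooting wA wB wP wQ m p k K"
proof -
  have z: "(0::real) \<notin> {1/2..1}" by auto
  have g: "\<exists>l u. 0 < l \<and> (\<forall>s\<in>{1/2..1}. l \<le> f s \<and> f s \<le> u)"
    if "continuous_on {1/2..1} f" "\<And>s. 0 < s \<Longrightarrow> 0 < f s" for f :: "real \<Rightarrow> real"
  proof (rule compact_Icc_pos_bounds[OF that(1)])
    show "0 < f s" if "s \<in> {1/2..1}" for s using that \<open>\<And>s. 0 < s \<Longrightarrow> 0 < f s\<close>[of s] by auto
    fix l u assume "0 < l" "\<And>s. s \<in> {1/2..1} \<Longrightarrow> l \<le> f s \<and> f s \<le> u"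
    then show "\<exists>l u. 0 < l \<and> (\<forall>s\<in>{1/2..1}. l \<le> f s \<and> f s \<le> u)"
      by (intro exI[of _ l] exI[of _ u]) auto
  qed simp
  obtain l1 u1 where 1: "0 < l1" "\<forall>s\<in>{1/2..1}. l1 \<le> wA s \<and> wA s \<le> u1"
    using g[OF w_cont(1)[OF z] w_pos(1)] by blast
  obtain l2 u2 where 2: "0 < l2" "\<forall>s\<in>{1/2..1}. l2 \<le> wB s \<and> wB s \<le> u2"
    using g[OF w_cont(2)[OF z] w_pos(2)] by blast
  obtain l3 u3 where 3: "0 < l3" "\<forall>s\<in>{1/2..1}. l3 \<le> wP s \<and> wP s \<le> u3"
    using g[OF w_cont(3)[OF z] w_pos(3)] by blast
  obtain l4 u4 where 4: "0 < l4" "\<forall>s\<in>{1/2..1}. l4 \<le> wQ s \<and> wQ s \<le> u4"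
    using g[OF w_cont(4)[OF z] w_pos(4)] by blast
  define k where "k = Min {1, l1, l2, l3, l4}"
  define K where "K = Max {1, u1, u2, u3, u4}"
  have k: "0 < k" "k \<le> 1" "k \<le> l1" "k \<le> l2" "k \<le> l3" "k \<le> l4" using 1 2 3 4 by (auto simp: k_def)
  have K: "1 \<le> K" "u1 \<le> K" "u2 \<le> K" "u3 \<le> K" "u4 \<le> K" by (auto simp: K_def)
  have "shooting wA wB wP wQ m p k K"
  proof
    fix s :: real assume s: "s \<in> {1/2..1}"
    have a: "l1 \<le> wA s" "wA s \<le> u1" "l2 \<le> wB s" "wB s \<le> u2" "l3 \<le> wP s" "wP s \<le> u3" "l4 \<le> wQ s" "wQ s \<le> u4"
      using 1 2 3 4 s by auto
    then show "k \<le> wA s \<and> wA s \<le> K \<and> k \<le> wB s \<and> wB s \<le> K \<and> k \<le> wP s \<and> wP s \<le> K \<and> k \<le> wQ s \<and> wQ s \<le> K"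
      using k K by linarith
  next
    fix s t :: real assume st: "0 < s" "s \<le> t" "t \<le> 1"
    \<comment> \<open>The ratio of the transport weight to the diffusion weight is a power with
      positive exponent, hence the monotonicity that the shooting argument asks for.\<close>
    have "wB x / wA x = \<beta> * x powr (N + \<sigma>1)" if "0 < x" for x
    proof -
      have "wB x / wA x = \<beta> * (x powr (1 + \<sigma>1) / x powr (1 - N))" by (simp add: wB_def wA_def)
      also have "x powr (1 + \<sigma>1) / x powr (1 - N) = x powr (N + \<sigma>1)"
        using that by (simp add: powr_diff[symmetric] add.commute)
      finally show ?thesis .
    qed
    then show "wB s / wA s \<le> wB t / wA t"
      using st \<beta> \<sigma> by (simp add: powr_mono2)
  qed (use m p k K w_pos w_cont in auto)
  then show ?thesis by blast
qed

text \<open>Because \<open>y a = 0\<close>, integrating from \<open>a\<close> to the right bounds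
  \<open>y\<close> by a power of \<open>s\<close> that vanishes at the origin, uniformly in
  \<open>a\<close>. This compensates the singular factor \<open>s powr (1 - N)\<close> in the
  equation for \<open>v\<close>. With \<open>M\<close> the maximum of \<open>v\<close> and
  \<open>1\<close> one obtains \<open>M \<le> const * M powr (p / m)\<close>, and
  \<open>p < m\<close> bounds \<open>M\<close>.\<close>

lemma zero_flux_bounds:
  assumes sh: "shooting wA wB wP wQ m p k K" and sol: "shooting.sol wA wB wP wQ m p l e a v y"
    and e: "0 < e" "e \<le> 1" and a: "0 < a" "a \<le> 1/2" and l: "0 \<le> l" "l \<le> L" and ya: "y a = 0"
  defines "C \<equiv> ((1 + ((c + L) / (N + \<mu>) + \<beta>) / (2 + \<mu>)) powr (1 / (1 - p / m))) powr (p / m)"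
  shows "\<And>s. s \<in> {a..1} \<Longrightarrow> \<bar>y s\<bar> \<le> (c + L) * C / (N + \<mu>) * s powr (N + \<mu>)"
    and "\<And>s t. a \<le> s \<Longrightarrow> s \<le> t \<Longrightarrow> t \<le> 1 \<Longrightarrow>
      \<bar>v t - v s\<bar> \<le> ((c + L) / (N + \<mu>) + \<beta>) * C / (2 + \<mu>) * (t powr (2 + \<mu>) - s powr (2 + \<mu>))"
proof -
  interpret shooting wA wB wP wQ m p k K by fact
  define q where "q = p / m"
  have q: "0 < q" "q < 1" "1 / m \<le> q" using m p by (auto simp: q_def divide_right_mono)
  obtain x where x: "x \<in> {a..1}" "\<And>s. s \<in> {a..1} \<Longrightarrow> v s \<le> v x"
    using continuous_attains_sup[OF compact_Icc _ solD(5)[OF sol]] a by auto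
  \<comment> \<open>With \<open>M \<ge> 1\<close> both \<open>M powr (1 / m)\<close> and
    \<open>M powr (p / m)\<close> are at most \<open>W\<close>, so one constant serves both
    nonlinear terms.\<close>
  define M where "M = max 1 (v x)"
  define W where "W = M powr q"
  have M: "1 \<le> M" "\<And>s. s \<in> {a..1} \<Longrightarrow> v s \<le> M" using x(2) by (auto simp: M_def intro: max.coboundedI2)
  have W: "1 \<le> W" using M q by (simp add: W_def ge_one_powr_ge_zero)
  have FW: "F e (v s) \<le> W" "G e (v s) \<le> W" if "s \<in> {a..1}" for s
  proof -
    have "F e (v s) \<le> max (v s) 0 powr (1 / m)" by (rule reg_le_powr[OF e(1) exponents(1,2)])
    also have "\<dots> \<le> M powr (1 / m)" using M(2)[OF that] M(1) m by (intro powr_mono2) auto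
    also have "\<dots> \<le> W" unfolding W_def using M(1) q by (intro powr_mono) auto
    finally show "F e (v s) \<le> W" .
    have "G e (v s) \<le> max (v s) 0 powr (p / m)" by (rule reg_le_powr[OF e(1) exponents(3,4)])
    also have "\<dots> \<le> W" unfolding W_def q_def[symmetric] using M(2)[OF that] M(1) q by (intro powr_mono2) auto
    finally show "G e (v s) \<le> W" .
  qed
  have dp: "((\<lambda>s. C' / r * s powr r) has_real_derivative C' * s powr (r - 1)) (at s within I)"
    if "0 < r" "0 < s" for C' r s I
  proof -
    have "((\<lambda>s. C' / r * s powr r) has_real_derivative C' / r * (r * s powr (r - 1))) (at s within I)"
      by (intro DERIV_cmult has_real_derivative_powr has_field_derivative_at_within) (use that in auto)
    then show ?thesis using that by simp
  qed
  have ybound: "\<bar>y s\<bar> \<le> (c + L) * W / (N + \<mu>) * s powr (N + \<mu>)" if s: "s \<in> {a..1}" for s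
  proof -
    have "\<bar>y s - y a\<bar> \<le> (c + L) * W / (N + \<mu>) * s powr (N + \<mu>) - (c + L) * W / (N + \<mu>) * a powr (N + \<mu>)"
    proof (rule increment_abs_le[OF _ _ solD(4)[OF sol]])
      fix x assume "x \<in> {a..1}"
      then show "((\<lambda>s. (c + L) * W / (N + \<mu>) * s powr (N + \<mu>)) has_real_derivative
          (c + L) * W * x powr (N + \<mu> - 1)) (at x within {a..1})"
        using a \<mu> by (intro dp) auto
    next
      fix x assume "a < x" "x < s"
      then have x: "x \<in> {a..1}" "0 < x" "x \<le> 1" using s a by auto
      have "wP x * F e (v x) \<le> (c * x powr (N - 1 + \<mu>)) * W"
        using w_le[OF x(2,3)] FW[OF x(1)] c by (intro mult_mono) auto
      moreover have "l * wQ x * G e (v x) \<le> (L * x powr (N - 1 + \<mu>)) * W"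
        using w_le[OF x(2,3)] FW[OF x(1)] w_pos(4)[OF x(2)] l by (intro mult_mono) auto
      moreover have "0 \<le> wP x * F e (v x)" "0 \<le> l * wQ x * G e (v x)"
        using w_pos[OF x(2)] l by auto
      ultimately have "\<bar>wP x * F e (v x) - l * wQ x * G e (v x)\<bar> \<le>
          (c * x powr (N - 1 + \<mu>)) * W + (L * x powr (N - 1 + \<mu>)) * W" by linarith
      also have "\<dots> = (c + L) * W * x powr (N + \<mu> - 1)" by (simp add: algebra_simps)
      finally show "\<bar>wP x * F e (v x) - l * wQ x * G e (v x)\<bar> \<le> (c + L) * W * x powr (N + \<mu> - 1)" .
    qed (use s in auto)
    moreover have "0 \<le> (c + L) * W / (N + \<mu>) * a powr (N + \<mu>)"
      using c l W \<mu> by simp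
    ultimately show ?thesis using ya by simp
  qed
  define D where "D = (c + L) / (N + \<mu>) + \<beta>"
  have D: "0 < D" using c l \<mu> \<beta> by (auto simp: D_def intro!: add_nonneg_pos)
  have vbound: "\<bar>v t - v s\<bar> \<le> D * W / (2 + \<mu>) * t powr (2 + \<mu>) - D * W / (2 + \<mu>) * s powr (2 + \<mu>)"
    if st: "a \<le> s" "s \<le> t" "t \<le> 1" for s t
  proof (rule increment_abs_le[OF st(2) _ solD(3)[OF sol]])
    fix x assume "x \<in> {a..1}"
    then show "((\<lambda>s. D * W / (2 + \<mu>) * s powr (2 + \<mu>)) has_real_derivative
        D * W * x powr (2 + \<mu> - 1)) (at x within {a..1})"
      using a \<mu> by (intro dp) auto
  next
    fix x assume "s < x" "x < t"
    then have x: "x \<in> {a..1}" "0 < x" "x \<le> 1" using st a by auto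
    have "\<bar>wA x * y x\<bar> \<le> x powr (1 - N) * ((c + L) * W / (N + \<mu>) * x powr (N + \<mu>))"
      unfolding wA_def abs_mult using ybound[OF x(1)] by (intro mult_mono) auto
    also have "\<dots> = (c + L) * W / (N + \<mu>) * (x powr (1 - N) * x powr (N + \<mu>))" by simp
    also have "x powr (1 - N) * x powr (N + \<mu>) = x powr (2 + \<mu> - 1)" using x by (simp flip: powr_add)
    finally have "\<bar>wA x * y x\<bar> \<le> (c + L) * W / (N + \<mu>) * x powr (2 + \<mu> - 1)" .
    moreover have "wB x * F e (v x) \<le> (\<beta> * x powr (2 + \<mu> - 1)) * W"
      using w_le[OF x(2,3)] FW[OF x(1)] \<beta> by (intro mult_mono) auto
    moreover have "0 \<le> wB x * F e (v x)" using w_pos[OF x(2)] by auto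
    ultimately have "\<bar>wA x * y x - wB x * F e (v x)\<bar> \<le>
        (c + L) * W / (N + \<mu>) * x powr (2 + \<mu> - 1) + (\<beta> * x powr (2 + \<mu> - 1)) * W" by linarith
    also have "\<dots> = D * W * x powr (2 + \<mu> - 1)" by (simp add: D_def algebra_simps)
    finally show "\<bar>wA x * y x - wB x * F e (v x)\<bar> \<le> D * W * x powr (2 + \<mu> - 1)" .
  qed (use st in auto)
  have "M \<le> (1 + D / (2 + \<mu>)) * W"
  proof -
    have "v x \<le> 1 + D * W / (2 + \<mu>) * (1 powr (2 + \<mu>) - x powr (2 + \<mu>))"
      using vbound[of x 1] x(1) solD(1)[OF sol] e by (auto simp: right_diff_distrib)
    also have "\<dots> \<le> 1 + D * W / (2 + \<mu>) * 1"
      using D W \<mu> by (intro add_left_mono mult_left_mono) auto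
    finally have "M \<le> 1 + D / (2 + \<mu>) * W" using D W \<mu> by (simp add: M_def)
    then show ?thesis using W by (simp add: distrib_right)
  qed
  then have "M \<le> (1 + D / (2 + \<mu>)) powr (1 / (1 - q))"
    unfolding W_def using M D \<mu> q by (intro sublinear_bound) (auto intro!: add_pos_nonneg)
  then have WC: "W \<le> C"
    unfolding W_def C_def D_def[symmetric] q_def[symmetric] using M q by (intro powr_mono2) auto
  show "\<bar>y s\<bar> \<le> (c + L) * C / (N + \<mu>) * s powr (N + \<mu>)" if "s \<in> {a..1}" for s
  proof (rule order_trans[OF ybound[OF that]])
    show "(c + L) * W / (N + \<mu>) * s powr (N + \<mu>) \<le> (c + L) * C / (N + \<mu>) * s powr (N + \<mu>)"
      using WC c l \<mu> by (intro mult_right_mono divide_right_mono mult_left_mono) auto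
  qed
  show "\<bar>v t - v s\<bar> \<le> ((c + L) / (N + \<mu>) + \<beta>) * C / (2 + \<mu>) * (t powr (2 + \<mu>) - s powr (2 + \<mu>))"
    if st: "a \<le> s" "s \<le> t" "t \<le> 1" for s t
  proof -
    have "\<bar>v t - v s\<bar> \<le> D * W / (2 + \<mu>) * (t powr (2 + \<mu>) - s powr (2 + \<mu>))"
      using vbound[OF st] by (simp add: right_diff_distrib)
    also have "\<dots> \<le> D * C / (2 + \<mu>) * (t powr (2 + \<mu>) - s powr (2 + \<mu>))"
      using WC D \<mu> st a by (intro mult_right_mono divide_right_mono mult_left_mono) (auto intro!: powr_mono2)
    finally show ?thesis by (simp add: D_def)
  qed
qed

end

text \<open>\<open>reg q e x\<close> lies between \<open>max x 0 powr q - e powr q\<close> and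
  \<open>max x 0 powr q\<close>, so the limits in \<open>e\<close> and \<open>x\<close> may be taken
  jointly.\<close>

lemma reg_tendsto:
  assumes q: "0 < q" "q < 1" and x: "x \<longlonglongrightarrow> a" and e: "e \<longlonglongrightarrow> 0" "\<And>n. 0 < e n"
  shows "(\<lambda>n. reg q (e n) (x n)) \<longlonglongrightarrow> max a 0 powr q"
proof -
  have "(\<lambda>n. max (x n) 0) \<longlonglongrightarrow> max a 0" by (intro tendsto_intros x)
  then have lim: "(\<lambda>n. max (x n) 0 powr q) \<longlonglongrightarrow> max a 0 powr q"
    using q by (intro tendsto_powr') (auto intro: tendsto_intros)
  have "(\<lambda>n. e n powr q) \<longlonglongrightarrow> 0 powr q"
    using q e by (intro tendsto_powr') (auto intro: tendsto_intros simp: less_imp_le)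
  then have "(\<lambda>n. max (x n) 0 powr q - e n powr q) \<longlonglongrightarrow> max a 0 powr q"
    using tendsto_diff[OF lim, of "\<lambda>n. e n powr q" 0] by simp
  then show ?thesis
  proof (rule tendsto_sandwich[OF _ _ _ lim, rotated -1])
    show "\<forall>\<^sub>F n in sequentially. max (x n) 0 powr q - e n powr q \<le> reg q (e n) (x n)"
      using powr_le_reg_add[OF e(2) q] by (intro always_eventually allI) (simp add: algebra_simps)
    show "\<forall>\<^sub>F n in sequentially. reg q (e n) (x n) \<le> max (x n) 0 powr q"
      using reg_le_powr[OF e(2) q] by (intro always_eventually allI)
  qed
qed

lemma integral_upper_derivative:
  fixes g u :: "real \<Rightarrow> real"
  assumes g: "continuous_on {0<..1} g" and u: "\<And>s. s \<in> {0<..1} \<Longrightarrow> u s = - integral {s..1} g"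
    and s: "s \<in> {0<..1}"
  shows "(u has_real_derivative g s) (at s within {0<..1})"
proof -
  have "((\<lambda>x. - integral {x..1} g) has_real_derivative - (- g s)) (at s within {s/2..1})"
    using s by (intro DERIV_minus integral_has_real_derivative' continuous_on_subset[OF g]) auto
  moreover have "at s within {s/2..1} = at s within {0<..1}"
    by (rule at_within_nhd[where S = "{s/2<..}"]) (use s in auto)
  ultimately have "((\<lambda>x. - integral {x..1} g) has_real_derivative g s) (at s within {0<..1})" by simp
  then show ?thesis
    by (rule has_field_derivative_transform_within[OF _ zero_less_one s]) (simp add: u)
qed

text \<open>The \<open>n\<close>-th equation is available only once \<open>E n \<le> s\<close>;
  since \<open>E n\<close> tends to \<open>0\<close>, for fixed \<open>s\<close> all but finitely
  many indices qualify, and the dominating constant may depend on \<open>s\<close>.\<close>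

lemma integral_equation_limit:
  fixes u f :: "nat \<Rightarrow> real \<Rightarrow> real"
  assumes s: "0 < s" "s \<le> 1" and E: "E \<longlonglongrightarrow> 0"
    and der: "\<And>n t. E n \<le> s \<Longrightarrow> t \<in> {s..1} \<Longrightarrow> (u n has_real_derivative f n t) (at t within {s..1})"
    and bnd: "\<And>n t. E n \<le> s \<Longrightarrow> t \<in> {s..1} \<Longrightarrow> \<bar>f n t\<bar> \<le> M"
    and conv: "\<And>t. t \<in> {s..1} \<Longrightarrow> (\<lambda>n. f n t) \<longlonglongrightarrow> g t"
    and u1: "(\<lambda>n. u n 1) \<longlonglongrightarrow> 0"
  shows "(\<lambda>n. u n s) \<longlonglongrightarrow> - integral {s..1} g"
proof -
  have "\<forall>\<^sub>F n in sequentially. E n < s" by (rule order_tendstoD(2)[OF E s(1)])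
  then obtain n0 where n0: "\<And>n. n0 \<le> n \<Longrightarrow> E n \<le> s"
    unfolding eventually_sequentially by (meson less_imp_le)
  define f' where "f' n = f (n + n0)" for n
  have int: "(f' n has_integral (u (n + n0) 1 - u (n + n0) s)) {s..1}" for n
    unfolding f'_def using der[OF n0] s
    by (intro fundamental_theorem_of_calculus) (auto simp flip: has_real_derivative_iff_has_vector_derivative)
  have "(\<lambda>n. integral {s..1} (f' n)) \<longlonglongrightarrow> integral {s..1} g"
  proof (rule dominated_convergence(2))
    show "f' n integrable_on {s..1}" for n using int by blast
    show "(\<lambda>_. M) integrable_on {s..1}" by (rule integrable_const_ivl)
    show "norm (f' n t) \<le> M" if "t \<in> {s..1}" for n t
      using bnd[OF n0 that, of "n + n0"] by (simp add: f'_def)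
    show "(\<lambda>n. f' n t) \<longlonglongrightarrow> g t" if "t \<in> {s..1}" for t
      unfolding f'_def using LIMSEQ_ignore_initial_segment[OF conv[OF that], of n0] .
  qed
  then have "(\<lambda>n. u (n + n0) 1 - integral {s..1} (f' n)) \<longlonglongrightarrow> 0 - integral {s..1} g"
    by (intro tendsto_diff LIMSEQ_ignore_initial_segment u1)
  moreover have "u (n + n0) 1 - integral {s..1} (f' n) = u (n + n0) s" for n
    using integral_unique[OF int[of n]] by simp
  ultimately have "(\<lambda>n. u (n + n0) s) \<longlonglongrightarrow> - integral {s..1} g" by simp
  then show ?thesis by (rule LIMSEQ_offset)
qed

context weighted_shooting
begin

lemma profile_exists:
  obtains l v y C where "0 < l" "continuous_on {0..1} v" "\<And>s. s \<in> {0..1} \<Longrightarrow> 0 \<le> v s"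
    "v 1 = 0" "y 1 = 0" "\<exists>s\<in>{0<..<1}. 0 < v s"
    "\<And>s. s \<in> {0<..1} \<Longrightarrow> (v has_real_derivative wA s * y s - wB s * v s powr (1 / m)) (at s within {0<..1})"
    "\<And>s. s \<in> {0<..1} \<Longrightarrow> (y has_real_derivative
       wP s * v s powr (1 / m) - l * wQ s * v s powr (p / m)) (at s within {0<..1})"
    "\<And>s. s \<in> {0<..1} \<Longrightarrow> \<bar>y s\<bar> \<le> C * s powr (N + \<mu>)"
proof -
  obtain k K where sh: "shooting wA wB wP wQ m p k K" using shooting_exists by blast
  interpret shooting wA wB wP wQ m p k K by fact
  obtain L e0 where L: "0 < L" and e0: "0 < e0" "e0 \<le> 1" and
    ex: "\<And>e a. 0 < e \<Longrightarrow> e \<le> e0 \<Longrightarrow> 0 < a \<Longrightarrow> a \<le> 1/2 \<Longrightarrow> \<exists>l\<in>{0..L}. \<exists>v y. sol l e a v y \<and> y a = 0"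
    using zero_flux_solution by metis
  \<comment> \<open>One sequence serves both as regularisation and as left end point; the offset
    \<open>2\<close> keeps it at most \<open>1 / 2\<close>.\<close>
  define en where "en n = e0 / (real n + 2)" for n :: nat
  have en: "0 < en n" "en n \<le> e0" "en n \<le> 1" "en n \<le> 1/2" for n
  proof -
    show "0 < en n" using e0 by (simp add: en_def)
    have "en n \<le> e0 / 2" unfolding en_def using e0 by (intro divide_left_mono) auto
    then show "en n \<le> e0" "en n \<le> 1" "en n \<le> 1/2" using e0 by auto
  qed
  have en_lim: "en \<longlonglongrightarrow> 0"
    unfolding en_def by (rule real_tendsto_divide_at_top[OF tendsto_const])
      (intro filterlim_tendsto_add_at_top[OF tendsto_const, where c = 2, simplified add.commute] filterlim_real_sequentially)
  have "\<forall>n. \<exists>l v y. l \<in> {0..L} \<and> sol l (en n) (en n) v y \<and> y (en n) = 0"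
    using ex[OF en(1,2,1,4)] by blast
  then obtain ln vn yn where n: "\<And>n. ln n \<in> {0..L}" "\<And>n. sol (ln n) (en n) (en n) (vn n) (yn n)"
    "\<And>n. yn n (en n) = 0" by metis
  define C where "C = ((1 + ((c + L) / (N + \<mu>) + \<beta>) / (2 + \<mu>)) powr (1 / (1 - p / m))) powr (p / m)"
  define Cy where "Cy = (c + L) * C / (N + \<mu>)"
  define Cv where "Cv = ((c + L) / (N + \<mu>) + \<beta>) * C / (2 + \<mu>)"
  have C: "0 \<le> C" "0 \<le> Cy" "0 \<le> Cv" using c L \<mu> \<beta> by (auto simp: C_def Cy_def Cv_def)
  have yb: "\<bar>yn n s\<bar> \<le> Cy * s powr (N + \<mu>)" if "s \<in> {en n..1}" for n s
    unfolding Cy_def C_def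
    by (rule zero_flux_bounds(1)[OF sh n(2) en(1,3,1,4) _ _ n(3) that]) (use n(1)[of n] in auto)
  have vb: "\<bar>vn n t - vn n s\<bar> \<le> Cv * (t powr (2 + \<mu>) - s powr (2 + \<mu>))"
    if "en n \<le> s" "s \<le> t" "t \<le> 1" for n s t
    unfolding Cv_def C_def
    by (rule zero_flux_bounds(2)[OF sh n(2) en(1,3,1,4) _ _ n(3) that]) (use n(1)[of n] in auto)
  \<comment> \<open>Constant continuation to the left of \<open>en n\<close> gives functions on the
    common interval \<open>{0..1}\<close>; the power bound on increments survives because truncation
    only shortens the differences.\<close>
  define w where "w n s = vn n (max s (en n))" for n s
  have w_eq: "w n s = vn n s" if "en n \<le> s" for n s using that by (simp add: w_def max_def)
  have wb: "\<bar>w n t - w n s\<bar> \<le> Cv * (t powr (2 + \<mu>) - s powr (2 + \<mu>))"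
    if st: "0 \<le> s" "s \<le> t" "t \<le> 1" for n s t
  proof -
    have "\<bar>w n t - w n s\<bar> \<le> Cv * (max t (en n) powr (2 + \<mu>) - max s (en n) powr (2 + \<mu>))"
      unfolding w_def using st en[of n] by (intro vb) auto
    also have "max t (en n) powr (2 + \<mu>) - max s (en n) powr (2 + \<mu>) \<le> t powr (2 + \<mu>) - s powr (2 + \<mu>)"
      using st \<mu> powr_mono2[of "2 + \<mu>" s t] powr_mono2[of "2 + \<mu>" s "en n"]
      by (auto simp: max_def)
    then have "Cv * (max t (en n) powr (2 + \<mu>) - max s (en n) powr (2 + \<mu>)) \<le>
        Cv * (t powr (2 + \<mu>) - s powr (2 + \<mu>))" using C by (intro mult_left_mono)
    finally show ?thesis .
  qed
  have wb': "\<bar>w n t - w n s\<bar> \<le> Cv * \<bar>t powr (2 + \<mu>) - s powr (2 + \<mu>)\<bar>"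
    if st: "s \<in> {0..1}" "t \<in> {0..1}" for n s t
  proof (cases "s \<le> t")
    case True
    then have "\<bar>w n t - w n s\<bar> \<le> Cv * (t powr (2 + \<mu>) - s powr (2 + \<mu>))" using wb[of s t n] st by auto
    also have "\<dots> \<le> Cv * \<bar>t powr (2 + \<mu>) - s powr (2 + \<mu>)\<bar>" using C by (intro mult_left_mono) auto
    finally show ?thesis .
  next
    case False
    then have "\<bar>w n s - w n t\<bar> \<le> Cv * (s powr (2 + \<mu>) - t powr (2 + \<mu>))" using wb[of t s n] st by auto
    also have "\<dots> \<le> Cv * \<bar>t powr (2 + \<mu>) - s powr (2 + \<mu>)\<bar>" using C by (intro mult_left_mono) auto
    finally show ?thesis by (simp add: abs_minus_commute)
  qed
  have w1: "w n 1 = en n" for n using w_eq[of n 1] en[of n] solD(1)[OF n(2)] by simp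
  have wM: "\<bar>w n s\<bar> \<le> 1 + Cv" if "s \<in> {0..1}" for n s
  proof -
    have "\<bar>w n 1 - w n s\<bar> \<le> Cv * (1 powr (2 + \<mu>) - s powr (2 + \<mu>))" using that by (intro wb) auto
    also have "\<dots> \<le> Cv * 1" using C by (intro mult_left_mono) auto
    finally show ?thesis using w1[of n] en[of n] by auto
  qed
  \<comment> \<open>Only \<open>v\<close> is handled by equicontinuity, with modulus
    \<open>s powr (2 + \<mu>)\<close>; the convergence of \<open>y\<close> is read off from its
    integral equation.\<close>
  obtain v r where v: "continuous_on {0..1} v" and r: "strict_mono (r :: nat \<Rightarrow> nat)"
    and conv: "\<And>e. 0 < e \<Longrightarrow> \<exists>M. \<forall>n x. n \<ge> M \<and> x \<in> {0..1} \<longrightarrow> norm (w (r n) x - v x) < e"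
  proof (rule Arzela_Ascoli[of "{0..1}" w "1 + Cv"])
    show "norm (w n x) \<le> 1 + Cv" if "x \<in> {0..1}" for n x using wM[OF that] by simp
    fix x e :: real assume x: "x \<in> {0..1}" and e: "0 < e"
    have "continuous_on {0..1} (\<lambda>s. s powr (2 + \<mu>))"
      using \<mu> by (intro continuous_on_powr') (auto intro: continuous_intros)
    then obtain d where d: "0 < d" "\<And>t. t \<in> {0..1} \<Longrightarrow> dist t x < d \<Longrightarrow>
        dist (t powr (2 + \<mu>)) (x powr (2 + \<mu>)) < e / (Cv + 1)"
      using x e C unfolding continuous_on_iff by (metis add_nonneg_pos divide_pos_pos zero_less_one)
    show "\<exists>d>0. \<forall>n y. y \<in> {0..1} \<and> norm (x - y) < d \<longrightarrow> norm (w n x - w n y) < e"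
    proof (intro exI[of _ d] conjI d allI impI)
      fix n y assume y: "y \<in> {0..1} \<and> norm (x - y) < d"
      have "\<bar>w n x - w n y\<bar> \<le> Cv * \<bar>x powr (2 + \<mu>) - y powr (2 + \<mu>)\<bar>" using x y by (intro wb') auto
      also have "\<dots> \<le> Cv * (e / (Cv + 1))"
        using d(2)[of y] y C by (intro mult_left_mono) (auto simp: dist_real_def abs_minus_commute)
      also have "\<dots> < e" using C e by (simp add: pos_divide_less_eq)
      finally show "norm (w n x - w n y) < e" by simp
    qed
  qed auto
  have "compact {0..L}" by simp
  then obtain l r' where l: "l \<in> {0..L}" and r': "strict_mono (r' :: nat \<Rightarrow> nat)" "((\<lambda>n. ln (r n)) \<circ> r') \<longlonglongrightarrow> l"
    using n(1) unfolding compact_eq_seq_compact_metric seq_compact_def by meson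
  define sub where "sub = r \<circ> r'"
  have sub: "strict_mono sub" using r r' by (simp add: sub_def strict_mono_o)
  have l_lim: "(\<lambda>n. ln (sub n)) \<longlonglongrightarrow> l" using r'(2) by (simp add: sub_def o_def)
  have E_lim: "(\<lambda>n. en (sub n)) \<longlonglongrightarrow> 0" using LIMSEQ_subseq_LIMSEQ[OF en_lim sub] by (simp add: o_def)
  have w_lim: "(\<lambda>n. w (sub n) s) \<longlonglongrightarrow> v s" if "s \<in> {0..1}" for s
  proof -
    have "(\<lambda>n. w (r n) s) \<longlonglongrightarrow> v s"
      unfolding LIMSEQ_iff using conv that by blast
    from LIMSEQ_subseq_LIMSEQ[OF this r'(1)] show ?thesis by (simp add: o_def sub_def)
  qed
  have ev: "\<forall>\<^sub>F n in sequentially. en (sub n) \<le> s" if "0 < s" for s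
    using order_tendstoD(2)[OF E_lim that] by (rule eventually_mono) simp
  have v_lim: "(\<lambda>n. vn (sub n) s) \<longlonglongrightarrow> v s" if "s \<in> {0<..1}" for s
  proof (rule Lim_transform_eventually[OF w_lim])
    show "\<forall>\<^sub>F n in sequentially. w (sub n) s = vn (sub n) s"
      using that by (intro eventually_mono[OF ev[of s]] w_eq) auto
  qed (use that in auto)
  have F_lim: "(\<lambda>n. F (en (sub n)) (vn (sub n) s)) \<longlonglongrightarrow> max (v s) 0 powr (1 / m)"
    and G_lim: "(\<lambda>n. G (en (sub n)) (vn (sub n) s)) \<longlonglongrightarrow> max (v s) 0 powr (p / m)" if "s \<in> {0<..1}" for s
    using exponents E_lim en v_lim[OF that] by (auto intro!: reg_tendsto)
  have FM: "F (en n) (vn n s) \<le> 1 + Cv" "G (en n) (vn n s) \<le> 1 + Cv" if "s \<in> {en n..1}" for n s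
  proof -
    have s0: "0 \<le> s" "s \<le> 1" using that en(1)[of n] by auto
    have vM: "max (vn n s) 0 \<le> 1 + Cv" using wM[of s n] w_eq[of n s] that s0 C by auto
    have M: "(1 + Cv) powr q \<le> 1 + Cv" if "0 < q" "q < 1" for q
      using powr_mono[of q 1 "1 + Cv"] that C by simp
    have *: "reg q (en n) (vn n s) \<le> 1 + Cv" if "0 < q" "q < 1" for q
    proof -
      have "reg q (en n) (vn n s) \<le> max (vn n s) 0 powr q" by (rule reg_le_powr[OF en(1) that])
      also have "\<dots> \<le> (1 + Cv) powr q" using vM that by (intro powr_mono2) auto
      finally show ?thesis using M[OF that] by simp
    qed
    show "F (en n) (vn n s) \<le> 1 + Cv" "G (en n) (vn n s) \<le> 1 + Cv"
      using exponents by (auto intro: *)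
  qed
  define H where "H s = wP s * max (v s) 0 powr (1 / m) - l * wQ s * max (v s) 0 powr (p / m)" for s
  define y where "y s = - integral {s..1} H" for s
  have wbound: "\<exists>M\<ge>0. \<forall>t\<in>{s..1}. \<bar>f t\<bar> \<le> M" if "continuous_on {0<..1} f" "0 < s" for f :: "real \<Rightarrow> real" and s
  proof -
    have "bounded (f ` {s..1})"
      using that by (intro compact_imp_bounded compact_continuous_image continuous_on_subset[OF that(1)]) auto
    then show ?thesis unfolding bounded_iff by (metis abs_ge_zero image_eqI order_trans real_norm_def linear)
  qed
  have y_lim: "(\<lambda>n. yn (sub n) s) \<longlonglongrightarrow> y s" if s: "s \<in> {0<..1}" for s
    unfolding y_def
  proof -
    have s': "0 < s" "s \<le> 1" using s by auto
    obtain MP where MP: "0 \<le> MP" "\<And>t. t \<in> {s..1} \<Longrightarrow> \<bar>wP t\<bar> \<le> MP"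
      using wbound[OF cont(3) s'(1)] by blast
    obtain MQ where MQ: "0 \<le> MQ" "\<And>t. t \<in> {s..1} \<Longrightarrow> \<bar>wQ t\<bar> \<le> MQ"
      using wbound[OF cont(4) s'(1)] by blast
    show "(\<lambda>n. yn (sub n) s) \<longlonglongrightarrow> - integral {s..1} H"
    proof (rule integral_equation_limit[OF s' E_lim, where u = "\<lambda>n. yn (sub n)"])
      fix n t assume le: "en (sub n) \<le> s" and t: "t \<in> {s..1}"
      then have t': "t \<in> {en (sub n)..1}" by auto
      show "(yn (sub n) has_real_derivative wP t * F (en (sub n)) (vn (sub n) t) -
          ln (sub n) * wQ t * G (en (sub n)) (vn (sub n) t)) (at t within {s..1})"
        by (rule has_field_derivative_subset[OF solD(4)[OF n(2) t']]) (use le in auto)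
      have "\<bar>wP t * F (en (sub n)) (vn (sub n) t)\<bar> \<le> MP * (1 + Cv)"
        unfolding abs_mult using MP FM[OF t'] t C by (intro mult_mono) auto
      moreover have "\<bar>ln (sub n) * wQ t * G (en (sub n)) (vn (sub n) t)\<bar> \<le> L * MQ * (1 + Cv)"
        unfolding abs_mult using MQ FM[OF t'] t C n(1)[of "sub n"] L by (intro mult_mono) auto
      ultimately show "\<bar>wP t * F (en (sub n)) (vn (sub n) t) -
          ln (sub n) * wQ t * G (en (sub n)) (vn (sub n) t)\<bar> \<le> MP * (1 + Cv) + L * MQ * (1 + Cv)"
        by linarith
    next
      fix t assume t: "t \<in> {s..1}"
      then have t': "t \<in> {0<..1}" using s by auto
      show "(\<lambda>n. wP t * F (en (sub n)) (vn (sub n) t) - ln (sub n) * wQ t * G (en (sub n)) (vn (sub n) t))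
          \<longlonglongrightarrow> H t"
        unfolding H_def by (intro tendsto_intros F_lim G_lim t' l_lim)
    next
      show "(\<lambda>n. yn (sub n) 1) \<longlonglongrightarrow> 0" using solD(2)[OF n(2)] by simp
    qed
  qed
  have yC: "\<bar>y s\<bar> \<le> Cy * s powr (N + \<mu>)" if s: "s \<in> {0<..1}" for s
  proof (rule tendsto_upperbound[OF tendsto_rabs[OF y_lim[OF s]]])
    show "\<forall>\<^sub>F n in sequentially. \<bar>yn (sub n) s\<bar> \<le> Cy * s powr (N + \<mu>)"
      using s by (intro eventually_mono[OF ev[of s]] yb) auto
  qed simp
  define J where "J s = wA s * y s - wB s * max (v s) 0 powr (1 / m)" for s
  have v_eq: "v s = - integral {s..1} J" if s: "s \<in> {0<..1}" for s
  proof (rule LIMSEQ_unique[OF v_lim[OF s]])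
    have s': "0 < s" "s \<le> 1" using s by auto
    obtain MA where MA: "0 \<le> MA" "\<And>t. t \<in> {s..1} \<Longrightarrow> \<bar>wA t\<bar> \<le> MA"
      using wbound[OF cont(1) s'(1)] by blast
    obtain MB where MB: "0 \<le> MB" "\<And>t. t \<in> {s..1} \<Longrightarrow> \<bar>wB t\<bar> \<le> MB"
      using wbound[OF cont(2) s'(1)] by blast
    show "(\<lambda>n. vn (sub n) s) \<longlonglongrightarrow> - integral {s..1} J"
    proof (rule integral_equation_limit[OF s' E_lim, where u = "\<lambda>n. vn (sub n)"])
      fix n t assume le: "en (sub n) \<le> s" and t: "t \<in> {s..1}"
      then have t': "t \<in> {en (sub n)..1}" by auto
      show "(vn (sub n) has_real_derivative wA t * yn (sub n) t - wB t * F (en (sub n)) (vn (sub n) t))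
          (at t within {s..1})"
        by (rule has_field_derivative_subset[OF solD(3)[OF n(2) t']]) (use le in auto)
      have "t powr (N + \<mu>) \<le> 1" using t s' \<mu> by (intro powr_le1) auto
      then have "Cy * t powr (N + \<mu>) \<le> Cy" using C by (simp add: mult_left_le)
      then have "\<bar>yn (sub n) t\<bar> \<le> Cy" using yb[OF t'] by simp
      then have "\<bar>wA t * yn (sub n) t\<bar> \<le> MA * Cy"
        unfolding abs_mult using MA t by (intro mult_mono) auto
      moreover have "\<bar>wB t * F (en (sub n)) (vn (sub n) t)\<bar> \<le> MB * (1 + Cv)"
        unfolding abs_mult using MB FM[OF t'] t C by (intro mult_mono) auto
      ultimately show "\<bar>wA t * yn (sub n) t - wB t * F (en (sub n)) (vn (sub n) t)\<bar> \<le> MA * Cy + MB * (1 + Cv)"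
        by linarith
    next
      fix t assume t: "t \<in> {s..1}"
      then have t': "t \<in> {0<..1}" using s by auto
      show "(\<lambda>n. wA t * yn (sub n) t - wB t * F (en (sub n)) (vn (sub n) t)) \<longlonglongrightarrow> J t"
        unfolding J_def by (intro tendsto_intros F_lim y_lim t')
    next
      show "(\<lambda>n. vn (sub n) 1) \<longlonglongrightarrow> 0" using E_lim by (simp add: solD(1)[OF n(2)])
    qed
  qed
  have cvp: "continuous_on {0<..1} (\<lambda>s. max (v s) 0 powr q)" if "0 < q" for q
    using that by (intro continuous_on_powr' continuous_intros continuous_on_subset[OF v]) auto
  have cH: "continuous_on {0<..1} H"
    unfolding H_def using m p by (intro continuous_intros cvp cont) auto
  have dy: "(y has_real_derivative H s) (at s within {0<..1})" if "s \<in> {0<..1}" for s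
    by (rule integral_upper_derivative[OF cH _ that]) (simp add: y_def)
  have cJ: "continuous_on {0<..1} J"
    unfolding J_def using m DERIV_continuous_on[OF dy] by (intro continuous_intros cvp cont) auto
  have dv: "(v has_real_derivative J s) (at s within {0<..1})" if "s \<in> {0<..1}" for s
    by (rule integral_upper_derivative[OF cJ v_eq that])
  have v1: "v 1 = 0" "y 1 = 0" using v_eq[of 1] by (auto simp: y_def)
  have inv0: "(\<lambda>n. 1 / real (Suc n)) \<longlonglongrightarrow> 0" by (rule LIMSEQ_Suc[OF lim_1_over_n])
  have y0: "(\<lambda>n. Cy * (1 / real (Suc n)) powr (N + \<mu>)) \<longlonglongrightarrow> 0"
  proof -
    have "(\<lambda>n. (1 / real (Suc n)) powr (N + \<mu>)) \<longlonglongrightarrow> 0 powr (N + \<mu>)"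
      using \<mu> by (intro tendsto_powr' tendsto_const inv0) auto
    from tendsto_mult_left[OF this, of Cy] show ?thesis by simp
  qed
  \<comment> \<open>A negative value would make \<open>y\<close> a positive constant on the whole
    interval to the left, against the decay
    \<open>\<bar>y s\<bar> \<le> Cy * s powr (N + \<mu>)\<close> at the origin.\<close>
  have v_nonneg': "0 \<le> v s" if s: "s \<in> {0<..1}" for s
  proof (rule ccontr)
    assume "\<not> 0 \<le> v s"
    then have vs: "v s < 0" by simp
    have yc: "y a = y s \<and> 0 < y s" if a: "0 < a" "a \<le> s" for a
    proof -
      have sub: "{a..1} \<subseteq> {0<..1}" using a by auto
      note dv' = has_field_derivative_subset[OF dv sub] and dy' = has_field_derivative_subset[OF dy sub]
      have dv'': "(v has_real_derivative wA t * y t - wB t * max (v t) 0 powr (1 / m)) (at t within {a..1})"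
        if "t \<in> {a..1}" for t using dv'[of t] sub that by (auto simp: J_def)
      have dy'': "(y has_real_derivative H t) (at t within {a..1})" if "t \<in> {a..1}" for t
        using dy'[of t] sub that by auto
      have A0: "0 < wA t" if "t \<in> {a..1}" for t using w_pos(1)[of t] that a by auto
      have z: "wB t * max (v t) 0 powr (1 / m) = 0 \<and> H t = 0" if "t \<in> {a..1}" "v t \<le> 0" for t
        using that by (simp add: H_def max_def)
      note neg = negative_imp_flux_constant[OF A0 dv'' dy'' z _ _ vs]
      have "0 \<le> v 1" "s \<in> {a..1}" using v1 a s by auto
      with neg show ?thesis by blast
    qed
    have ys: "0 < y s" using yc[of s] s by auto
    have "\<forall>\<^sub>F n in sequentially. 1 / real (Suc n) < s"
      using s by (intro order_tendstoD(2)[OF inv0]) auto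
    moreover have "\<forall>\<^sub>F n in sequentially. Cy * (1 / real (Suc n)) powr (N + \<mu>) < y s"
      by (rule order_tendstoD(2)[OF y0 ys])
    ultimately have "\<forall>\<^sub>F n in sequentially. 1 / real (Suc n) < s \<and> Cy * (1 / real (Suc n)) powr (N + \<mu>) < y s"
      by (rule eventually_conj)
    then obtain n where n: "1 / real (Suc n) < s" "Cy * (1 / real (Suc n)) powr (N + \<mu>) < y s"
      by (metis (mono_tags, lifting) eventually_sequentially order_refl)
    define a where "a = 1 / real (Suc n)"
    have a: "0 < a" "a \<le> s" using n by (auto simp: a_def)
    have "\<bar>y a\<bar> \<le> Cy * a powr (N + \<mu>)" using a s by (intro yC) auto
    then show False using yc[OF a] n(2) by (simp add: a_def)
  qed
  have v_nonneg: "0 \<le> v s" if s: "s \<in> {0..1}" for s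
  proof (cases "s = 0")
    case True
    have "(v \<longlongrightarrow> v 0) (at 0 within {0..1})" using v by (auto simp: continuous_on_def)
    then have "(v \<longlongrightarrow> v 0) (at_right 0)" by (simp add: at_within_Icc_at_right)
    moreover have "\<forall>\<^sub>F s in at_right 0. 0 \<le> v s"
      using v_nonneg' unfolding eventually_at_right_field by (intro exI[of _ 1]) auto
    ultimately have "0 \<le> v 0" by (rule tendsto_lowerbound) simp
    then show ?thesis using True by simp
  qed (use s in \<open>auto intro!: v_nonneg'\<close>)
  have max_v: "max (v s) 0 = v s" if "s \<in> {0<..1}" for s using v_nonneg'[OF that] by simp
  obtain s0 where s0: "s0 \<in> {0<..<1}" "0 < v s0"
  proof -
    obtain d where d: "0 < d" "d \<le> 1 / 2" and low:
      "\<And>l e a v y s. sol l e a v y \<Longrightarrow> 0 < e \<Longrightarrow> e \<le> 1 \<Longrightarrow> 0 \<le> l \<Longrightarrow> l \<le> L \<Longrightarrow> 0 < a \<Longrightarrow> a \<le> 1/2 \<Longrightarrow>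
       1 - d \<le> s \<Longrightarrow> s \<le> 1 \<Longrightarrow> e \<le> v s \<and> (1 - 1 / m) * (k / 2) * (1 - s) \<le> v s powr (1 - 1 / m)"
      using lower_bound_near_one[OF less_imp_le[OF L]] by metis
    define s where "s = 1 - d / 2"
    have s: "s \<in> {0<..<1}" "1 - d \<le> s" "s \<le> 1" using d by (auto simp: s_def)
    define b where "b = ((1 - 1 / m) * (k / 2) * (1 - s)) powr (1 / (1 - 1 / m))"
    have b: "0 < b" using m k s by (simp add: b_def)
    have "b \<le> vn n s" for n
    proof -
      have h: "en n \<le> vn n s" "(1 - 1 / m) * (k / 2) * (1 - s) \<le> vn n s powr (1 - 1 / m)"
        using low[OF n(2) en(1,3) _ _ en(1,4) s(2,3)] n(1)[of n] by auto
      have "b \<le> (vn n s powr (1 - 1 / m)) powr (1 / (1 - 1 / m))"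
        unfolding b_def using h(2) m k s by (intro powr_mono2) auto
      also have "\<dots> = vn n s" using h(1) en(1)[of n] m by (simp add: powr_powr)
      finally show ?thesis .
    qed
    then have "b \<le> v s"
      using s by (intro tendsto_lowerbound[OF v_lim]) auto
    then show ?thesis using that[of s] s b by auto
  qed
  \<comment> \<open>Without reaction \<open>y\<close> would be nondecreasing with limit
    \<open>0\<close> at the origin and \<open>y 1 = 0\<close>, hence zero; its derivative, however,
    is positive where \<open>v\<close> is.\<close>
  have "l \<noteq> 0"
  proof
    assume l0: "l = 0"
    have H0: "0 \<le> H t" if "t \<in> {0<..1}" for t using that w_pos(3)[of t] by (simp add: H_def l0)
    have mono: "y t1 \<le> y t2" if "0 < t1" "t1 \<le> t2" "t2 \<le> 1" for t1 t2
    proof -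
      have "0 * (t2 - t1) \<le> y t2 - y t1"
        by (rule increment_ge[OF that(2) _ dy]) (use that in \<open>auto intro: H0\<close>)
      then show ?thesis by simp
    qed
    have yz: "y s = 0" if s: "s \<in> {0<..1}" for s
    proof (rule antisym)
      show "y s \<le> 0" using mono[of s 1] s v1 by auto
      have "- y s \<le> 0"
      proof (rule tendsto_lowerbound[OF y0])
        have "\<forall>\<^sub>F n in sequentially. 1 / real (Suc n) < s"
          using s by (intro order_tendstoD(2)[OF inv0]) auto
        then show "\<forall>\<^sub>F n in sequentially. - y s \<le> Cy * (1 / real (Suc n)) powr (N + \<mu>)"
        proof (rule eventually_mono)
          fix n assume "1 / real (Suc n) < s"
          then have "y (1 / real (Suc n)) \<le> y s" "1 / real (Suc n) \<in> {0<..1}"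
            using s by (auto intro!: mono)
          with yC[of "1 / real (Suc n)"] show "- y s \<le> Cy * (1 / real (Suc n)) powr (N + \<mu>)" by auto
        qed
      qed simp
      then show "0 \<le> y s" by simp
    qed
    have "H s0 = 0"
    proof -
      have "(y has_real_derivative H s0) (at s0 within {0<..<1})"
        by (rule has_field_derivative_subset[OF dy]) (use s0 in auto)
      moreover have "at s0 within {0<..<1} = at s0"
        by (rule at_within_open[OF s0(1) open_greaterThanLessThan])
      ultimately have "(y has_real_derivative H s0) (at s0)" by simp
      moreover have "((\<lambda>_. 0) has_real_derivative 0) (at s0)" by simp
      then have "(y has_real_derivative 0) (at s0)"
        by (rule has_field_derivative_transform_within_open[where S = "{0<..<1}"]) (use s0 yz in auto)
      ultimately show ?thesis by (rule DERIV_unique)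
    qed
    then show False using s0 w_pos(3)[of s0] by (simp add: H_def l0)
  qed
  then have "0 < l" using l by auto
  show ?thesis
  proof (rule that[of l v y Cy, OF \<open>0 < l\<close> v _ v1])
    show "\<exists>s\<in>{0<..<1}. 0 < v s" using s0 by blast
    show "(v has_real_derivative wA s * y s - wB s * v s powr (1 / m)) (at s within {0<..1})"
      if "s \<in> {0<..1}" for s using dv[OF that] max_v[OF that] by (simp add: J_def)
    show "(y has_real_derivative wP s * v s powr (1 / m) - l * wQ s * v s powr (p / m)) (at s within {0<..1})"
      if "s \<in> {0<..1}" for s using dy[OF that] max_v[OF that] by (simp add: H_def)
  qed (use yC v_nonneg in auto)
qed

end

section \<open>Integration by parts across the origin\<close>

lemma integrable_continuous_compact_support:
  fixes w :: "'a::euclidean_space \<Rightarrow> 'b::euclidean_space"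
  assumes "continuous_on UNIV w" "\<And>x. R < norm x \<Longrightarrow> w x = 0"
  shows "integrable lborel w"
proof -
  have "integrable lborel (\<lambda>x. indicator (cball 0 R) x *\<^sub>R w x)"
    by (intro borel_integrable_compact continuous_on_subset[OF assms(1)]) auto
  moreover have "indicator (cball 0 R) x *\<^sub>R w x = w x" for x
    using assms(2)[of x] by (cases "norm x \<le> R") auto
  ultimately show ?thesis by simp
qed

lemma lborel_translate:
  fixes w :: "'a::euclidean_space \<Rightarrow> real"
  assumes "integrable lborel w"
  shows "integrable lborel (\<lambda>x. w (x + c))" "(\<integral>x. w (x + c) \<partial>lborel) = integral\<^sup>L lborel w"
proof -
  have w: "w \<in> borel_measurable borel" using borel_measurable_integrable[OF assms] by simp
  have d: "distr lborel borel (\<lambda>x. x + c) = lborel"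
    using lborel_distr_plus[of c] by (simp add: add.commute[of _ c])
  show "integrable lborel (\<lambda>x. w (x + c))"
    using integrable_distr_eq[of "\<lambda>x. x + c" lborel borel w] w assms by (simp add: d)
  show "(\<integral>x. w (x + c) \<partial>lborel) = integral\<^sup>L lborel w"
    using integral_distr[of "\<lambda>x. x + c" lborel borel w] w by (simp add: d)
qed

text \<open>Translation invariance makes the integrals of the difference quotients vanish.\<close>

lemma integral_directional_derivative_eq_0:
  fixes w D :: "'a::euclidean_space \<Rightarrow> real"
  assumes w: "continuous_on UNIV w" and D: "continuous_on UNIV D"
    and der: "\<And>x. ((\<lambda>t. w (x + t *\<^sub>R b)) has_real_derivative D x) (at 0)"
    and supp: "\<And>x. R < norm x \<Longrightarrow> w x = 0"
  shows "integral\<^sup>L lborel D = 0"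
proof -
  have der': "((\<lambda>t. w (x + t *\<^sub>R b)) has_real_derivative D (x + t *\<^sub>R b)) (at t)" for x t
  proof -
    have "(\<lambda>s. w (x + t *\<^sub>R b + s *\<^sub>R b)) = (\<lambda>s. w (x + (s + t) *\<^sub>R b))"
      by (simp add: scaleR_left_distrib add_ac)
    then show ?thesis
      using der[of "x + t *\<^sub>R b"] DERIV_shift[of "\<lambda>t. w (x + t *\<^sub>R b)" "D (x + t *\<^sub>R b)" 0 t] by simp
  qed
  \<comment> \<open>The difference quotients live in the ball of radius \<open>R + norm b\<close>,
    and the mean value theorem evaluates \<open>D\<close> at most \<open>norm b\<close> further
    away.\<close>
  have "bounded (D ` cball 0 (R + 2 * norm b))"
    by (intro compact_imp_bounded compact_continuous_image continuous_on_subset[OF D]) auto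
  then obtain M where "\<forall>x\<in>cball 0 (R + 2 * norm b). \<bar>D x\<bar> \<le> M"
    unfolding bounded_iff by auto
  then have M: "\<And>x. norm x \<le> R + 2 * norm b \<Longrightarrow> \<bar>D x\<bar> \<le> M" by simp
  have iw: "integrable lborel w" by (rule integrable_continuous_compact_support[OF w supp])
  define h where "h n = 1 / real (Suc n)" for n
  have h: "0 < h n" "h n \<le> 1" for n by (auto simp: h_def)
  have h_lim: "h \<longlonglongrightarrow> 0" unfolding h_def by (rule LIMSEQ_Suc[OF lim_1_over_n])
  define q where "q n x = (w (x + h n *\<^sub>R b) - w x) / h n" for n x
  have q0: "integral\<^sup>L lborel (q n) = 0" for n
    unfolding q_def using lborel_translate[OF iw, of "h n *\<^sub>R b"] iw by simp
  have wm: "w \<in> borel_measurable borel" using borel_measurable_integrable[OF iw] by simp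
  have "(\<lambda>n. integral\<^sup>L lborel (q n)) \<longlonglongrightarrow> integral\<^sup>L lborel D"
  proof (rule integral_dominated_convergence)
    show "D \<in> borel_measurable lborel" using D by (simp add: borel_measurable_continuous_onI)
    show "q n \<in> borel_measurable lborel" for n unfolding q_def using wm by measurable
    show "integrable lborel (\<lambda>x. M * indicator (cball 0 (R + norm b)) x)"
      by (intro integrable_mult_right integrable_real_indicator) (use emeasure_bounded_finite[OF bounded_cball] in auto)
    show "AE x in lborel. (\<lambda>n. q n x) \<longlonglongrightarrow> D x"
    proof (rule AE_I2)
      fix x
      have "((\<lambda>t. (w (x + t *\<^sub>R b) - w (x + 0 *\<^sub>R b)) / (t - 0)) \<longlongrightarrow> D x) (at 0)"
        using der[of x] unfolding has_field_derivative_iff .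
      moreover have "filterlim h (at 0) sequentially"
        unfolding filterlim_at using h_lim less_imp_neq[OF h(1), symmetric] by simp
      ultimately show "(\<lambda>n. q n x) \<longlonglongrightarrow> D x"
        unfolding q_def using filterlim_compose by fastforce
    qed
    show "AE x in lborel. norm (q n x) \<le> M * indicator (cball 0 (R + norm b)) x" for n
    proof (rule AE_I2)
      fix x
      have hb: "norm (h n *\<^sub>R b) \<le> norm b" using h[of n] by (simp add: mult_left_le_one_le)
      show "norm (q n x) \<le> M * indicator (cball 0 (R + norm b)) x"
      proof (cases "norm x \<le> R + norm b")
        case True
        obtain z where z: "0 < z" "z < h n" "w (x + h n *\<^sub>R b) - w (x + 0 *\<^sub>R b) = (h n - 0) * D (x + z *\<^sub>R b)"
          using MVT2[OF h(1), of n "\<lambda>t. w (x + t *\<^sub>R b)" "\<lambda>t. D (x + t *\<^sub>R b)"] der' by auto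
        have "norm (z *\<^sub>R b) \<le> norm b" using z h[of n] by (simp add: mult_left_le_one_le)
        then have "norm (x + z *\<^sub>R b) \<le> R + 2 * norm b" using True norm_triangle_ineq[of x "z *\<^sub>R b"] by simp
        from M[OF this] show ?thesis using z h[of n] True by (simp add: q_def)
      next
        case False
        have "R < norm x" using False norm_ge_zero[of b] by linarith
        moreover have "R < norm (x + h n *\<^sub>R b)"
          using False hb norm_triangle_ineq2[of x "- (h n *\<^sub>R b)"] by simp
        ultimately show ?thesis using False by (simp add: q_def supp)
      qed
    qed
  qed
  then show ?thesis using q0 by (simp add: LIMSEQ_const_iff)
qed

text \<open>For negative exponents the ball is exhausted by the dyadic shells
  \<open>R / 2 ^ Suc k < norm x \<le> R / 2 ^ k\<close>. The value at the inner radius bounds the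
  power on each shell and the volume of the outer ball its measure; the geometric series has ratio
  \<open>2 powr (- \<nu> - d) < 1\<close> because \<open>\<nu>\<close> exceeds minus the
  dimension.\<close>

lemma set_integrable_norm_powr:
  fixes \<nu> R :: real
  assumes "- real DIM('a) < \<nu>" "0 < R"
  shows "set_integrable lborel (cball (0::'a::euclidean_space) R) (\<lambda>x. norm x powr \<nu>)"
proof (cases "0 \<le> \<nu>")
  case True
  show ?thesis unfolding set_integrable_def
  proof (rule Bochner_Integration.integrable_bound)
    show "integrable lborel (\<lambda>x::'a. R powr \<nu> * indicator (cball 0 R) x)"
      by (intro integrable_mult_right integrable_real_indicator) (use emeasure_bounded_finite[OF bounded_cball] in auto)
    show "AE x::'a in lborel. norm (indicator (cball 0 R) x *\<^sub>R norm x powr \<nu>) \<le> norm (R powr \<nu> * indicator (cball 0 R) x)"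
      using True by (intro AE_I2) (auto simp: indicator_def intro!: powr_mono2)
    have "(\<lambda>x::'a. norm x powr \<nu>) \<in> borel_measurable lborel" by simp
    then show "(\<lambda>x::'a. indicator (cball 0 R) x *\<^sub>R norm x powr \<nu>) \<in> borel_measurable lborel"
      by (intro borel_measurable_scaleR borel_measurable_indicator) auto
  qed
next
  case False
  define d where "d = DIM('a)"
  define V where "V = measure lborel (cball (0::'a) 1)"
  define a where "a k = (R / 2 ^ Suc k) powr \<nu>" for k
  define r where "r k = R / 2 ^ k" for k
  define g where "g k x = ennreal (a k) * indicator (cball (0::'a) (r k)) x" for k and x :: 'a
  have a0: "0 \<le> a k" for k by (simp add: a_def)
  have r0: "0 < r k" for k using assms by (simp add: r_def)
  have le: "ennreal (norm (indicator (cball 0 R) x *\<^sub>R norm x powr \<nu>)) \<le> (\<Sum>k. g k x)" for x :: 'a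
  proof (cases "x \<noteq> 0 \<and> norm x \<le> R")
    case True
    have "\<exists>k. R / 2 ^ Suc k < norm x"
    proof -
      have "(\<lambda>k. R * (1 / 2) ^ k) \<longlonglongrightarrow> R * 0" by (intro tendsto_mult_left LIMSEQ_realpow_zero) auto
      then have "\<forall>\<^sub>F k in sequentially. R * (1 / 2) ^ k < norm x"
        using True by (intro order_tendstoD(2)) auto
      then obtain k where "R * (1 / 2) ^ Suc k < norm x"
        unfolding eventually_sequentially by (meson le_SucI order_refl)
      then show ?thesis by (intro exI[of _ k]) (simp add: power_divide)
    qed
    define k where "k = (LEAST k. R / 2 ^ Suc k < norm x)"
    have k: "R / 2 ^ Suc k < norm x" unfolding k_def by (rule LeastI_ex) fact
    have k': "norm x \<le> r k"
    proof (cases k)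
      case 0 then show ?thesis using True by (simp add: r_def)
    next
      case (Suc j)
      then have "j < k" by simp
      then have "j < (LEAST k. R / 2 ^ Suc k < norm x)" unfolding k_def .
      from not_less_Least[OF this] have "\<not> R / 2 ^ Suc j < norm x" .
      then show ?thesis using Suc by (simp add: r_def)
    qed
    have "norm x powr \<nu> \<le> a k"
      unfolding a_def using k False assms by (intro powr_mono2') auto
    then have "ennreal (norm (indicator (cball 0 R) x *\<^sub>R norm x powr \<nu>)) \<le> g k x"
      using True k' by (simp add: g_def ennreal_leI)
    also have "g k x \<le> (\<Sum>k. g k x)"
      using sum_le_suminf[OF summableI, of "{k}" "\<lambda>k. g k x"] by simp
    finally show ?thesis .
  qed auto
  have gk: "(\<integral>\<^sup>+x. g k x \<partial>lborel) = ennreal ((R / 2) powr \<nu> * R ^ d * V * (2 powr (- \<nu> - d)) ^ k)" for k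
  proof -
    have "(\<integral>\<^sup>+x. g k x \<partial>lborel) = ennreal (a k) * emeasure lborel (cball (0::'a) (r k))"
      unfolding g_def by (rule nn_integral_cmult_indicator) simp
    also have "emeasure lborel (cball (0::'a) (r k)) = ennreal (r k ^ d * V)"
      using emeasure_cball[of "r k" "0::'a"] content_cball[of 1 "0::'a"] r0[of k]
      by (simp add: V_def d_def mult.commute)
    also have "ennreal (a k) * ennreal (r k ^ d * V) = ennreal (a k * (r k ^ d * V))"
      using a0 r0[of k] by (simp add: ennreal_mult V_def less_imp_le)
    also have "a k * (r k ^ d * V) = (R / 2) powr \<nu> * R ^ d * V * (2 powr (- \<nu> - d)) ^ k"
    proof -
      have "a k = (R / 2 * 2 powr (- real k)) powr \<nu>"
        unfolding a_def by (simp add: powr_minus powr_realpow field_simps)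
      also have "\<dots> = (R / 2) powr \<nu> * 2 powr (- \<nu> * k)"
        by (subst powr_mult) (use assms in \<open>auto simp: powr_powr mult.commute\<close>)
      finally have ak: "a k = (R / 2) powr \<nu> * 2 powr (- \<nu> * k)" .
      have "r k ^ d = R ^ d * 2 powr (- real d * k)"
        unfolding r_def by (simp add: power_divide powr_minus powr_realpow[symmetric] powr_powr power_mult[symmetric] field_simps)
      moreover have "(2 powr (- \<nu> - d)) ^ k = 2 powr (- \<nu> * k) * 2 powr (- real d * k)"
        by (simp add: powr_realpow[symmetric] powr_powr powr_add[symmetric] algebra_simps)
      ultimately show ?thesis using ak by simp
    qed
    finally show ?thesis .
  qed
  have "(\<integral>\<^sup>+x. ennreal (norm (indicator (cball 0 R) x *\<^sub>R norm x powr \<nu>)) \<partial>(lborel :: 'a measure)) \<le>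
      (\<integral>\<^sup>+x. (\<Sum>k. g k x) \<partial>lborel)"
    by (intro nn_integral_mono le)
  also have "\<dots> = (\<Sum>k. \<integral>\<^sup>+x. g k x \<partial>lborel)"
  proof (rule nn_integral_suminf)
    fix k
    have [measurable]: "cball (0::'a) (r k) \<in> sets borel" by simp
    show "g k \<in> borel_measurable lborel" unfolding g_def by measurable
  qed
  also have "\<dots> = (\<Sum>k. ennreal ((R / 2) powr \<nu> * R ^ d * V * (2 powr (- \<nu> - d)) ^ k))"
    by (simp only: gk)
  also have "\<dots> < \<infinity>"
  proof -
    have "2 powr (- \<nu> - d) < 2 powr 0" using assms by (intro powr_less_mono) (auto simp: d_def)
    then have "summable (\<lambda>k. (R / 2) powr \<nu> * R ^ d * V * (2 powr (- \<nu> - d)) ^ k)"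
      by (intro summable_mult summable_geometric) simp
    note sums = summable_sums[OF this]
    have "0 \<le> (R / 2) powr \<nu> * R ^ d * V * (2 powr (- \<nu> - d)) ^ k" for k
      using assms by (simp add: V_def)
    note suminf_ennreal_eq[OF this sums]
    then show ?thesis by (simp only: ennreal_less_top infinity_ennreal_def)
  qed
  finally have fin: "(\<integral>\<^sup>+x. ennreal (norm (indicator (cball 0 R) x *\<^sub>R norm x powr \<nu>)) \<partial>(lborel :: 'a measure)) < \<infinity>" .
  have "(\<lambda>x::'a. norm x powr \<nu>) \<in> borel_measurable lborel" by simp
  then have "(\<lambda>x::'a. indicator (cball 0 R) x *\<^sub>R norm x powr \<nu>) \<in> borel_measurable lborel"
    by (intro borel_measurable_scaleR borel_measurable_indicator) auto
  from this fin show ?thesis unfolding set_integrable_def by (rule integrableI_bounded)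
qed

text \<open>Squaring removes the corner of the positive part, so a cut-off of this form is
  continuously differentiable.\<close>

lemma max0_square_derivative: "((\<lambda>u::real. (max 0 u)\<^sup>2) has_real_derivative 2 * max 0 u) (at u)"
proof -
  consider "0 < u" | "u < 0" | "u = 0" by linarith
  then show ?thesis
  proof cases
    case 1
    have "((\<lambda>u. u\<^sup>2) has_real_derivative 2 * u) (at u)" by (auto intro!: derivative_eq_intros)
    then have "((\<lambda>u. (max 0 u)\<^sup>2) has_real_derivative 2 * u) (at u)"
      by (rule has_field_derivative_transform_within_open[where S = "{0<..}"]) (use 1 in auto)
    then show ?thesis using 1 by simp
  next
    case 2
    have "((\<lambda>u. 0) has_real_derivative 0) (at u)" by simp
    then have "((\<lambda>u. (max 0 u)\<^sup>2) has_real_derivative 0) (at u)"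
      by (rule has_field_derivative_transform_within_open[where S = "{..<0}"]) (use 2 in auto)
    then show ?thesis using 2 by simp
  next
    case 3
    have "((\<lambda>y. (max 0 y)\<^sup>2 / y) \<longlongrightarrow> 0) (at (0::real))"
    proof (rule metric_tendsto_imp_tendsto)
      show "((\<lambda>y::real. y) \<longlongrightarrow> 0) (at 0)" by (rule tendsto_ident_at)
      show "\<forall>\<^sub>F y in at (0::real). dist ((max 0 y)\<^sup>2 / y) 0 \<le> dist y 0"
        by (rule always_eventually) (auto simp: max_def power2_eq_square)
    qed
    then show ?thesis using 3 by (simp add: has_field_derivative_iff)
  qed
qed

lemma norm_directional_derivative:
  fixes x b :: "'a::euclidean_space"
  assumes "x \<noteq> 0"
  shows "((\<lambda>t. norm (x + t *\<^sub>R b)) has_real_derivative (x \<bullet> b) / norm x) (at 0)"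
proof -
  define f where "f t = (x + t *\<^sub>R b) \<bullet> (x + t *\<^sub>R b)" for t
  have f: "(f has_real_derivative 2 * (x \<bullet> b)) (at 0)"
    unfolding f_def inner_add_left inner_add_right inner_scaleR_left inner_scaleR_right
    by (auto intro!: derivative_eq_intros simp: inner_commute)
  have "0 < f 0" using assms by (simp add: f_def)
  from DERIV_chain2[OF DERIV_real_sqrt[OF this] f]
  have 1: "((\<lambda>t. sqrt (f t)) has_real_derivative inverse (sqrt (f 0)) / 2 * (2 * (x \<bullet> b))) (at 0)" .
  have 2: "sqrt (f t) = norm (x + t *\<^sub>R b)" for t by (simp only: f_def norm_eq_sqrt_inner)
  have 3: "inverse (norm (x + 0 *\<^sub>R b)) / 2 * (2 * (x \<bullet> b)) = (x \<bullet> b) / norm x"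
    by (simp add: inverse_eq_divide)
  show ?thesis using 1 unfolding 2 3 .
qed

text \<open>The cut-off \<open>max 0 (1 - 1 / (k |x|\<^sup>2))\<^sup>2\<close> is \<open>C\<^sup>1\<close>, vanishes near the origin, and its
  gradient is at most \<open>4 / |x|\<close>; the growth conditions make its contribution negligible.\<close>

lemma integral_directional_derivative_punctured:
  fixes w D :: "'a::euclidean_space \<Rightarrow> real" and b :: 'a
  assumes b: "norm b = 1"
    and w: "continuous_on (- {0}) w" and D: "continuous_on (- {0}) D"
    and der: "\<And>x. x \<noteq> 0 \<Longrightarrow> ((\<lambda>t. w (x + t *\<^sub>R b)) has_real_derivative D x) (at 0)"
    and supp: "\<And>x. R < norm x \<Longrightarrow> w x = 0 \<and> D x = 0" and R: "0 < R"
    and \<nu>: "- real DIM('a) < \<nu>"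
    and wb: "\<And>x. x \<noteq> 0 \<Longrightarrow> norm x \<le> R \<Longrightarrow> \<bar>w x\<bar> \<le> C * norm x powr (1 + \<nu>)"
    and Db: "\<And>x. x \<noteq> 0 \<Longrightarrow> norm x \<le> R \<Longrightarrow> \<bar>D x\<bar> \<le> C * norm x powr \<nu>"
  shows "integrable lborel D" "integral\<^sup>L lborel D = 0"
proof -
  \<comment> \<open>The threshold is the radius \<open>1 / sqrt (Suc k)\<close>. Both
    \<open>wk\<close> and \<open>Dk\<close> vanish inside it, which makes them continuous on the
    whole space whatever the behaviour of \<open>w\<close> and \<open>D\<close> at the
    origin.\<close>
  define e where "e k x = max 0 (1 - 1 / (real (Suc k) * (x \<bullet> x)))" for k and x :: 'a
  define de where "de k x = 2 * e k x * (2 * (x \<bullet> b) / (real (Suc k) * (x \<bullet> x)\<^sup>2))" for k and x :: 'a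
  define wk where "wk k x = (if x = 0 then 0 else (e k x)\<^sup>2 * w x)" for k x
  define Dk where "Dk k x = (if x = 0 then 0 else (e k x)\<^sup>2 * D x + de k x * w x)" for k x
  have e01: "0 \<le> e k x" "e k x \<le> 1" for k x by (auto simp: e_def)
  have e0: "e k x = 0" if "norm x < 1 / sqrt (Suc k)" "x \<noteq> 0" for k x
  proof -
    have "(norm x)\<^sup>2 < (1 / sqrt (Suc k))\<^sup>2" using that(1) by (intro power_strict_mono) auto
    then have "x \<bullet> x < 1 / Suc k" by (simp add: power2_norm_eq_inner power_divide)
    then have "real (Suc k) * (x \<bullet> x) < 1" by (simp add: pos_less_divide_eq mult.commute)
    moreover have "0 < real (Suc k) * (x \<bullet> x)" using that(2) by simp
    ultimately have "1 \<le> 1 / (real (Suc k) * (x \<bullet> x))" by (simp add: pos_le_divide_eq del: of_nat_Suc)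
    then show ?thesis unfolding e_def by linarith
  qed
  have cont_e: "continuous_on (- {0}) (e k)" for k
    unfolding e_def by (intro continuous_intros) (auto simp del: of_nat_Suc)
  have cont_de: "continuous_on (- {0}) (de k)" for k
    unfolding de_def by (intro continuous_intros cont_e) (auto simp del: of_nat_Suc)
  have der_e: "((\<lambda>t. (e k (x + t *\<^sub>R b))\<^sup>2) has_real_derivative de k x) (at 0)" if "x \<noteq> 0" for k x
  proof -
    have i: "((\<lambda>t. (x + t *\<^sub>R b) \<bullet> (x + t *\<^sub>R b)) has_real_derivative 2 * (x \<bullet> b)) (at 0)"
      unfolding inner_add_left inner_add_right inner_scaleR_left inner_scaleR_right
      by (auto intro!: derivative_eq_intros simp: inner_commute)
    have "((\<lambda>t. 1 - inverse (real (Suc k)) * inverse ((x + t *\<^sub>R b) \<bullet> (x + t *\<^sub>R b))) has_real_derivative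
        0 - inverse (real (Suc k)) * - (2 * (x \<bullet> b) * inverse (((x + 0 *\<^sub>R b) \<bullet> (x + 0 *\<^sub>R b)) ^ Suc (Suc 0)))) (at 0)"
      by (intro DERIV_diff DERIV_const DERIV_cmult DERIV_inverse_fun i) (use that in auto)
    then have "((\<lambda>t. 1 - 1 / (real (Suc k) * ((x + t *\<^sub>R b) \<bullet> (x + t *\<^sub>R b)))) has_real_derivative
        2 * (x \<bullet> b) / (real (Suc k) * (x \<bullet> x)\<^sup>2)) (at 0)"
      by (simp add: divide_inverse power2_eq_square mult_ac del: of_nat_Suc)
    from DERIV_chain2[OF max0_square_derivative this]
    show ?thesis by (simp add: e_def de_def del: of_nat_Suc)
  qed
  have nhd: "\<exists>d>0. \<forall>y. norm y < d \<longrightarrow> wk k y = 0 \<and> Dk k y = 0" for k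
    by (intro exI[of _ "1 / sqrt (Suc k)"]) (auto simp: wk_def Dk_def de_def e0)
  have cont_ext: "continuous_on UNIV f"
    if f: "continuous_on (- {0}) f" and z: "\<exists>d>0. \<forall>y. norm y < d \<longrightarrow> f y = 0" for f :: "'a \<Rightarrow> real"
  proof -
    obtain d where d: "0 < d" "\<And>y. norm y < d \<Longrightarrow> f y = 0" using z by blast
    have "continuous_on (ball 0 d) f"
      by (rule continuous_on_eq[OF continuous_on_const[of _ 0]]) (use d in auto)
    moreover have "open (- {0::'a})" by auto
    ultimately have "continuous_on (ball 0 d \<union> - {0}) f"
      using f by (intro continuous_on_open_Un) auto
    moreover have "ball 0 d \<union> - {0} = (UNIV :: 'a set)" using d(1) by auto
    ultimately show ?thesis by simp
  qed
  have "continuous_on (- {0}) (wk k)" for k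
  proof -
    have "continuous_on (- {0}) (\<lambda>x. (e k x)\<^sup>2 * w x)" by (intro continuous_intros cont_e w)
    then show ?thesis by (rule continuous_on_eq) (simp add: wk_def)
  qed
  from cont_ext[OF this] nhd have cwk: "continuous_on UNIV (wk k)" for k by blast
  have "continuous_on (- {0}) (Dk k)" for k
  proof -
    have "continuous_on (- {0}) (\<lambda>x. (e k x)\<^sup>2 * D x + de k x * w x)"
      by (intro continuous_intros cont_e cont_de w D)
    then show ?thesis by (rule continuous_on_eq) (simp add: Dk_def)
  qed
  from cont_ext[OF this] nhd have cDk: "continuous_on UNIV (Dk k)" for k by blast
  have near0: "\<forall>\<^sub>F t in nhds (0::real). norm (x + t *\<^sub>R b) < d" if "norm x < d" for x d
  proof -
    have "((\<lambda>t. norm (x + t *\<^sub>R b)) \<longlongrightarrow> norm (x + 0 *\<^sub>R b)) (nhds 0)"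
      by (intro tendsto_intros filterlim_ident)
    then show ?thesis using that by (intro order_tendstoD(2)) auto
  qed
  have derk: "((\<lambda>t. wk k (x + t *\<^sub>R b)) has_real_derivative Dk k x) (at 0)" for k x
  proof (cases "x = 0")
    case True
    obtain d where d: "0 < d" "\<And>y. norm y < d \<Longrightarrow> wk k y = 0" using nhd[of k] by blast
    have "\<forall>\<^sub>F t in nhds 0. norm (x + t *\<^sub>R b) < d" using near0[of x d] d(1) True by simp
    then have "\<forall>\<^sub>F t in nhds 0. 0 = wk k (x + t *\<^sub>R b)" by (rule eventually_mono) (simp add: d(2))
    from DERIV_cong_ev[OF refl this refl, of 0] True show ?thesis by (simp add: Dk_def)
  next
    case False
    have "((\<lambda>t. (e k (x + t *\<^sub>R b))\<^sup>2 * w (x + t *\<^sub>R b)) has_real_derivative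
        de k x * w (x + 0 *\<^sub>R b) + D x * (e k (x + 0 *\<^sub>R b))\<^sup>2) (at 0)"
      by (rule DERIV_mult[OF der_e[OF False] der[OF False]])
    then have *: "((\<lambda>t. (e k (x + t *\<^sub>R b))\<^sup>2 * w (x + t *\<^sub>R b)) has_real_derivative Dk k x) (at 0)"
      using False by (simp add: Dk_def mult.commute add.commute)
    have "((\<lambda>t. x + t *\<^sub>R b) \<longlongrightarrow> x + 0 *\<^sub>R b) (nhds 0)"
      by (intro tendsto_intros filterlim_ident)
    then have "\<forall>\<^sub>F t in nhds (0::real). x + t *\<^sub>R b \<noteq> 0"
      using False by (intro tendsto_imp_eventually_ne) auto
    then have "\<forall>\<^sub>F t in nhds 0. (e k (x + t *\<^sub>R b))\<^sup>2 * w (x + t *\<^sub>R b) = wk k (x + t *\<^sub>R b)"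
      by (rule eventually_mono) (simp add: wk_def)
    from DERIV_cong_ev[OF refl this refl] * show ?thesis by blast
  qed
  have int0: "integral\<^sup>L lborel (Dk k) = 0" for k
    by (rule integral_directional_derivative_eq_0[OF cwk cDk derk, of R]) (auto simp: wk_def supp)
  \<comment> \<open>The factor \<open>5\<close> is \<open>1\<close> for the cut-off times
    \<open>D\<close> plus \<open>4\<close> for the derivative of the cut-off times
    \<open>w\<close>.\<close>
  define B where "B x = 5 * C * (indicator (cball 0 R) x *\<^sub>R norm x powr \<nu>)" for x :: 'a
  have B: "integrable lborel B"
    using set_integrable_norm_powr[OF \<nu> R] unfolding B_def set_integrable_def by (rule integrable_mult_right)
  have AE0: "AE x in lborel. x \<noteq> (0::'a)" by (rule AE_lborel_singleton)
  have Dm: "D \<in> borel_measurable lborel"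
  proof -
    have "(\<lambda>x. indicator (- {0}) x *\<^sub>R D x) \<in> borel_measurable borel"
      by (intro borel_measurable_continuous_on_indicator D) auto
    then have "(\<lambda>x. if x = 0 then D 0 else indicator (- {0}) x *\<^sub>R D x) \<in> borel_measurable borel"
      by (intro measurable_If) auto
    moreover have "(\<lambda>x. if x = 0 then D 0 else indicator (- {0}) x *\<^sub>R D x) = D" by auto
    ultimately show ?thesis by simp
  qed
  have bound: "\<bar>Dk k x\<bar> \<le> B x" for k x
  proof (cases "x = 0 \<or> R < norm x")
    case True then show ?thesis using supp by (auto simp: Dk_def B_def)
  next
    case False
    then have x: "x \<noteq> 0" "norm x \<le> R" by auto
    have C0: "0 \<le> C * norm x powr \<nu>" using Db[OF x] by linarith
    have "\<bar>(e k x)\<^sup>2 * D x\<bar> \<le> 1 * (C * norm x powr \<nu>)"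
      unfolding abs_mult using Db[OF x] e01[of k x] C0 by (intro mult_mono) (auto simp: power_le_one)
    moreover have "\<bar>de k x * w x\<bar> \<le> (4 / norm x) * (C * norm x powr (1 + \<nu>))"
    proof -
      have "\<bar>de k x\<bar> \<le> 4 / norm x"
      proof (cases "e k x = 0")
        case True then show ?thesis by (simp add: de_def)
      next
        case False
        then have "1 / (real (Suc k) * (x \<bullet> x)) < 1" unfolding e_def by linarith
        \<comment> \<open>Where the cut-off is positive,
          \<open>1 \<le> Suc k * (x \<bullet> x)\<close> absorbs one factor of the denominator and
          frees the bound from \<open>k\<close>.\<close>
        then have kx: "1 \<le> real (Suc k) * (x \<bullet> x)" using x by (simp add: divide_less_eq del: of_nat_Suc)
        have "\<bar>x \<bullet> b\<bar> \<le> norm x" using Cauchy_Schwarz_ineq2[of x b] b by simp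
        then have "\<bar>2 * (x \<bullet> b) / (real (Suc k) * (x \<bullet> x)\<^sup>2)\<bar> \<le> 2 * norm x / (1 * (x \<bullet> x))"
          unfolding abs_divide power2_eq_square mult.assoc[symmetric]
          using kx x by (intro frac_le mult_right_mono) (auto simp: abs_mult simp del: of_nat_Suc)
        also have "\<dots> = 2 / norm x"
          using x by (simp add: power2_norm_eq_inner[symmetric] power2_eq_square)
        finally have "\<bar>2 * e k x\<bar> * \<bar>2 * (x \<bullet> b) / (real (Suc k) * (x \<bullet> x)\<^sup>2)\<bar> \<le> 2 * (2 / norm x)"
          using e01[of k x] by (intro mult_mono) auto
        then show ?thesis unfolding de_def abs_mult[of "2 * e k x"] by simp
      qed
      then show ?thesis unfolding abs_mult using wb[OF x] by (intro mult_mono) auto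
    qed
    moreover have "(4 / norm x) * (C * norm x powr (1 + \<nu>)) = 4 * (C * norm x powr \<nu>)"
      using x by (simp add: powr_add)
    ultimately have "\<bar>Dk k x\<bar> \<le> 5 * (C * norm x powr \<nu>)" using x by (simp add: Dk_def)
    then show ?thesis using x by (simp add: B_def)
  qed
  have lim: "(\<lambda>k. Dk k x) \<longlonglongrightarrow> D x" if "x \<noteq> 0" for x
  proof -
    have inv: "(\<lambda>k. 1 / real (Suc k)) \<longlonglongrightarrow> 0" by (rule LIMSEQ_Suc[OF lim_1_over_n])
    have "(\<lambda>k. max 0 (1 - 1 / real (Suc k) * (1 / (x \<bullet> x)))) \<longlonglongrightarrow> max 0 (1 - 0 * (1 / (x \<bullet> x)))"
      by (intro tendsto_intros inv)
    then have e1: "(\<lambda>k. e k x) \<longlonglongrightarrow> 1" by (simp add: e_def del: of_nat_Suc)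
    have "(\<lambda>k. 2 * e k x * (1 / real (Suc k) * (2 * (x \<bullet> b) / (x \<bullet> x)\<^sup>2))) \<longlonglongrightarrow>
        2 * 1 * (0 * (2 * (x \<bullet> b) / (x \<bullet> x)\<^sup>2))"
      by (intro tendsto_intros inv e1)
    then have "(\<lambda>k. de k x) \<longlonglongrightarrow> 0" by (simp add: de_def del: of_nat_Suc)
    then have "(\<lambda>k. (e k x)\<^sup>2 * D x + de k x * w x) \<longlonglongrightarrow> 1\<^sup>2 * D x + 0 * w x"
      by (intro tendsto_intros e1)
    then show ?thesis using that by (simp add: Dk_def)
  qed
  have Dkm: "Dk k \<in> borel_measurable lborel" for k using cDk by (simp add: borel_measurable_continuous_onI)
  have l1: "AE x in lborel. (\<lambda>k. Dk k x) \<longlonglongrightarrow> D x" using AE0 by eventually_elim (rule lim)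
  have l2: "AE x in lborel. norm (Dk k x) \<le> B x" for k using bound by simp
  show "integral\<^sup>L lborel D = 0"
    using integral_dominated_convergence[OF Dm Dkm B l1 l2] by (simp add: int0 LIMSEQ_const_iff)
  show "integrable lborel D" by (rule integrable_dominated_convergence[OF Dm Dkm B l1 l2])
qed

lemma bounded_on_cball:
  fixes f :: "'a::euclidean_space \<Rightarrow> 'b::real_normed_vector"
  assumes "continuous_on UNIV f"
  obtains M where "0 \<le> M" "\<And>x. norm x \<le> R \<Longrightarrow> norm (f x) \<le> M"
proof -
  have "bounded (f ` cball 0 R)"
    by (intro compact_imp_bounded compact_continuous_image continuous_on_subset[OF assms]) auto
  then obtain M where "\<forall>x\<in>cball 0 R. norm (f x) \<le> M" unfolding bounded_iff by auto
  then show ?thesis by (intro that[of "max 0 M"]) (auto simp: le_max_iff_disj)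
qed

section \<open>Integration by parts for radial fields against a compactly supported function\<close>

context
  fixes \<phi> :: "'a::euclidean_space \<Rightarrow> real" and g :: "'a \<Rightarrow> 'a" and R :: real
  assumes \<phi>: "continuous_on UNIV \<phi>" and g: "continuous_on UNIV g"
    and der: "\<And>x b. ((\<lambda>t. \<phi> (x + t *\<^sub>R b)) has_real_derivative g x \<bullet> b) (at 0)"
    and supp: "\<And>x. R < norm x \<Longrightarrow> \<phi> x = 0 \<and> g x = 0" and R: "0 < R"
begin

lemma radial_continuous:
  assumes "continuous_on {0<..} f"
  shows "continuous_on (- {0}) (\<lambda>x::'a. f (norm x) :: real)"
  by (rule continuous_on_compose2[OF assms]) (auto intro: continuous_intros)

lemma radial_derivative:
  fixes V :: "real \<Rightarrow> real" and x b :: 'a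
  assumes "\<And>r. 0 < r \<Longrightarrow> (V has_real_derivative V' r) (at r)" "x \<noteq> 0"
  shows "((\<lambda>t. V (norm (x + t *\<^sub>R b))) has_real_derivative V' (norm x) * ((x \<bullet> b) / norm x)) (at 0)"
proof -
  have "(V has_real_derivative V' (norm x)) (at (norm (x + 0 *\<^sub>R b)))"
    using assms(1)[of "norm x"] assms(2) by simp
  from DERIV_chain2[OF this norm_directional_derivative[OF assms(2)]] show ?thesis .
qed

lemma inner_unit_le: "norm b = 1 \<Longrightarrow> \<bar>(x::'a) \<bullet> b\<bar> \<le> norm x"
  using Cauchy_Schwarz_ineq2[of x b] by simp

text \<open>\<open>V\<close> need not vanish at the origin, so \<open>Vz\<close> is subtracted to
  give the product with \<open>\<phi>\<close> one power more than its derivative. The constant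
  \<open>Vz\<close> is treated separately, the integral of \<open>g x \<bullet> b\<close> being zero
  by compact support.\<close>

lemma radial_gradient_by_parts:
  fixes V V' :: "real \<Rightarrow> real"
  assumes V: "\<And>r. 0 < r \<Longrightarrow> (V has_real_derivative V' r) (at r)"
    and V': "continuous_on {0<..} V'"
    and bV: "\<And>r. 0 < r \<Longrightarrow> r \<le> R \<Longrightarrow> \<bar>V r - Vz\<bar> \<le> C * r powr (2 + \<mu>)"
    and bV': "\<And>r. 0 < r \<Longrightarrow> r \<le> R \<Longrightarrow> \<bar>V' r\<bar> \<le> C * r powr (1 + \<mu>)"
    and \<mu>: "- real DIM('a) < 1 + \<mu>" and b: "norm b = 1"
  shows "(\<integral>x. V (norm x) * (g x \<bullet> b) + V' (norm x) * ((x \<bullet> b) / norm x) * \<phi> x \<partial>lborel) = 0"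
proof -
  have cV: "continuous_on {0<..} V"
    by (rule DERIV_continuous_on[OF has_field_derivative_at_within[OF V]]) auto
  obtain Mp where Mp: "0 \<le> Mp" "\<And>x. norm x \<le> R \<Longrightarrow> norm (\<phi> x) \<le> Mp" using bounded_on_cball[OF \<phi>] by metis
  obtain Mg where Mg: "0 \<le> Mg" "\<And>x. norm x \<le> R \<Longrightarrow> norm (g x) \<le> Mg" using bounded_on_cball[OF g] by metis
  have "0 \<le> C * R powr (1 + \<mu>)" using bV'[OF R order_refl] by linarith
  then have C: "0 \<le> C" using R by (simp add: zero_le_mult_iff)
  define w where "w x = (V (norm x) - Vz) * \<phi> x" for x
  define D where "D x = V' (norm x) * ((x \<bullet> b) / norm x) * \<phi> x + (g x \<bullet> b) * (V (norm x) - Vz)" for x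
  define C' where "C' = C * Mp + C * R * Mg"
  have a1: "continuous_on (- {0}) w"
    unfolding w_def by (intro continuous_intros radial_continuous[OF cV] continuous_on_subset[OF \<phi>]) auto
  have a2: "continuous_on (- {0}) D"
    unfolding D_def
    by (intro continuous_intros radial_continuous[OF cV] radial_continuous[OF V']
        continuous_on_subset[OF \<phi>] continuous_on_subset[OF g]) auto
  have a3: "((\<lambda>t. w (x + t *\<^sub>R b)) has_real_derivative D x) (at 0)" if "x \<noteq> 0" for x
  proof -
    have "((\<lambda>t. V (norm (x + t *\<^sub>R b)) - Vz) has_real_derivative V' (norm x) * ((x \<bullet> b) / norm x) - 0) (at 0)"
      by (intro DERIV_diff DERIV_const radial_derivative V that)
    from DERIV_mult[OF this der[of x b]] show ?thesis
      unfolding w_def D_def by simp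
  qed
  have a4: "w x = 0 \<and> D x = 0" if "R < norm x" for x
    using supp[OF that] by (simp add: w_def D_def)
  have up: "r powr (2 + \<mu>) = r * r powr (1 + \<mu>)" if "0 < r" for r
    using that powr_add[of r 1 "1 + \<mu>"] by simp
  have a5: "\<bar>w x\<bar> \<le> C' * norm x powr (1 + (1 + \<mu>))" if x: "x \<noteq> 0" "norm x \<le> R" for x
  proof -
    have "\<bar>w x\<bar> \<le> (C * norm x powr (2 + \<mu>)) * Mp"
      unfolding w_def abs_mult using x bV[of "norm x"] Mp(2)[of x] by (intro mult_mono) auto
    also have "\<dots> = C * Mp * norm x powr (2 + \<mu>)" by simp
    also have "\<dots> \<le> C' * norm x powr (2 + \<mu>)"
      using C R Mg(1) by (intro mult_right_mono) (auto simp: C'_def)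
    finally show ?thesis by simp
  qed
  have a6: "\<bar>D x\<bar> \<le> C' * norm x powr (1 + \<mu>)" if x: "x \<noteq> 0" "norm x \<le> R" for x
  proof -
    have "\<bar>V' (norm x) * ((x \<bullet> b) / norm x) * \<phi> x\<bar> \<le> (C * norm x powr (1 + \<mu>)) * 1 * Mp"
      unfolding abs_mult using x bV'[of "norm x"] Mp(2)[of x] inner_unit_le[OF b, of x] C
      by (intro mult_mono) (auto simp: abs_divide divide_le_eq)
    moreover have "\<bar>(g x \<bullet> b) * (V (norm x) - Vz)\<bar> \<le> Mg * (C * norm x powr (2 + \<mu>))"
      unfolding abs_mult using x bV[of "norm x"] Mg inner_unit_le[OF b, of "g x"]
      by (intro mult_mono order_trans[OF inner_unit_le[OF b]]) auto
    moreover have "Mg * (C * norm x powr (2 + \<mu>)) \<le> Mg * (C * (R * norm x powr (1 + \<mu>)))"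
      using x C Mg(1) up[of "norm x"] by (intro mult_left_mono mult_right_mono) auto
    ultimately have "\<bar>D x\<bar> \<le> (C * norm x powr (1 + \<mu>)) * 1 * Mp + Mg * (C * (R * norm x powr (1 + \<mu>)))"
      unfolding D_def by linarith
    then show ?thesis by (simp add: C'_def algebra_simps)
  qed
  note D = integral_directional_derivative_punctured[OF b a1 a2 a3 a4 R \<mu> a5 a6]
  have g0: "integral\<^sup>L lborel (\<lambda>x. g x \<bullet> b) = 0"
    by (rule integral_directional_derivative_eq_0[OF \<phi> _ der, where R = R]) (use g supp in \<open>auto intro: continuous_intros\<close>)
  have gi: "integrable lborel (\<lambda>x. g x \<bullet> b)"
    by (rule integrable_continuous_compact_support[where R = R]) (use g supp in \<open>auto intro: continuous_intros\<close>)
  have "(\<lambda>x. V (norm x) * (g x \<bullet> b) + V' (norm x) * ((x \<bullet> b) / norm x) * \<phi> x) =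
      (\<lambda>x. D x + Vz * (g x \<bullet> b))"
    by (simp add: D_def algebra_simps)
  then show ?thesis using D gi g0 by (simp del: integral_mult_right_zero)
qed

text \<open>The field is \<open>A (norm x) *\<^sub>R x\<close> with
  \<open>A r = Y r * r powr - N\<close>. As \<open>norm x powr - N *\<^sub>R x\<close> is
  divergence-free away from the origin, its divergence is \<open>Y' r * r powr (1 - N)\<close> with
  \<open>r = norm x\<close>. Each component times \<open>\<phi>\<close> is treated with the cut-off,
  and the components are summed.\<close>

lemma radial_flux_by_parts:
  fixes Y Y' :: "real \<Rightarrow> real" and C \<mu> :: real
  assumes Y: "\<And>r. 0 < r \<Longrightarrow> (Y has_real_derivative Y' r) (at r)"
    and Y': "continuous_on {0<..} Y'"
    and bY: "\<And>r. 0 < r \<Longrightarrow> r \<le> R \<Longrightarrow> \<bar>Y r\<bar> \<le> C * r powr (real DIM('a) + \<mu>)"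
    and bY': "\<And>r. 0 < r \<Longrightarrow> r \<le> R \<Longrightarrow> \<bar>Y' r\<bar> \<le> C * r powr (real DIM('a) - 1 + \<mu>)"
    and \<mu>: "- real DIM('a) < \<mu>"
  shows "(\<integral>x. Y (norm x) * norm x powr (- real DIM('a)) * (x \<bullet> g x) +
      Y' (norm x) * norm x powr (1 - real DIM('a)) * \<phi> x \<partial>lborel) = 0"
proof -
  define N where "N = real DIM('a)"
  have N: "0 < N" by (simp add: N_def)
  define A where "A r = Y r * r powr - N" for r
  define A' where "A' r = Y' r * r powr - N + (- N * r powr (- N - 1)) * Y r" for r
  have A: "(A has_real_derivative A' r) (at r)" if "0 < r" for r
    unfolding A_def A'_def by (rule DERIV_mult[OF Y[OF that] has_real_derivative_powr[OF that]])
  have cA: "continuous_on {0<..} A"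
    by (rule DERIV_continuous_on[OF has_field_derivative_at_within[OF A]]) auto
  have cY: "continuous_on {0<..} Y"
    by (rule DERIV_continuous_on[OF has_field_derivative_at_within[OF Y]]) auto
  have cA': "continuous_on {0<..} A'"
    unfolding A'_def by (intro continuous_intros Y' cY) auto
  obtain Mp where Mp: "0 \<le> Mp" "\<And>x. norm x \<le> R \<Longrightarrow> norm (\<phi> x) \<le> Mp" using bounded_on_cball[OF \<phi>] by metis
  obtain Mg where Mg: "0 \<le> Mg" "\<And>x. norm x \<le> R \<Longrightarrow> norm (g x) \<le> Mg" using bounded_on_cball[OF g] by metis
  have "0 \<le> C * R powr (real DIM('a) + \<mu>)" using bY[OF R order_refl] by linarith
  then have C: "0 \<le> C" using R by (simp add: zero_le_mult_iff)
  have bA: "\<bar>A r\<bar> \<le> C * r powr \<mu>" if r: "0 < r" "r \<le> R" for r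
  proof -
    have "\<bar>A r\<bar> \<le> (C * r powr (N + \<mu>)) * r powr - N"
      unfolding A_def abs_mult using bY[OF r] by (intro mult_mono) (auto simp: N_def)
    also have "\<dots> = C * (r powr (N + \<mu>) * r powr - N)" by simp
    also have "r powr (N + \<mu>) * r powr - N = r powr \<mu>" by (simp flip: powr_add)
    finally show ?thesis .
  qed
  have bA': "\<bar>A' r\<bar> \<le> (1 + N) * C * r powr (\<mu> - 1)" if r: "0 < r" "r \<le> R" for r
  proof -
    have "\<bar>Y' r * r powr - N\<bar> \<le> (C * r powr (N - 1 + \<mu>)) * r powr - N"
      unfolding abs_mult using bY'[OF r] by (intro mult_mono) (auto simp: N_def)
    also have "\<dots> = C * (r powr (N - 1 + \<mu>) * r powr - N)" by simp
    also have "r powr (N - 1 + \<mu>) * r powr - N = r powr (\<mu> - 1)" by (simp flip: powr_add)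
    finally have 1: "\<bar>Y' r * r powr - N\<bar> \<le> C * r powr (\<mu> - 1)" .
    have "\<bar>(- N * r powr (- N - 1)) * Y r\<bar> \<le> (N * r powr (- N - 1)) * (C * r powr (N + \<mu>))"
      unfolding abs_mult using bY[OF r] N by (intro mult_mono) (auto simp: N_def)
    also have "\<dots> = N * C * (r powr (- N - 1) * r powr (N + \<mu>))" by simp
    also have "r powr (- N - 1) * r powr (N + \<mu>) = r powr (\<mu> - 1)" by (simp add: algebra_simps flip: powr_add)
    finally have "\<bar>(- N * r powr (- N - 1)) * Y r\<bar> \<le> N * C * r powr (\<mu> - 1)" .
    with 1 show ?thesis unfolding A'_def by (simp add: algebra_simps)
  qed
  define D where "D b x = (A' (norm x) * ((x \<bullet> b) / norm x) * (x \<bullet> b) + (b \<bullet> b) * A (norm x)) * \<phi> x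
      + (g x \<bullet> b) * (A (norm x) * (x \<bullet> b))" for b x
  have D: "integrable lborel (D b)" "integral\<^sup>L lborel (D b) = 0" if bB: "b \<in> Basis" for b
  proof -
    have b: "norm b = 1" using bB by simp
    define w where "w x = A (norm x) * (x \<bullet> b) * \<phi> x" for x
    define C' where "C' = (1 + N) * C * Mp + C * Mp + C * R * Mg"
    have a1: "continuous_on (- {0}) w"
      unfolding w_def by (intro continuous_intros radial_continuous[OF cA] continuous_on_subset[OF \<phi>]) auto
    have a2: "continuous_on (- {0}) (D b)"
      unfolding D_def
      by (intro continuous_intros radial_continuous[OF cA] radial_continuous[OF cA']
          continuous_on_subset[OF \<phi>] continuous_on_subset[OF g]) auto
    have a3: "((\<lambda>t. w (x + t *\<^sub>R b)) has_real_derivative D b x) (at 0)" if "x \<noteq> 0" for x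
    proof -
      have "((\<lambda>t. (x + t *\<^sub>R b) \<bullet> b) has_real_derivative b \<bullet> b) (at 0)"
        unfolding inner_add_left inner_scaleR_left by (auto intro!: derivative_eq_intros)
      from DERIV_mult[OF DERIV_mult[OF radial_derivative[OF A that] this] der[of x b]]
      show ?thesis unfolding w_def D_def by simp
    qed
    have a4: "w x = 0 \<and> D b x = 0" if "R < norm x" for x
      using supp[OF that] by (simp add: w_def D_def)
    have up: "r powr (1 + \<mu>) = r * r powr \<mu>" if "0 < r" for r :: real
      using that by (simp add: powr_add)
    have a5: "\<bar>w x\<bar> \<le> C' * norm x powr (1 + \<mu>)" if x: "x \<noteq> 0" "norm x \<le> R" for x
    proof -
      have "\<bar>w x\<bar> \<le> (C * norm x powr \<mu>) * norm x * Mp"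
        unfolding w_def abs_mult using x bA[of "norm x"] Mp(2)[of x] inner_unit_le[OF b, of x] C
        by (intro mult_mono) auto
      also have "\<dots> = C * Mp * norm x powr (1 + \<mu>)" using x up[of "norm x"] by simp
      also have "\<dots> \<le> C' * norm x powr (1 + \<mu>)"
        using C R Mg(1) Mp(1) N by (intro mult_right_mono) (auto simp: C'_def)
      finally show ?thesis .
    qed
    have a6: "\<bar>D b x\<bar> \<le> C' * norm x powr \<mu>" if x: "x \<noteq> 0" "norm x \<le> R" for x
    proof -
      have xb: "\<bar>x \<bullet> b\<bar> \<le> norm x" by (rule inner_unit_le[OF b])
      have "\<bar>A' (norm x) * ((x \<bullet> b) / norm x) * (x \<bullet> b) * \<phi> x\<bar> \<le> ((1 + N) * C * norm x powr (\<mu> - 1)) * 1 * norm x * Mp"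
        unfolding abs_mult using x bA'[of "norm x"] Mp(2)[of x] xb C N
        by (intro mult_mono) (auto simp: abs_divide divide_le_eq)
      also have "\<dots> = (1 + N) * C * Mp * (norm x powr (\<mu> - 1) * norm x)" by simp
      also have "norm x powr (\<mu> - 1) * norm x = norm x powr \<mu>" using x by (simp add: powr_diff)
      finally have 1: "\<bar>A' (norm x) * ((x \<bullet> b) / norm x) * (x \<bullet> b) * \<phi> x\<bar> \<le> (1 + N) * C * Mp * norm x powr \<mu>" .
      have "\<bar>(b \<bullet> b) * A (norm x) * \<phi> x\<bar> \<le> 1 * (C * norm x powr \<mu>) * Mp"
        unfolding abs_mult using x bA[of "norm x"] Mp(2)[of x] b C bB
        by (intro mult_mono) (auto simp: inner_Basis)
      then have 2: "\<bar>(b \<bullet> b) * A (norm x) * \<phi> x\<bar> \<le> C * Mp * norm x powr \<mu>" by (simp add: mult_ac)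
      have "\<bar>(g x \<bullet> b) * (A (norm x) * (x \<bullet> b))\<bar> \<le> Mg * ((C * norm x powr \<mu>) * R)"
        unfolding abs_mult using x bA[of "norm x"] Mg xb inner_unit_le[OF b, of "g x"] C
        by (intro mult_mono order_trans[OF inner_unit_le[OF b]]) auto
      then have 3: "\<bar>(g x \<bullet> b) * (A (norm x) * (x \<bullet> b))\<bar> \<le> C * R * Mg * norm x powr \<mu>" by (simp add: mult_ac)
      have "D b x = A' (norm x) * ((x \<bullet> b) / norm x) * (x \<bullet> b) * \<phi> x + (b \<bullet> b) * A (norm x) * \<phi> x
          + (g x \<bullet> b) * (A (norm x) * (x \<bullet> b))"
        by (simp add: D_def distrib_right)
      then have "\<bar>D b x\<bar> \<le> (1 + N) * C * Mp * norm x powr \<mu> + C * Mp * norm x powr \<mu> + C * R * Mg * norm x powr \<mu>"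
        using 1 2 3 by linarith
      then show ?thesis by (simp add: C'_def distrib_right)
    qed
    show "integrable lborel (D b)" "integral\<^sup>L lborel (D b) = 0"
      by (rule integral_directional_derivative_punctured[OF b a1 a2 a3 a4 R \<mu> a5 a6]; assumption)+
  qed
  \<comment> \<open>In the sum \<open>b \<bullet> b\<close> adds up to \<open>N\<close>, which
    cancels the contribution from the derivative of \<open>r powr - N\<close>.\<close>
  have "Y (norm x) * norm x powr - N * (x \<bullet> g x) + Y' (norm x) * norm x powr (1 - N) * \<phi> x = (\<Sum>b\<in>Basis. D b x)"
    if "x \<noteq> 0" for x
  proof -
    have s1: "(\<Sum>b\<in>Basis. (x \<bullet> b) * (x \<bullet> b)) = norm x * norm x"
      by (simp add: euclidean_inner[of x x, symmetric] power2_norm_eq_inner[symmetric] power2_eq_square)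
    have s2: "(\<Sum>b\<in>Basis. (g x \<bullet> b) * (x \<bullet> b)) = x \<bullet> g x"
      by (simp only: euclidean_inner[of "g x" x, symmetric] inner_commute[of "g x" x])
    have s3: "(\<Sum>b\<in>(Basis :: 'a set). b \<bullet> b) = N" by (simp add: N_def inner_Basis)
    have "(\<Sum>b\<in>Basis. D b x) = (\<Sum>b\<in>Basis. (A' (norm x) / norm x * \<phi> x) * ((x \<bullet> b) * (x \<bullet> b)) +
        (A (norm x) * \<phi> x) * (b \<bullet> b) + A (norm x) * ((g x \<bullet> b) * (x \<bullet> b)))"
      by (intro sum.cong refl) (simp add: D_def algebra_simps)
    also have "\<dots> = (A' (norm x) / norm x * \<phi> x) * (norm x * norm x) + (A (norm x) * \<phi> x) * N + A (norm x) * (x \<bullet> g x)"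
      by (simp only: sum.distrib sum_distrib_left[symmetric] s1 s2 s3)
    also have "\<dots> = (A' (norm x) * norm x + N * A (norm x)) * \<phi> x + A (norm x) * (x \<bullet> g x)"
      using that by (simp add: algebra_simps)
    also have "A' (norm x) * norm x + N * A (norm x) = Y' (norm x) * norm x powr (1 - N)"
    proof -
      have "norm x powr (- N - 1) * norm x = norm x powr - N" "norm x powr - N * norm x = norm x powr (1 - N)"
        using that by (simp_all add: powr_diff powr_minus divide_inverse)
      moreover have "A' (norm x) * norm x + N * A (norm x) = Y' (norm x) * (norm x powr - N * norm x)
          - N * Y (norm x) * (norm x powr (- N - 1) * norm x) + N * Y (norm x) * norm x powr - N"
        by (simp add: A'_def A_def algebra_simps)
      ultimately show ?thesis by simp
    qed
    finally show ?thesis by (simp add: A_def)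
  qed
  then have "AE x in lborel. Y (norm x) * norm x powr - N * (x \<bullet> g x) + Y' (norm x) * norm x powr (1 - N) * \<phi> x
      = (\<Sum>b\<in>Basis. D b x)"
    using AE_lborel_singleton[of "0::'a"] by (auto elim: eventually_mono)
  moreover have "integral\<^sup>L lborel (\<lambda>x. \<Sum>b\<in>Basis. D b x) = 0" using D by simp
  ultimately show ?thesis
  proof -
    assume AE: "AE x in lborel. Y (norm x) * norm x powr - N * (x \<bullet> g x) + Y' (norm x) * norm x powr (1 - N) * \<phi> x
      = (\<Sum>b\<in>Basis. D b x)" and z: "integral\<^sup>L lborel (\<lambda>x. \<Sum>b\<in>Basis. D b x) = 0"
    have m0: "(\<lambda>x::'a. f (norm x)) \<in> borel_measurable lborel" if "continuous_on {0<..} f" for f :: "real \<Rightarrow> real"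
    proof -
      have "(\<lambda>r. if r \<in> {0<..} then f r else f 0) \<in> borel_measurable borel"
        by (intro borel_measurable_continuous_on_if that continuous_on_const) auto
      then have "(\<lambda>x::'a. (\<lambda>r. if r \<in> {0<..} then f r else f 0) (norm x)) \<in> borel_measurable lborel"
        by (rule measurable_compose[of norm lborel borel, rotated]) simp
      moreover have "(\<lambda>x::'a. (\<lambda>r. if r \<in> {0<..} then f r else f 0) (norm x)) = (\<lambda>x. f (norm x))"
        by (auto simp: fun_eq_iff)
      ultimately show ?thesis by (simp only:)
    qed
    have [measurable]: "(\<lambda>x. Y (norm (x::'a))) \<in> borel_measurable lborel" "(\<lambda>x. Y' (norm (x::'a))) \<in> borel_measurable lborel"
      using m0[OF cY] m0[OF Y'] .
    have [measurable]: "\<phi> \<in> borel_measurable lborel" "g \<in> borel_measurable lborel"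
      using \<phi> g by (auto intro: borel_measurable_continuous_onI)
    have "(\<integral>x. Y (norm x) * norm x powr - N * (x \<bullet> g x) + Y' (norm x) * norm x powr (1 - N) * \<phi> x \<partial>lborel) =
        (\<integral>x. (\<Sum>b\<in>Basis. D b x) \<partial>lborel)"
      by (rule integral_cong_AE) (use AE D in \<open>auto intro!: borel_measurable_sum\<close>)
    with z show ?thesis unfolding N_def by simp
  qed
qed

end

section \<open>The weak formulation\<close>

lemma integrable_product:
  fixes a :: "'a::euclidean_space \<Rightarrow> real" and b :: "'b::euclidean_space \<Rightarrow> real"
  assumes "integrable lborel a" "integrable lborel b"
  shows "integrable lborel (\<lambda>(x, y). a x * b y)"
proof -
  have [measurable]: "a \<in> borel_measurable lborel" "b \<in> borel_measurable lborel"
    using assms by (auto intro: borel_measurable_integrable)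
  have "integrable (lborel \<Otimes>\<^sub>M lborel) (\<lambda>z. a (fst z) * b (snd z))"
  proof (rule lborel_pair.Fubini_integrable)
    show "(\<lambda>z. a (fst z) * b (snd z)) \<in> borel_measurable (lborel \<Otimes>\<^sub>M lborel)" by measurable
    have "integrable lborel (\<lambda>x. \<bar>a x\<bar> * (\<integral>y. \<bar>b y\<bar> \<partial>lborel))"
      using assms by (intro integrable_mult_left integrable_abs) auto
    then show "integrable lborel (\<lambda>x. \<integral>y. norm (a (fst (x, y)) * b (snd (x, y))) \<partial>lborel)"
      using assms by (simp add: abs_mult)
    show "AE x in lborel. integrable lborel (\<lambda>y. a (fst (x, y)) * b (snd (x, y)))"
      using assms by simp
  qed
  then show ?thesis by (simp add: lborel_prod split_beta')
qed

lemma integrable_weighted: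
  fixes w :: "'a::euclidean_space \<times> real \<Rightarrow> 'b::{banach, second_countable_topology}"
  assumes w: "w \<in> borel_measurable borel" and s: "- real DIM('a) < s" and R: "0 < R"
    and bnd: "\<And>x t. norm x \<le> R \<Longrightarrow> t \<in> {t0..t1} \<Longrightarrow> norm (w (x, t)) \<le> C * norm x powr s"
    and zero: "\<And>x t. \<not> (norm x \<le> R \<and> t \<in> {t0..t1}) \<Longrightarrow> w (x, t) = 0"
  shows "integrable lborel w"
proof (rule Bochner_Integration.integrable_bound)
  have "integrable lborel (\<lambda>x::'a. C * (indicator (cball 0 R) x *\<^sub>R norm x powr s))"
    using set_integrable_norm_powr[OF s R] unfolding set_integrable_def by (rule integrable_mult_right)
  moreover have "integrable lborel (indicator {t0..t1} :: real \<Rightarrow> real)"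
    using emeasure_bounded_finite[OF bounded_closed_interval, of t0 t1]
    by (intro integrable_real_indicator) auto
  ultimately show "integrable lborel (\<lambda>(x::'a, t). (C * (indicator (cball 0 R) x *\<^sub>R norm x powr s)) * indicator {t0..t1} t)"
    by (rule integrable_product)
  show "w \<in> borel_measurable lborel" using w by simp
  show "AE z in lborel. norm (w z) \<le> norm ((\<lambda>(x::'a, t). (C * (indicator (cball 0 R) x *\<^sub>R norm x powr s)) * indicator {t0..t1} t) z)"
  proof (intro AE_I2)
    fix z :: "'a \<times> real"
    obtain x t where z: "z = (x, t)" by (cases z)
    show "norm (w z) \<le> norm ((\<lambda>(x::'a, t). (C * (indicator (cball 0 R) x *\<^sub>R norm x powr s)) * indicator {t0..t1} t) z)"
    proof (cases "norm x \<le> R \<and> t \<in> {t0..t1}")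
      case True
      then have "norm (w z) \<le> \<bar>C * norm x powr s\<bar>" using bnd[of x t] z by (auto intro: order_trans)
      then show ?thesis using True z by simp
    qed (use zero z in simp)
  qed
qed

lemma compact_in_space_time:
  fixes K :: "('a::euclidean_space \<times> real) set"
  assumes "compact K" "K \<subseteq> space_time T" "0 < T"
  obtains R t0 t1 where "0 < R" "0 < t0" "t0 \<le> t1" "t1 < T" "K \<subseteq> cball 0 R \<times> {t0..t1}"
proof (cases "K = {}")
  case True
  then show ?thesis using assms by (intro that[of 1 "T/2" "T/2"]) auto
next
  case False
  have c: "compact (snd ` K)" "compact (fst ` K)"
    using assms by (auto intro!: compact_continuous_image continuous_intros)
  obtain t0 where t0: "t0 \<in> snd ` K" "\<forall>t\<in>snd ` K. t0 \<le> t"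
    using compact_attains_inf[OF c(1)] False by auto
  obtain t1 where t1: "t1 \<in> snd ` K" "\<forall>t\<in>snd ` K. t \<le> t1"
    using compact_attains_sup[OF c(1)] False by auto
  obtain R where R: "\<forall>x\<in>fst ` K. norm x \<le> R"
    using compact_imp_bounded[OF c(2)] unfolding bounded_iff by auto
  have "K \<subseteq> cball 0 (max 1 R) \<times> {t0..t1}"
  proof
    fix z assume z: "z \<in> K"
    then have "fst z \<in> fst ` K" "snd z \<in> snd ` K" by auto
    then show "z \<in> cball 0 (max 1 R) \<times> {t0..t1}" using R t0 t1 by (cases z) (auto simp: le_max_iff_disj)
  qed
  moreover have "0 < t0" "t1 < T" "t0 \<le> t1"
    using assms t0 t1 by (auto simp: space_time_def)
  ultimately show ?thesis by (intro that[of "max 1 R" t0 t1]) auto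
qed

lemma locally_integrable_weighted:
  fixes w :: "'a::euclidean_space \<times> real \<Rightarrow> 'b::{banach, second_countable_topology}"
  assumes w: "w \<in> borel_measurable borel" and s: "- real DIM('a) < s" and T: "0 < T"
    and bnd: "\<And>R t0 t1. 0 < R \<Longrightarrow> 0 < t0 \<Longrightarrow> t0 \<le> t1 \<Longrightarrow> t1 < T \<Longrightarrow>
      \<exists>C. \<forall>x t. norm x \<le> R \<longrightarrow> t \<in> {t0..t1} \<longrightarrow> norm (w (x, t)) \<le> C * norm x powr s"
  shows "locally_integrable_on w (space_time T)"
  unfolding locally_integrable_on_def
proof (intro allI impI, elim conjE)
  fix K :: "('a \<times> real) set" assume K: "compact K" "K \<subseteq> space_time T"
  obtain R t0 t1 where R: "0 < R" "0 < t0" "t0 \<le> t1" "t1 < T" "K \<subseteq> cball 0 R \<times> {t0..t1}"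
    using compact_in_space_time[OF K T] .
  obtain C where C: "\<And>x t. norm x \<le> R \<Longrightarrow> t \<in> {t0..t1} \<Longrightarrow> norm (w (x, t)) \<le> C * norm x powr s"
    using bnd[OF R(1-4)] by blast
  have Kb: "K \<in> sets borel" using K(1) by (simp add: compact_imp_closed)
  show "set_integrable lborel K w"
    unfolding set_integrable_def
  proof (rule integrable_weighted[OF _ s R(1), of _ t0 t1 C])
    show "(\<lambda>z. indicator K z *\<^sub>R w z) \<in> borel_measurable borel"
      using w Kb by (intro borel_measurable_scaleR borel_measurable_indicator) auto
    show "norm (indicator K (x, t) *\<^sub>R w (x, t)) \<le> C * norm x powr s" if "norm x \<le> R" "t \<in> {t0..t1}" for x t
      using C[OF that] order_trans[OF norm_ge_zero C[OF that]] by (auto simp: indicator_def)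
    show "indicator K (x, t) *\<^sub>R w (x, t) = 0" if "\<not> (norm x \<le> R \<and> t \<in> {t0..t1})" for x t
      using that R(5) by (auto simp: indicator_def)
  qed
qed

lemma locally_integrable_continuous:
  fixes w :: "'a::euclidean_space \<Rightarrow> real"
  assumes "continuous_on Q w"
  shows "locally_integrable_on w Q"
  unfolding locally_integrable_on_def set_integrable_def
  using borel_integrable_compact continuous_on_subset[OF assms] by blast

text \<open>Since \<open>\<phi>\<close> vanishes on the open complement of its support, so does its
  derivative and hence \<open>g\<close>; the support fits into the product of a ball and a time
  interval that stays away from \<open>0\<close> and \<open>T\<close>.\<close>

lemma test_functionD:
  fixes \<phi> :: "'a::euclidean_space \<times> real \<Rightarrow> real"
  assumes tf: "test_function (space_time T) \<phi> g" and T: "0 < T"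
  obtains R t0 t1 where "0 < R" "0 < t0" "t0 \<le> t1" "t1 < T"
    "\<And>x t. \<not> (norm x \<le> R \<and> t \<in> {t0..t1}) \<Longrightarrow> \<phi> (x, t) = 0 \<and> g (x, t) = 0"
    "continuous_on UNIV \<phi>" "continuous_on UNIV g"
    "\<And>z. (\<phi> has_derivative (\<lambda>h. h \<bullet> g z)) (at z)"
proof -
  define K where "K = closure {z. \<phi> z \<noteq> 0}"
  have K: "compact K" "K \<subseteq> space_time T" using tf by (auto simp: test_function_def K_def)
  obtain R t0 t1 where R: "0 < R" "0 < t0" "t0 \<le> t1" "t1 < T" "K \<subseteq> cball 0 R \<times> {t0..t1}"
    using compact_in_space_time[OF K T] .
  have der: "(\<phi> has_derivative (\<lambda>h. h \<bullet> g z)) (at z)" for z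
    using tf unfolding test_function_def gderiv_def by blast
  have zero: "\<phi> z = 0 \<and> g z = 0" if "z \<notin> K" for z
  proof -
    have \<phi>0: "\<phi> y = 0" if "y \<in> - K" for y using that closure_subset[of "{z. \<phi> z \<noteq> 0}"] by (auto simp: K_def)
    have "open (- K)" using K(1) by (simp add: compact_imp_closed open_Compl)
    moreover have "((\<lambda>_. 0) has_derivative (\<lambda>h. 0)) (at z)" by simp
    ultimately have "(\<phi> has_derivative (\<lambda>h. 0)) (at z)"
      using that \<phi>0 by (intro has_derivative_transform_within_open[of "\<lambda>_. 0" _ z UNIV "- K" \<phi>]) auto
    then have "(\<lambda>h. h \<bullet> g z) = (\<lambda>h. 0)" by (rule has_derivative_unique[OF der])
    then have "g z \<bullet> g z = 0" by metis
    then show ?thesis using \<phi>0 that by simp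
  qed
  show ?thesis
  proof (rule that[OF R(1-4)])
    show "\<phi> (x, t) = 0 \<and> g (x, t) = 0" if "\<not> (norm x \<le> R \<and> t \<in> {t0..t1})" for x t
      using that R(5) by (intro zero) auto
    show "continuous_on UNIV \<phi>"
      using der by (intro has_derivative_continuous_on[of _ _ "\<lambda>z h. h \<bullet> g z"]) auto
    show "continuous_on UNIV g" using tf by (simp add: test_function_def)
  qed (rule der)
qed

lemma path_derivative:
  fixes \<phi> :: "'a::euclidean_space \<times> real \<Rightarrow> real" and x :: "real \<Rightarrow> 'a" and t :: "real \<Rightarrow> real"
  assumes "(\<phi> has_derivative (\<lambda>h. h \<bullet> g (x s, t s))) (at (x s, t s))"
    and "(x has_vector_derivative x') (at s)" "(t has_real_derivative t') (at s)"
  shows "((\<lambda>s. \<phi> (x s, t s)) has_real_derivative x' \<bullet> fst (g (x s, t s)) + t' * snd (g (x s, t s))) (at s)"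
proof -
  have pair: "((\<lambda>s. (x s, t s)) has_derivative (\<lambda>h. (h *\<^sub>R x', t' * h))) (at s)"
    using assms(2,3) unfolding has_vector_derivative_def has_field_derivative_def
    by (auto intro!: has_derivative_Pair)
  have "((\<lambda>s. \<phi> (x s, t s)) has_derivative (\<lambda>h. (h *\<^sub>R x', t' * h) \<bullet> g (x s, t s))) (at s)"
    by (rule has_derivative_compose[OF pair assms(1)])
  moreover have "(\<lambda>h. (h *\<^sub>R x', t' * h) \<bullet> g (x s, t s)) =
      (*) (x' \<bullet> fst (g (x s, t s)) + t' * snd (g (x s, t s)))"
    by (auto simp: fun_eq_iff inner_prod_def algebra_simps)
  ultimately show ?thesis by (simp add: has_field_derivative_def)
qed

lemma set_lebesgue_integral_supported:
  fixes w :: "'a::euclidean_space \<Rightarrow> 'b::{banach, second_countable_topology}"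
  assumes "\<And>z. z \<notin> Q \<Longrightarrow> w z = 0"
  shows "(LINT z:Q|lborel. w z) = integral\<^sup>L lborel w"
proof -
  have "indicator Q z *\<^sub>R w z = w z" for z using assms[of z] by (auto simp: indicator_def)
  then show ?thesis by (simp add: set_lebesgue_integral_def)
qed

lemma lborel_scale:
  fixes F :: "'a::euclidean_space \<Rightarrow> real"
  assumes "0 < r" and F: "F \<in> borel_measurable borel"
  shows "integral\<^sup>L lborel F = r ^ DIM('a) * (\<integral>z. F (r *\<^sub>R z) \<partial>lborel)"
proof -
  have "integral\<^sup>L lborel F = integral\<^sup>L (density (distr lborel borel (\<lambda>x. 0 + r *\<^sub>R x)) (\<lambda>_. ennreal (\<bar>r\<bar> ^ DIM('a)))) F"
    using lborel_affine[of r "0::'a"] assms by simp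
  also have "\<dots> = (\<integral>z. r ^ DIM('a) *\<^sub>R F z \<partial>distr lborel borel (\<lambda>x. 0 + r *\<^sub>R x))"
    using F assms by (subst integral_density) auto
  also have "\<dots> = (\<integral>z. r ^ DIM('a) *\<^sub>R F (0 + r *\<^sub>R z) \<partial>lborel)"
    using F by (subst integral_distr) auto
  finally show ?thesis by simp
qed

text \<open>The two relations in \<open>exps\<close> say that the powers of \<open>T - t\<close> in
  the time derivative, the diffusion and the reaction agree after substitution of the self-similar
  form. \<open>E\<close> only carries the space dimension. \<open>f\<close> is continuous on the
  whole line and \<open>Y\<close> is set to zero on nonpositive arguments, which makes both Borel
  functions.\<close>

locale self_similar_profile =
  fixes E :: "'a::euclidean_space itself" and N m p \<sigma>1 \<sigma>2 \<alpha> \<beta> c R C :: real and f Y :: "real \<Rightarrow> real"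
  assumes N_def: "N = real DIM('a)"
    and m: "1 < m" and p: "1 \<le> p"
    and \<sigma>: "-2 < \<sigma>1" "-2 < \<sigma>2" "0 < N + \<sigma>1" "0 < N + \<sigma>2"
    and \<beta>: "0 < \<beta>" and c: "0 < c" "c = \<alpha> + \<beta> * (N + \<sigma>1)"
    and exps: "\<alpha> * m = \<alpha> + 1 + \<beta> * (2 + \<sigma>1)" "\<alpha> * m = \<alpha> * p + \<beta> * (2 + \<sigma>2)"
    and f_cont: "continuous_on UNIV f" and f_nonneg: "\<And>r. 0 \<le> f r" and R: "0 < R"
    and f_supp: "\<And>r. R \<le> r \<Longrightarrow> f r = 0" and f_nontriv: "\<exists>r>0. 0 < f r"
    and V_der: "\<And>r. 0 < r \<Longrightarrow> ((\<lambda>r. f r powr m) has_real_derivative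
      r powr (1 - N) * Y r - \<beta> * r powr (1 + \<sigma>1) * f r) (at r)"
    and Y_der: "\<And>r. 0 < r \<Longrightarrow> (Y has_real_derivative
      r powr (N - 1) * (c * r powr \<sigma>1 * f r - r powr \<sigma>2 * f r powr p)) (at r)"
    and Y_bound: "\<And>r. 0 < r \<Longrightarrow> \<bar>Y r\<bar> \<le> C * r powr (N + min \<sigma>1 \<sigma>2)"
    and Y_supp: "\<And>r. R \<le> r \<Longrightarrow> Y r = 0" and Y_neg: "\<And>r. r \<le> 0 \<Longrightarrow> Y r = 0"
begin

definition "\<mu> = min \<sigma>1 \<sigma>2"
definition "h r = c * r powr \<sigma>1 * f r - r powr \<sigma>2 * f r powr p"
definition "V' r = r powr (1 - N) * Y r - \<beta> * r powr (1 + \<sigma>1) * f r"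

lemma \<mu>: "-2 < \<mu>" "- N < \<mu>" "\<mu> \<le> \<sigma>1" "\<mu> \<le> \<sigma>2"
  using \<sigma> by (auto simp: \<mu>_def)

lemma Y_cont: "continuous_on {0<..} Y"
  by (rule DERIV_continuous_on[OF has_field_derivative_at_within[OF Y_der]]) auto

lemma f_cont_on: "continuous_on S f" by (rule continuous_on_subset[OF f_cont]) auto

lemma fq_cont: "0 < q \<Longrightarrow> continuous_on S (\<lambda>r. f r powr q)"
  using f_nonneg by (intro continuous_on_powr' f_cont_on continuous_on_const) auto

lemma V'_cont: "continuous_on {0<..} V'"
  unfolding V'_def by (intro continuous_intros Y_cont f_cont_on) auto

lemma h_cont: "continuous_on {0<..} (\<lambda>r. r powr (N - 1) * h r)"
  unfolding h_def using p by (intro continuous_intros f_cont_on fq_cont) auto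

lemma V'_measurable [measurable]: "V' \<in> borel_measurable borel"
proof -
  have "(\<lambda>r. if r \<in> {0<..} then V' r else - \<beta> * (r powr (1 + \<sigma>1) * f r)) \<in> borel_measurable borel"
  proof (rule measurable_If_set)
    show "V' \<in> borel_measurable borel"
    proof -
      have "(\<lambda>r. if r \<in> {0<..} then Y r else 0) \<in> borel_measurable borel"
        by (intro borel_measurable_continuous_on_if Y_cont continuous_on_const) auto
      moreover have "(\<lambda>r. if r \<in> {0<..} then Y r else 0) = Y" using Y_neg by (auto simp: fun_eq_iff)
      ultimately have [measurable]: "Y \<in> borel_measurable borel" by simp
      have [measurable]: "f \<in> borel_measurable borel" by (rule borel_measurable_continuous_onI[OF f_cont])
      show ?thesis unfolding V'_def by measurable
    qed
    have [measurable]: "f \<in> borel_measurable borel" by (rule borel_measurable_continuous_onI[OF f_cont])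
    show "(\<lambda>r. - \<beta> * (r powr (1 + \<sigma>1) * f r)) \<in> borel_measurable borel" by measurable
  qed auto
  then show ?thesis
    by (rule measurable_cong[THEN iffD1, rotated]) (auto simp: V'_def Y_neg)
qed

text \<open>The bounds hold for every \<open>r > 0\<close>, also beyond the support, because at time
  \<open>t\<close> they are applied at \<open>r * (T - t) powr \<beta>\<close>.\<close>

lemma profile_bounds:
  obtains C1 where "0 \<le> C1" "\<And>r. 0 < r \<Longrightarrow> \<bar>V' r\<bar> \<le> C1 * r powr (1 + \<mu>)"
    "\<And>r. 0 < r \<Longrightarrow> \<bar>r powr (N - 1) * h r\<bar> \<le> C1 * r powr (N - 1 + \<mu>)"
    "\<And>r. 0 < r \<Longrightarrow> \<bar>Y r\<bar> \<le> C1 * r powr (N + \<mu>)"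
    "\<And>r. 0 < r \<Longrightarrow> \<bar>f r powr m - f 0 powr m\<bar> \<le> C1 * r powr (2 + \<mu>)"
proof -
  have "bounded (f ` {0..R})"
    by (intro compact_imp_bounded compact_continuous_image f_cont_on) auto
  then obtain Mf where MfB: "\<forall>r\<in>{0..R}. \<bar>f r\<bar> \<le> Mf" unfolding bounded_iff by auto
  have Mf: "f r \<le> Mf" if "0 \<le> r" "r \<le> R" for r
    using MfB[rule_format, of r] that by auto
  have Mf0: "0 \<le> Mf" using Mf[of R] R f_nonneg[of R] by simp
  \<comment> \<open>Up to \<open>R\<close>, \<open>K\<close> converts both weights to the common
    exponent \<open>\<mu>\<close>; beyond \<open>R\<close> the profile and the flux vanish.\<close>
  define K where "K = R powr (\<sigma>1 - \<mu>) + R powr (\<sigma>2 - \<mu>)"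
  have K: "0 \<le> K" by (simp add: K_def)
  have pw: "r powr \<sigma>1 \<le> K * r powr \<mu>" "r powr \<sigma>2 \<le> K * r powr \<mu>" if r: "0 < r" "r \<le> R" for r
  proof -
    have "r powr s \<le> K * r powr \<mu>" if s: "\<mu> \<le> s" "R powr (s - \<mu>) \<le> K" for s
    proof -
      have "r powr s = r powr (s - \<mu>) * r powr \<mu>" by (simp flip: powr_add)
      also have "\<dots> \<le> R powr (s - \<mu>) * r powr \<mu>" using r s by (intro mult_right_mono powr_mono2) auto
      also have "\<dots> \<le> K * r powr \<mu>" using s by (intro mult_right_mono) auto
      finally show ?thesis .
    qed
    then show "r powr \<sigma>1 \<le> K * r powr \<mu>" "r powr \<sigma>2 \<le> K * r powr \<mu>" using \<mu> by (auto simp: K_def)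
  qed
  have C: "0 \<le> C"
  proof -
    have "0 \<le> C * R powr (N + min \<sigma>1 \<sigma>2)" using Y_bound[OF R] by linarith
    then show ?thesis using R by (simp add: zero_le_mult_iff)
  qed
  define Ca where "Ca = C + \<beta> * K * Mf"
  define Cb where "Cb = c * K * Mf + K * Mf powr p"
  have Ca: "0 \<le> Ca" using C \<beta> K Mf0 by (simp add: Ca_def)
  have Cb: "0 \<le> Cb" using c K Mf0 by (simp add: Cb_def)
  have bV: "\<bar>V' r\<bar> \<le> Ca * r powr (1 + \<mu>)" if r: "0 < r" for r
  proof (cases "r \<le> R")
    case True
    have "\<bar>r powr (1 - N) * Y r\<bar> \<le> r powr (1 - N) * (C * r powr (N + \<mu>))"
      unfolding abs_mult using Y_bound[OF r] by (intro mult_mono) (auto simp: \<mu>_def)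
    also have "\<dots> = C * (r powr (1 - N) * r powr (N + \<mu>))" by simp
    also have "r powr (1 - N) * r powr (N + \<mu>) = r powr (1 + \<mu>)" by (simp flip: powr_add)
    finally have 1: "\<bar>r powr (1 - N) * Y r\<bar> \<le> C * r powr (1 + \<mu>)" .
    have "\<beta> * r powr (1 + \<sigma>1) * f r = \<beta> * r * r powr \<sigma>1 * f r" using r by (simp add: powr_add)
    also have "\<dots> \<le> \<beta> * r * (K * r powr \<mu>) * Mf"
      using \<beta> r pw(1)[OF r True] Mf[of r] True f_nonneg K by (intro mult_mono) auto
    also have "\<dots> = \<beta> * K * Mf * r powr (1 + \<mu>)" using r by (simp add: powr_add)
    finally have 2: "\<beta> * r powr (1 + \<sigma>1) * f r \<le> \<beta> * K * Mf * r powr (1 + \<mu>)" .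
    have "0 \<le> \<beta> * r powr (1 + \<sigma>1) * f r" using \<beta> f_nonneg[of r] by simp
    with 1 2 have "\<bar>V' r\<bar> \<le> C * r powr (1 + \<mu>) + \<beta> * K * Mf * r powr (1 + \<mu>)" unfolding V'_def by linarith
    then show ?thesis by (simp add: Ca_def distrib_right)
  qed (use f_supp Y_supp Ca in \<open>simp add: V'_def\<close>)
  have bh: "\<bar>r powr (N - 1) * h r\<bar> \<le> Cb * r powr (N - 1 + \<mu>)" if r: "0 < r" for r
  proof (cases "r \<le> R")
    case True
    have "c * r powr \<sigma>1 * f r \<le> c * (K * r powr \<mu>) * Mf"
      using c pw(1)[OF r True] Mf[of r] True f_nonneg K r by (intro mult_mono) auto
    moreover have "r powr \<sigma>2 * f r powr p \<le> (K * r powr \<mu>) * Mf powr p"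
      using p pw(2)[OF r True] Mf[of r] True f_nonneg K r by (intro mult_mono powr_mono2) auto
    moreover have "0 \<le> c * r powr \<sigma>1 * f r" "0 \<le> r powr \<sigma>2 * f r powr p" using c f_nonneg by auto
    moreover have "c * (K * r powr \<mu>) * Mf + (K * r powr \<mu>) * Mf powr p = Cb * r powr \<mu>"
      by (simp add: Cb_def algebra_simps)
    ultimately have "\<bar>h r\<bar> \<le> Cb * r powr \<mu>" unfolding h_def by linarith
    then have "\<bar>r powr (N - 1) * h r\<bar> \<le> r powr (N - 1) * (Cb * r powr \<mu>)"
      unfolding abs_mult by (intro mult_mono) auto
    then show ?thesis by (simp add: powr_add mult_ac)
  qed (use f_supp Cb p in \<open>simp add: h_def\<close>)
  have bV0: "\<bar>f r powr m - f 0 powr m\<bar> \<le> Ca / (2 + \<mu>) * r powr (2 + \<mu>)" if r: "0 < r" for r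
  proof -
    \<comment> \<open>The derivative bound holds only away from \<open>0\<close>, so the value at
      the origin is reached as a limit from the right.\<close>
    have "((\<lambda>s. f s powr m) \<longlongrightarrow> f 0 powr m) (at_right 0)"
      using fq_cont[of m UNIV] m by (auto simp: continuous_on_def intro: tendsto_within_subset)
    note lim = tendsto_rabs[OF tendsto_diff[OF tendsto_const[of "f r powr m"] this]]
    have ev: "\<forall>\<^sub>F s in at_right 0. \<bar>f r powr m - f s powr m\<bar> \<le> Ca / (2 + \<mu>) * r powr (2 + \<mu>)"
      unfolding eventually_at_right_field
    proof (intro exI[of _ r] conjI r allI impI)
      fix s assume s: "0 < s" "s < r"
      have "\<bar>f r powr m - f s powr m\<bar> \<le> Ca / (2 + \<mu>) * r powr (2 + \<mu>) - Ca / (2 + \<mu>) * s powr (2 + \<mu>)"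
      proof (rule increment_abs_le[where I = "{s..r}"])
        fix x assume x: "x \<in> {s..r}"
        then have x0: "0 < x" using s by auto
        show "((\<lambda>r. f r powr m) has_real_derivative V' x) (at x within {s..r})"
          using V_der[OF x0] unfolding V'_def by (rule has_field_derivative_at_within)
        have "((\<lambda>r. Ca / (2 + \<mu>) * r powr (2 + \<mu>)) has_real_derivative
            Ca / (2 + \<mu>) * ((2 + \<mu>) * x powr (2 + \<mu> - 1))) (at x within {s..r})"
          by (intro DERIV_cmult has_field_derivative_at_within[OF has_real_derivative_powr] x0)
        moreover have "Ca / (2 + \<mu>) * ((2 + \<mu>) * x powr (2 + \<mu> - 1)) = Ca * x powr (1 + \<mu>)"
          using \<mu>(1) by simp
        ultimately show "((\<lambda>r. Ca / (2 + \<mu>) * r powr (2 + \<mu>)) has_real_derivative Ca * x powr (1 + \<mu>)) (at x within {s..r})"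
          by (simp only:)
      next
        fix x assume "s < x" "x < r"
        then show "\<bar>V' x\<bar> \<le> Ca * x powr (1 + \<mu>)" using s by (intro bV) auto
      qed (use s in auto)
      moreover have "0 \<le> Ca / (2 + \<mu>) * s powr (2 + \<mu>)" using Ca \<mu>(1) by simp
      ultimately show "\<bar>f r powr m - f s powr m\<bar> \<le> Ca / (2 + \<mu>) * r powr (2 + \<mu>)" by linarith
    qed
    show ?thesis by (rule tendsto_upperbound[OF lim ev]) simp
  qed
  define C1 where "C1 = Ca + Cb + C + Ca / (2 + \<mu>)"
  have C1: "Ca \<le> C1" "Cb \<le> C1" "C \<le> C1" "Ca / (2 + \<mu>) \<le> C1" "0 \<le> C1"
    using Ca Cb C \<mu>(1) by (auto simp: C1_def)
  have up: "x \<le> C1 * r powr s" if "x \<le> D * r powr s" "D \<le> C1" for x D r s :: real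
    using that mult_right_mono[of D C1 "r powr s"] by simp
  show ?thesis
  proof (rule that[OF C1(5)])
    fix r :: real assume r: "0 < r"
    show "\<bar>V' r\<bar> \<le> C1 * r powr (1 + \<mu>)" by (rule up[OF bV[OF r] C1(1)])
    show "\<bar>r powr (N - 1) * h r\<bar> \<le> C1 * r powr (N - 1 + \<mu>)" by (rule up[OF bh[OF r] C1(2)])
    show "\<bar>Y r\<bar> \<le> C1 * r powr (N + \<mu>)" using up[OF Y_bound[OF r] C1(3)] by (simp add: \<mu>_def)
    show "\<bar>f r powr m - f 0 powr m\<bar> \<le> C1 * r powr (2 + \<mu>)" by (rule up[OF bV0[OF r] C1(4)])
  qed
qed

section \<open>The self-similar function and its spatial gradient\<close>

definition u :: "real \<Rightarrow> 'a \<times> real \<Rightarrow> real" where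
  "u T z = (T - snd z) powr (- \<alpha>) * f (norm (fst z) * (T - snd z) powr \<beta>)"

text \<open>This is the spatial gradient of \<open>u T z powr m\<close> away from
  \<open>x = 0\<close>; the factor \<open>fst z\<close> makes it zero there.\<close>

definition G :: "real \<Rightarrow> 'a \<times> real \<Rightarrow> 'a" where
  "G T z = ((T - snd z) powr (\<beta> - \<alpha> * m) * V' (norm (fst z) * (T - snd z) powr \<beta>) / norm (fst z)) *\<^sub>R fst z"

lemma u_eq: "backward_self_similar T \<alpha> \<beta> f = u T"
  by (auto simp: fun_eq_iff backward_self_similar_def u_def)

lemma u_nonneg: "0 \<le> u T z" by (simp add: u_def f_nonneg)

lemma u_powr: "u T z powr q = (T - snd z) powr (- \<alpha> * q) * f (norm (fst z) * (T - snd z) powr \<beta>) powr q"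
  by (simp add: u_def powr_mult f_nonneg powr_powr)

lemma u_cont: "continuous_on (UNIV \<times> {..<T}) (u T)"
  unfolding u_def by (intro continuous_intros continuous_on_compose2[OF f_cont]) auto

lemma u_powr_cont: "0 < q \<Longrightarrow> continuous_on (UNIV \<times> {..<T}) (\<lambda>z. u T z powr q)"
  using u_nonneg by (intro continuous_on_powr' u_cont continuous_on_const) auto

lemma G_measurable: "G T \<in> borel_measurable borel"
proof -
  have [measurable]: "(fst :: 'a \<times> real \<Rightarrow> 'a) \<in> borel_measurable borel" "(snd :: 'a \<times> real \<Rightarrow> real) \<in> borel_measurable borel"
    by (auto intro!: borel_measurable_continuous_onI continuous_intros)
  show ?thesis unfolding G_def by measurable
qed

lemma radial_chain:
  assumes "\<And>r. 0 < r \<Longrightarrow> (W has_real_derivative W' r) (at r)" "0 < r" "0 < \<rho>"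
  shows "((\<lambda>r. k * W (r * \<rho>)) has_real_derivative k * (W' (r * \<rho>) * \<rho>)) (at r)"
proof -
  have "((\<lambda>r. r * \<rho>) has_real_derivative \<rho>) (at r)" by (auto intro!: derivative_eq_intros)
  from DERIV_cmult[OF DERIV_chain2[OF assms(1) this], of k] assms show ?thesis by simp
qed

lemma slice_gradient:
  assumes t: "t < T" and \<phi>: "continuous_on UNIV \<phi>" and g: "continuous_on UNIV g"
    and der: "\<And>x b. ((\<lambda>s. \<phi> (x + s *\<^sub>R b)) has_real_derivative g x \<bullet> b) (at 0)"
    and supp: "\<And>x. R' < norm x \<Longrightarrow> \<phi> x = 0 \<and> g x = 0" and R': "0 < R'" and b: "norm (b :: 'a) = 1"
  shows "(\<integral>x. u T (x, t) powr m * (g x \<bullet> b) + (G T (x, t) \<bullet> b) * \<phi> x \<partial>lborel) = 0"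
proof -
  define k where "k = (T - t) powr (- \<alpha> * m)"
  define \<rho> where "\<rho> = (T - t) powr \<beta>"
  have \<rho>: "0 < \<rho>" and k: "0 < k" using t by (auto simp: \<rho>_def k_def)
  obtain C1 where C1: "0 \<le> C1" "\<And>r. 0 < r \<Longrightarrow> \<bar>V' r\<bar> \<le> C1 * r powr (1 + \<mu>)"
    "\<And>r. 0 < r \<Longrightarrow> \<bar>f r powr m - f 0 powr m\<bar> \<le> C1 * r powr (2 + \<mu>)"
    using profile_bounds by metis
  define C2 where "C2 = k * C1 * \<rho> powr (2 + \<mu>)"
  define V where "V r = k * (f (r * \<rho>) powr m)" for r
  define V2 where "V2 r = k * (V' (r * \<rho>) * \<rho>)" for r
  have "(\<integral>x. V (norm x) * (g x \<bullet> b) + V2 (norm x) * ((x \<bullet> b) / norm x) * \<phi> x \<partial>lborel) = 0"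
  proof (rule radial_gradient_by_parts[OF \<phi> g der supp R', where Vz = "k * f 0 powr m" and C = C2 and \<mu> = \<mu>])
    fix r :: real assume r: "0 < r"
    show "(V has_real_derivative V2 r) (at r)"
      unfolding V_def V2_def by (rule radial_chain[OF V_der r \<rho>, folded V'_def])
    have "\<bar>V r - k * f 0 powr m\<bar> = k * \<bar>f (r * \<rho>) powr m - f 0 powr m\<bar>"
      using k by (simp add: V_def abs_mult flip: right_diff_distrib)
    also have "\<dots> \<le> k * (C1 * (r * \<rho>) powr (2 + \<mu>))" using k r \<rho> by (intro mult_left_mono C1) auto
    also have "\<dots> = C2 * r powr (2 + \<mu>)" using r \<rho> by (simp add: C2_def powr_mult)
    finally show "\<bar>V r - k * f 0 powr m\<bar> \<le> C2 * r powr (2 + \<mu>)" .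
    have "\<bar>V2 r\<bar> = k * \<bar>V' (r * \<rho>)\<bar> * \<rho>" using k \<rho> by (simp add: V2_def abs_mult)
    also have "\<dots> \<le> k * (C1 * (r * \<rho>) powr (1 + \<mu>)) * \<rho>"
      using k r \<rho> by (intro mult_right_mono mult_left_mono C1) auto
    also have "\<dots> = k * C1 * (\<rho> * \<rho> powr (1 + \<mu>)) * r powr (1 + \<mu>)" using r \<rho> by (simp add: powr_mult)
    also have "\<rho> * \<rho> powr (1 + \<mu>) = \<rho> powr (2 + \<mu>)" using \<rho> powr_add[of \<rho> 1 "1 + \<mu>"] by simp
    finally show "\<bar>V2 r\<bar> \<le> C2 * r powr (1 + \<mu>)" by (simp add: C2_def)
  next
    show "continuous_on {0<..} V2"
      unfolding V2_def using \<rho> by (intro continuous_intros continuous_on_compose2[OF V'_cont]) auto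
    show "- real DIM('a) < 1 + \<mu>" using \<mu>(2) by (simp add: N_def)
  qed (use b in auto)
  moreover have "V (norm x) = u T (x, t) powr m" for x :: 'a
    by (simp add: V_def u_powr k_def \<rho>_def)
  moreover have "V2 (norm x) * ((x \<bullet> b) / norm x) = G T (x, t) \<bullet> b" for x :: 'a
  proof -
    have "(T - t) powr (\<beta> - \<alpha> * m) = k * \<rho>" by (simp add: k_def \<rho>_def flip: powr_add)
    then show ?thesis by (simp add: G_def V2_def \<rho>_def mult_ac)
  qed
  ultimately show ?thesis by (simp only:)
qed

text \<open>Adding the transport term turns \<open>G\<close> into the flux \<open>Y\<close> of the first integral of the profile equation.\<close>

definition flux_form :: "real \<Rightarrow> ('a \<times> real \<Rightarrow> real) \<Rightarrow> ('a \<times> real \<Rightarrow> 'a) \<Rightarrow> 'a \<times> real \<Rightarrow> real" where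
  "flux_form T \<phi> g z = (G T z + (\<beta> / (T - snd z) * norm (fst z) powr \<sigma>1 * u T z) *\<^sub>R fst z) \<bullet> g z +
     (c / (T - snd z) * norm (fst z) powr \<sigma>1 * u T z - norm (fst z) powr \<sigma>2 * u T z powr p) * \<phi> z"

text \<open>At a fixed time the added transport term cancels the \<open>\<beta>\<close> part of
  \<open>V'\<close>, which leaves a radial field built from \<open>Y\<close> alone; its divergence
  is the remaining coefficient of \<open>\<phi>\<close>, so integration by parts in space
  applies.\<close>

lemma slice_flux:
  assumes t: "t < T" and \<phi>: "continuous_on UNIV (\<lambda>x. \<phi> (x, t))" and g: "continuous_on UNIV (\<lambda>x. g (x, t))"
    and der: "\<And>x b. ((\<lambda>s. \<phi> (x + s *\<^sub>R b, t)) has_real_derivative g (x, t) \<bullet> b) (at 0)"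
    and supp: "\<And>x. R' < norm x \<Longrightarrow> \<phi> (x, t) = 0 \<and> g (x, t) = 0" and R': "0 < R'"
  shows "(\<integral>x. flux_form T \<phi> g (x, t) \<partial>lborel) = 0"
proof -
  define \<tau> where "\<tau> = T - t"
  define k where "k = \<tau> powr (- \<alpha> * m)"
  define \<rho> where "\<rho> = \<tau> powr \<beta>"
  have \<tau>: "0 < \<tau>" using t by (simp add: \<tau>_def)
  have \<rho>: "0 < \<rho>" and k: "0 < k" using \<tau> by (auto simp: \<rho>_def k_def)
  obtain C1 where C1: "0 \<le> C1" "\<And>r. 0 < r \<Longrightarrow> \<bar>Y r\<bar> \<le> C1 * r powr (N + \<mu>)"
    "\<And>r. 0 < r \<Longrightarrow> \<bar>r powr (N - 1) * h r\<bar> \<le> C1 * r powr (N - 1 + \<mu>)"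
    using profile_bounds by metis
  \<comment> \<open>\<open>k2\<close> collects the powers of \<open>\<rho>\<close> left over when
    \<open>G\<close> and the weights are rewritten in the variable
    \<open>s = r * \<rho>\<close>.\<close>
  define k2 where "k2 = k * \<rho> powr (2 - N)"
  have k2: "0 < k2" using k \<rho> by (simp add: k2_def)
  define C2 where "C2 = k2 * C1 * \<rho> powr (N + \<mu>)"
  define Y1 where "Y1 r = k2 * Y (r * \<rho>)" for r
  define Y2 where "Y2 r = k2 * (((r * \<rho>) powr (N - 1) * h (r * \<rho>)) * \<rho>)" for r
  have int0: "(\<integral>x. Y1 (norm x) * norm x powr (- real DIM('a)) * (x \<bullet> g (x, t)) +
      Y2 (norm x) * norm x powr (1 - real DIM('a)) * \<phi> (x, t) \<partial>lborel) = 0"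
  proof (rule radial_flux_by_parts[OF \<phi> g der supp R', where C = C2 and \<mu> = \<mu>])
    fix r :: real assume r: "0 < r"
    show "(Y1 has_real_derivative Y2 r) (at r)"
      unfolding Y1_def Y2_def h_def by (rule radial_chain[OF Y_der r \<rho>])
    have "\<bar>Y1 r\<bar> = k2 * \<bar>Y (r * \<rho>)\<bar>" using k2 by (simp add: Y1_def abs_mult)
    also have "\<dots> \<le> k2 * (C1 * (r * \<rho>) powr (N + \<mu>))" using k2 r \<rho> by (intro mult_left_mono C1) auto
    also have "\<dots> = C2 * r powr (N + \<mu>)" using r \<rho> by (simp add: C2_def powr_mult)
    finally show "\<bar>Y1 r\<bar> \<le> C2 * r powr (real DIM('a) + \<mu>)" by (simp add: N_def)
    have "\<bar>Y2 r\<bar> = k2 * \<bar>(r * \<rho>) powr (N - 1) * h (r * \<rho>)\<bar> * \<rho>" using k2 \<rho> by (simp add: Y2_def abs_mult)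
    also have "\<dots> \<le> k2 * (C1 * (r * \<rho>) powr (N - 1 + \<mu>)) * \<rho>"
      using k2 r \<rho> by (intro mult_right_mono mult_left_mono C1) auto
    also have "\<dots> = k2 * C1 * (\<rho> * \<rho> powr (N - 1 + \<mu>)) * r powr (N - 1 + \<mu>)" using r \<rho> by (simp add: powr_mult)
    also have "\<rho> * \<rho> powr (N - 1 + \<mu>) = \<rho> powr (N + \<mu>)" using \<rho> powr_add[of \<rho> 1 "N - 1 + \<mu>"] by simp
    finally show "\<bar>Y2 r\<bar> \<le> C2 * r powr (real DIM('a) - 1 + \<mu>)" by (simp add: C2_def N_def)
  next
    show "continuous_on {0<..} Y2"
      unfolding Y2_def using \<rho> by (intro continuous_intros continuous_on_compose2[OF h_cont]) auto
    show "- real DIM('a) < \<mu>" using \<mu>(2) by (simp add: N_def)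
  qed
  \<comment> \<open>The relations between the exponents enter here: the time factor of the diffusion
    turns into that of the time derivative and into that of the reaction.\<close>
  have e1: "k * \<rho> powr (2 + \<sigma>1) = \<tau> powr (- \<alpha> - 1)"
    using exps(1) by (simp add: k_def \<rho>_def powr_powr flip: powr_add)
  have e2: "k * \<rho> powr (2 + \<sigma>2) = \<tau> powr (- \<alpha> * p)"
    using exps(2) by (simp add: k_def \<rho>_def powr_powr flip: powr_add)
  have e3: "\<tau> powr (- \<alpha> - 1) = \<tau> powr (- \<alpha>) / \<tau>" using \<tau> by (simp add: powr_diff)
  have e4: "\<tau> powr (\<beta> - \<alpha> * m) = k * \<rho>" by (simp add: k_def \<rho>_def flip: powr_add)
  have "Y1 (norm x) * norm x powr - N * (x \<bullet> g (x, t)) + Y2 (norm x) * norm x powr (1 - N) * \<phi> (x, t)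
      = flux_form T \<phi> g (x, t)" for x :: 'a
  proof (cases "x = 0")
    case True then show ?thesis by (simp add: flux_form_def G_def)
  next
    case False
    define r where "r = norm x"
    have r: "0 < r" using False by (simp add: r_def)
    define s where "s = r * \<rho>"
    have s: "0 < s" using r \<rho> by (simp add: s_def)
    have u: "u T (x, t) = \<tau> powr (- \<alpha>) * f s" by (simp add: u_def \<tau>_def s_def r_def \<rho>_def)
    have up: "u T (x, t) powr p = \<tau> powr (- \<alpha> * p) * f s powr p"
      by (simp add: u_powr \<tau>_def s_def r_def \<rho>_def)
    have G: "G T (x, t) = (k * \<rho> * V' s / r) *\<^sub>R x"
      using e4 by (simp add: G_def \<tau>_def s_def r_def \<rho>_def)
    have p1: "k * \<rho> * s powr (1 - N) / r = k2 * r powr - N"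
    proof -
      have "k * \<rho> * s powr (1 - N) / r = k * (\<rho> * \<rho> powr (1 - N)) * (r powr (1 - N) / r)"
        using r \<rho> by (simp add: s_def powr_mult)
      also have "\<rho> * \<rho> powr (1 - N) = \<rho> powr (2 - N)" using \<rho> powr_add[of \<rho> 1 "1 - N"] by simp
      also have "r powr (1 - N) / r = r powr - N" using r powr_diff[of r "1 - N" 1] by simp
      finally show ?thesis by (simp add: k2_def)
    qed
    have p2: "k * \<rho> * s powr (1 + \<sigma>1) / r = \<tau> powr (- \<alpha>) / \<tau> * r powr \<sigma>1"
    proof -
      have "k * \<rho> * s powr (1 + \<sigma>1) / r = k * (\<rho> * \<rho> powr (1 + \<sigma>1)) * (r powr (1 + \<sigma>1) / r)"
        using r \<rho> by (simp add: s_def powr_mult)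
      also have "\<rho> * \<rho> powr (1 + \<sigma>1) = \<rho> powr (2 + \<sigma>1)" using \<rho> powr_add[of \<rho> 1 "1 + \<sigma>1"] by simp
      also have "r powr (1 + \<sigma>1) / r = r powr \<sigma>1" using r powr_diff[of r "1 + \<sigma>1" 1] by simp
      finally show ?thesis by (simp add: e1 e3)
    qed
    have c1: "k * \<rho> * V' s / r + \<beta> / \<tau> * r powr \<sigma>1 * (\<tau> powr (- \<alpha>) * f s) = k2 * r powr - N * Y s"
    proof -
      have "k * \<rho> * V' s / r = (k * \<rho> * s powr (1 - N) / r) * Y s - \<beta> * (k * \<rho> * s powr (1 + \<sigma>1) / r) * f s"
        by (simp add: V'_def algebra_simps diff_divide_distrib)
      then show ?thesis by (simp add: p1 p2)
    qed
    have p3: "k2 * (s powr (N - 1) * \<rho>) * r powr (1 - N) = k * \<rho> powr 2"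
    proof -
      have "k2 * (s powr (N - 1) * \<rho>) * r powr (1 - N) =
          k * (\<rho> powr (2 - N) * \<rho> powr (N - 1) * \<rho> powr 1) * (r powr (N - 1) * r powr (1 - N))"
        using r \<rho> by (simp add: s_def powr_mult k2_def)
      also have "\<rho> powr (2 - N) * \<rho> powr (N - 1) * \<rho> powr 1 = \<rho> powr 2" by (simp only: flip: powr_add) simp
      also have "r powr (N - 1) * r powr (1 - N) = 1" using r by (simp flip: powr_add)
      finally show ?thesis by simp
    qed
    have c2: "k2 * ((s powr (N - 1) * h s) * \<rho>) * r powr (1 - N) =
        c / \<tau> * r powr \<sigma>1 * (\<tau> powr (- \<alpha>) * f s) - r powr \<sigma>2 * (\<tau> powr (- \<alpha> * p) * f s powr p)"
    proof -
      have "k2 * ((s powr (N - 1) * h s) * \<rho>) * r powr (1 - N) = (k2 * (s powr (N - 1) * \<rho>) * r powr (1 - N)) * h s"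
        by (simp add: mult_ac)
      also have "\<dots> = k * \<rho> powr 2 * (c * s powr \<sigma>1 * f s - s powr \<sigma>2 * f s powr p)"
        by (simp only: p3 h_def)
      also have "\<dots> = c * (k * (\<rho> powr 2 * \<rho> powr \<sigma>1)) * r powr \<sigma>1 * f s
          - (k * (\<rho> powr 2 * \<rho> powr \<sigma>2)) * r powr \<sigma>2 * f s powr p"
        using r \<rho> by (simp add: s_def powr_mult algebra_simps)
      also have "\<dots> = c * (k * \<rho> powr (2 + \<sigma>1)) * r powr \<sigma>1 * f s - (k * \<rho> powr (2 + \<sigma>2)) * r powr \<sigma>2 * f s powr p"
        by (simp only: powr_add)
      also have "\<dots> = c * (\<tau> powr (- \<alpha>) / \<tau>) * r powr \<sigma>1 * f s - \<tau> powr (- \<alpha> * p) * r powr \<sigma>2 * f s powr p"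
        by (simp only: e1 e2 e3)
      finally show ?thesis by (simp add: mult_ac)
    qed
    have "flux_form T \<phi> g (x, t) = (k * \<rho> * V' s / r + \<beta> / \<tau> * r powr \<sigma>1 * (\<tau> powr (- \<alpha>) * f s)) * (x \<bullet> g (x, t)) +
        (c / \<tau> * r powr \<sigma>1 * (\<tau> powr (- \<alpha>) * f s) - r powr \<sigma>2 * (\<tau> powr (- \<alpha> * p) * f s powr p)) * \<phi> (x, t)"
      unfolding flux_form_def G up unfolding u fst_conv snd_conv \<tau>_def[symmetric] r_def[symmetric]
        scaleR_add_left[symmetric] inner_scaleR_left ..
    also have "\<dots> = Y1 r * r powr - N * (x \<bullet> g (x, t)) + Y2 r * r powr (1 - N) * \<phi> (x, t)"
      unfolding c1 c2[symmetric] Y1_def Y2_def s_def[symmetric] by (simp add: mult_ac)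
    finally show ?thesis by (simp add: r_def)
  qed
  then show ?thesis using int0 by (simp add: N_def)
qed

section \<open>Integrability and the weak gradient\<close>

lemma integrable_weighted_continuous:
  fixes a :: "'a \<times> real \<Rightarrow> real"
  assumes a: "continuous_on (UNIV \<times> {..<T}) a" and s: "- N < s" and R': "0 < R'" and t1: "t1 < T"
    and zero: "\<And>x t. \<not> (norm x \<le> R' \<and> t \<in> {t0..t1}) \<Longrightarrow> a (x, t) = 0"
  shows "integrable lborel (\<lambda>z. norm (fst z) powr s * a z)"
proof -
  have "bounded (a ` (cball 0 R' \<times> {t0..t1}))"
    using t1 by (intro compact_imp_bounded compact_continuous_image continuous_on_subset[OF a] compact_Times) auto
  then obtain M where M: "\<forall>z\<in>cball 0 R' \<times> {t0..t1}. \<bar>a z\<bar> \<le> M" unfolding bounded_iff by auto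
  have "(\<lambda>z. if z \<in> UNIV \<times> {..<T} then a z else 0) \<in> borel_measurable borel"
    by (intro borel_measurable_continuous_on_if a continuous_on_const) (auto intro!: borel_open open_Times)
  moreover have "(\<lambda>z. if z \<in> UNIV \<times> {..<T} then a z else 0) = a" using zero t1 by (fastforce simp: fun_eq_iff)
  ultimately have [measurable]: "a \<in> borel_measurable borel" by simp
  have [measurable]: "(fst :: 'a \<times> real \<Rightarrow> 'a) \<in> borel_measurable borel"
    by (auto intro!: borel_measurable_continuous_onI continuous_intros)
  show ?thesis
  proof (rule integrable_weighted[OF _ _ R', where s = s and ?t0.0 = t0 and ?t1.0 = t1 and C = M])
    show "(\<lambda>z. norm (fst z) powr s * a z) \<in> borel_measurable borel" by measurable
    show "- real DIM('a) < s" using s by (simp add: N_def)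
    show "norm (norm (fst (x, t)) powr s * a (x, t)) \<le> M * norm x powr s" if "norm x \<le> R'" "t \<in> {t0..t1}" for x t
    proof -
      have "\<bar>a (x, t)\<bar> \<le> M" using M that by (intro bspec[OF M]) auto
      then have "\<bar>a (x, t)\<bar> * norm x powr s \<le> M * norm x powr s" by (intro mult_right_mono) auto
      then show ?thesis by (simp add: abs_mult mult.commute)
    qed
  qed (use zero in auto)
qed

lemma G_bound:
  assumes "t1 < T"
  obtains M where "0 \<le> M" "\<And>x t. t \<in> {t0..t1} \<Longrightarrow> norm (G T (x, t)) \<le> M * norm x powr (1 + \<mu>)"
proof -
  obtain C1 where C1: "0 \<le> C1" "\<And>r. 0 < r \<Longrightarrow> \<bar>V' r\<bar> \<le> C1 * r powr (1 + \<mu>)"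
    using profile_bounds by metis
  define e where "e = \<beta> - \<alpha> * m + \<beta> * (1 + \<mu>)"
  have "continuous_on {t0..t1} (\<lambda>t. (T - t) powr e)" using assms by (intro continuous_intros) auto
  then have "bounded ((\<lambda>t. (T - t) powr e) ` {t0..t1})"
    by (intro compact_imp_bounded compact_continuous_image) auto
  then obtain M where M: "\<forall>t\<in>{t0..t1}. \<bar>(T - t) powr e\<bar> \<le> M" unfolding bounded_iff by auto
  show ?thesis
  proof (rule that[of "max 0 M * C1"])
    show "0 \<le> max 0 M * C1" using C1(1) by simp
    fix x :: 'a and t assume t: "t \<in> {t0..t1}"
    have Mt: "(T - t) powr e \<le> max 0 M" using bspec[OF M t] by simp
    show "norm (G T (x, t)) \<le> max 0 M * C1 * norm x powr (1 + \<mu>)"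
    proof (cases "x = 0")
      case True then show ?thesis by (simp add: G_def)
    next
      case False
      have pos: "0 < (T - t) powr \<beta>" using t assms by simp
      have "norm (G T (x, t)) = (T - t) powr (\<beta> - \<alpha> * m) * \<bar>V' (norm x * (T - t) powr \<beta>)\<bar>"
        using False by (simp add: G_def abs_mult)
      also have "\<dots> \<le> (T - t) powr (\<beta> - \<alpha> * m) * (C1 * (norm x * (T - t) powr \<beta>) powr (1 + \<mu>))"
        using False pos by (intro mult_left_mono C1) auto
      also have "\<dots> = ((T - t) powr (\<beta> - \<alpha> * m) * (T - t) powr (\<beta> * (1 + \<mu>))) * C1 * norm x powr (1 + \<mu>)"
        by (simp add: powr_mult powr_powr)
      also have "(T - t) powr (\<beta> - \<alpha> * m) * (T - t) powr (\<beta> * (1 + \<mu>)) = (T - t) powr e"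
        by (simp add: e_def flip: powr_add)
      also have "(T - t) powr e * C1 * norm x powr (1 + \<mu>) \<le> max 0 M * C1 * norm x powr (1 + \<mu>)"
        using Mt C1(1) by (intro mult_right_mono) auto
      finally show ?thesis .
    qed
  qed
qed

lemma weak_gradient:
  assumes T: "0 < T"
  shows "weak_spatial_gradient (space_time T) (\<lambda>z. u T z powr m) (G T)"
    and "locally_integrable_on (\<lambda>z. (norm (G T z))\<^sup>2) (space_time T)"
proof -
  have Q: "space_time T \<subseteq> (UNIV :: 'a set) \<times> {..<T}" by (auto simp: space_time_def)
  have uc: "continuous_on (UNIV \<times> {..<T}) (\<lambda>z. u T z powr m)" using m by (intro u_powr_cont) simp
  have li_u: "locally_integrable_on (\<lambda>z. u T z powr m) (space_time T)"
    by (rule locally_integrable_continuous[OF continuous_on_subset[OF uc Q]])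
  have li_G: "locally_integrable_on (G T) (space_time T)"
  proof (rule locally_integrable_weighted[OF G_measurable _ T, of "1 + \<mu>"])
    show "- real DIM('a) < 1 + \<mu>" using \<mu> by (simp add: N_def)
    fix R t0 t1 :: real assume "t1 < T"
    then show "\<exists>C. \<forall>x t. norm x \<le> R \<longrightarrow> t \<in> {t0..t1} \<longrightarrow> norm (G T (x, t)) \<le> C * norm x powr (1 + \<mu>)"
      using G_bound by metis
  qed
  show "locally_integrable_on (\<lambda>z. (norm (G T z))\<^sup>2) (space_time T)"
  proof (rule locally_integrable_weighted[OF _ _ T, of _ "2 + 2 * \<mu>"])
    show "(\<lambda>z. (norm (G T z))\<^sup>2) \<in> borel_measurable borel" using G_measurable by measurable
    \<comment> \<open>Square integrability of the gradient asks for this exponent: for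
      \<open>N \<ge> 2\<close> it follows from \<open>\<mu> > -2\<close>, for \<open>N = 1\<close>
      from \<open>\<mu> > - N = -1\<close>.\<close>
    have "- N < 2 + 2 * \<mu>"
    proof (cases "N \<ge> 2")
      case False
      then have "N < 2" by simp
      then have "DIM('a) < 2" by (simp add: N_def)
      then have "DIM('a) = 1" using DIM_positive[where 'a = 'a] by linarith
      then have "N = 1" by (simp add: N_def)
      then show ?thesis using \<mu>(2) by simp
    qed (use \<mu> in simp)
    then show "- real DIM('a) < 2 + 2 * \<mu>" by (simp add: N_def)
    fix R t0 t1 :: real assume "t1 < T"
    then obtain M where M: "0 \<le> M" "\<And>x t. t \<in> {t0..t1} \<Longrightarrow> norm (G T (x, t)) \<le> M * norm x powr (1 + \<mu>)"
      using G_bound by metis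
    have "norm ((norm (G T (x, t)))\<^sup>2) \<le> M\<^sup>2 * norm x powr (2 + 2 * \<mu>)" if "t \<in> {t0..t1}" for x t
    proof -
      have "(norm (G T (x, t)))\<^sup>2 \<le> (M * norm x powr (1 + \<mu>))\<^sup>2" using M(2)[OF that] by (intro power_mono) auto
      also have "\<dots> = M\<^sup>2 * (norm x powr (1 + \<mu>) * norm x powr (1 + \<mu>))"
        by (simp add: power_mult_distrib power2_eq_square)
      also have "norm x powr (1 + \<mu>) * norm x powr (1 + \<mu>) = norm x powr (2 + 2 * \<mu>)" by (simp flip: powr_add)
      finally show ?thesis by simp
    qed
    then show "\<exists>C. \<forall>x t. norm x \<le> R \<longrightarrow> t \<in> {t0..t1} \<longrightarrow> norm ((norm (G T (x, t)))\<^sup>2) \<le> C * norm x powr (2 + 2 * \<mu>)"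
      by blast
  qed
  show "weak_spatial_gradient (space_time T) (\<lambda>z. u T z powr m) (G T)"
    unfolding weak_spatial_gradient_def
  proof (intro conjI li_u li_G allI impI)
    fix \<phi> :: "'a \<times> real \<Rightarrow> real" and g assume tf: "test_function (space_time T) \<phi> g"
    obtain R' t0 t1 where R': "0 < R'" "0 < t0" "t0 \<le> t1" "t1 < T"
      and z: "\<And>x t. \<not> (norm x \<le> R' \<and> t \<in> {t0..t1}) \<Longrightarrow> \<phi> (x, t) = 0 \<and> g (x, t) = 0"
      and c: "continuous_on UNIV \<phi>" "continuous_on UNIV g"
      and der: "\<And>z. (\<phi> has_derivative (\<lambda>h. h \<bullet> g z)) (at z)"
      using test_functionD[OF tf T] by metis
    have out: "\<phi> z = 0 \<and> g z = 0" if "z \<notin> space_time T" for z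
    proof -
      have "\<not> snd z \<in> {t0..t1}" using that R' by (cases z) (auto simp: space_time_def)
      then show ?thesis using z[of "fst z" "snd z"] by simp
    qed
    define K where "K = cball (0::'a) R' \<times> {t0..t1}"
    have K: "compact K" "K \<subseteq> space_time T" using R' by (auto simp: K_def space_time_def intro!: compact_Times)
    have zK: "\<phi> z = 0 \<and> g z = 0" if "z \<notin> K" for z
      using z[of "fst z" "snd z"] that by (cases z) (auto simp: K_def)
    have i1: "integrable lborel (\<lambda>z. u T z powr m *\<^sub>R fst (g z))"
    proof -
      have "integrable lborel (\<lambda>z. indicator K z *\<^sub>R (u T z powr m *\<^sub>R fst (g z)))"
        using Q K by (intro borel_integrable_compact K continuous_intros continuous_on_subset[OF uc] continuous_on_subset[OF c(2)]) auto
      moreover have "indicator K z *\<^sub>R (u T z powr m *\<^sub>R fst (g z)) = u T z powr m *\<^sub>R fst (g z)" for z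
        using zK[of z] by (cases "z \<in> K") auto
      ultimately show ?thesis by (simp only:)
    qed
    have \<phi>m [measurable]: "\<phi> \<in> borel_measurable borel" by (rule borel_measurable_continuous_onI[OF c(1)])
    have i2: "integrable lborel (\<lambda>z. \<phi> z *\<^sub>R G T z)"
    proof -
      have "bounded (\<phi> ` K)" by (intro compact_imp_bounded compact_continuous_image continuous_on_subset[OF c(1)] K) auto
      then obtain P where P: "\<forall>z\<in>K. \<bar>\<phi> z\<bar> \<le> P" unfolding bounded_iff by auto
      obtain M where M: "0 \<le> M" "\<And>x t. t \<in> {t0..t1} \<Longrightarrow> norm (G T (x, t)) \<le> M * norm x powr (1 + \<mu>)"
        using G_bound[OF R'(4)] by metis
      show ?thesis
      proof (rule integrable_weighted[OF _ _ R'(1), where s = "1 + \<mu>" and ?t0.0 = t0 and ?t1.0 = t1 and C = "P * M"])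
        show "(\<lambda>z. \<phi> z *\<^sub>R G T z) \<in> borel_measurable borel"
          using G_measurable \<phi>m by (rule borel_measurable_scaleR[rotated])
        show "- real DIM('a) < 1 + \<mu>" using \<mu> by (simp add: N_def)
        show "norm (\<phi> (x, t) *\<^sub>R G T (x, t)) \<le> P * M * norm x powr (1 + \<mu>)" if "norm x \<le> R'" "t \<in> {t0..t1}" for x t
        proof -
          have "\<bar>\<phi> (x, t)\<bar> \<le> P" using that by (intro bspec[OF P]) (auto simp: K_def)
          then have "\<bar>\<phi> (x, t)\<bar> * norm (G T (x, t)) \<le> P * (M * norm x powr (1 + \<mu>))"
            using M(2)[OF that(2)] by (intro mult_mono) auto
          then show ?thesis by (simp add: mult.assoc)
        qed
      qed (use z in auto)
    qed
    have "integral\<^sup>L lborel (\<lambda>z. u T z powr m *\<^sub>R fst (g z)) + integral\<^sup>L lborel (\<lambda>z. \<phi> z *\<^sub>R G T z) = 0"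
    proof (rule euclidean_eqI)
      fix b :: 'a assume b: "b \<in> Basis"
      define e where "e z = u T z powr m * (fst (g z) \<bullet> b) + (G T z \<bullet> b) * \<phi> z" for z
      have j1: "integrable lborel (\<lambda>z. (u T z powr m *\<^sub>R fst (g z)) \<bullet> b)"
        by (rule integrable_inner_left) (rule i1)
      have j2: "integrable lborel (\<lambda>z. (\<phi> z *\<^sub>R G T z) \<bullet> b)"
        by (rule integrable_inner_left) (rule i2)
      have e_eq: "e = (\<lambda>z. (u T z powr m *\<^sub>R fst (g z)) \<bullet> b + (\<phi> z *\<^sub>R G T z) \<bullet> b)"
        by (simp add: fun_eq_iff e_def mult.commute)
      have ie: "integrable lborel e" unfolding e_eq by (intro Bochner_Integration.integrable_add j1 j2)
      \<comment> \<open>On each time slice the identity is integration by parts in space; Fubini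
        then gives it in space-time, component by component.\<close>
      have e0: "(\<integral>x. e (x, t) \<partial>lborel) = 0" for t
      proof (cases "t < T")
        case True
        show ?thesis unfolding e_def
        proof (rule slice_gradient[OF True _ _ _ _ R'(1)])
          show "continuous_on UNIV (\<lambda>x. \<phi> (x, t))" "continuous_on UNIV (\<lambda>x. fst (g (x, t)))"
            by (intro continuous_intros continuous_on_compose2[OF c(1)] continuous_on_compose2[OF c(2)]; simp)+
          show "((\<lambda>s. \<phi> (x + s *\<^sub>R b, t)) has_real_derivative fst (g (x, t)) \<bullet> b) (at 0)" for x b
          proof -
            have "((\<lambda>s. x + s *\<^sub>R b) has_vector_derivative b) (at 0)"
              by (auto intro!: derivative_eq_intros)
            from path_derivative[where g = g and x = "\<lambda>s. x + s *\<^sub>R b" and t = "\<lambda>_. t" and s = 0, OF _ this DERIV_const] der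
            show ?thesis by (simp add: inner_commute)
          qed
          show "\<phi> (x, t) = 0 \<and> fst (g (x, t)) = 0" if "R' < norm x" for x using z[of x t] that by auto
          show "norm b = 1" using b by simp
        qed
      next
        case False
        then have "\<phi> (x, t) = 0 \<and> g (x, t) = 0" for x using z[of x t] R' by auto
        then show ?thesis by (simp add: e_def)
      qed
      have "integral\<^sup>L lborel e = (\<integral>t. (\<integral>x. e (x, t) \<partial>lborel) \<partial>lborel)"
        using lborel_pair.integral_snd[of "\<lambda>x t. e (x, t)"] ie by (simp add: lborel_prod)
      also have "\<dots> = 0" by (simp only: e0) simp
      finally have "integral\<^sup>L lborel e = 0" .
      moreover have "integral\<^sup>L lborel e = (\<integral>z. (u T z powr m *\<^sub>R fst (g z)) \<bullet> b \<partial>lborel) + (\<integral>z. (\<phi> z *\<^sub>R G T z) \<bullet> b \<partial>lborel)"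
        unfolding e_eq by (rule Bochner_Integration.integral_add[OF j1 j2])
      ultimately show "(integral\<^sup>L lborel (\<lambda>z. u T z powr m *\<^sub>R fst (g z)) + integral\<^sup>L lborel (\<lambda>z. \<phi> z *\<^sub>R G T z)) \<bullet> b = 0 \<bullet> b"
        using i1 i2 by (simp add: inner_add_left del: inner_scaleR_left)
    qed
    moreover have "(LINT z:space_time T|lborel. u T z powr m *\<^sub>R fst (g z)) = integral\<^sup>L lborel (\<lambda>z. u T z powr m *\<^sub>R fst (g z))"
      by (rule set_lebesgue_integral_supported) (use out in auto)
    moreover have "(LINT z:space_time T|lborel. \<phi> z *\<^sub>R G T z) = integral\<^sup>L lborel (\<lambda>z. \<phi> z *\<^sub>R G T z)"
      by (rule set_lebesgue_integral_supported) (use out in auto)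
    ultimately show "(LINT z:space_time T|lborel. u T z powr m *\<^sub>R fst (g z)) = - (LINT z:space_time T|lborel. \<phi> z *\<^sub>R G T z)"
      by (simp add: eq_neg_iff_add_eq_0)
  qed
qed

text \<open>The time derivative of the test function together with the transport and zero-order
  terms that occur in \<open>flux_form\<close>; the integrand of the weak formulation is its
  weighted product with \<open>u\<close> minus \<open>flux_form\<close>.\<close>

definition transport_form :: "real \<Rightarrow> ('a \<times> real \<Rightarrow> real) \<Rightarrow> ('a \<times> real \<Rightarrow> 'a \<times> real) \<Rightarrow> 'a \<times> real \<Rightarrow> real" where
  "transport_form T \<phi> g z = snd (g z) + \<beta> / (T - snd z) * (fst z \<bullet> fst (g z)) + c / (T - snd z) * \<phi> z"

text \<open>In the similarity variable \<open>x (T - t)\<^sup>\<beta>\<close> the transport form is the exact time derivative of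
  \<open>(T - t)\<^sup>-\<^sup>c \<phi>\<close>.\<close>

lemma transport_integral:
  assumes R': "0 < R'" "0 < t0" "t0 \<le> t1" "t1 < T"
    and z: "\<And>x t. \<not> (norm x \<le> R' \<and> t \<in> {t0..t1}) \<Longrightarrow> \<phi> (x, t) = 0 \<and> g (x, t) = 0"
    and cont: "continuous_on UNIV \<phi>" "continuous_on UNIV g"
    and der: "\<And>z. (\<phi> has_derivative (\<lambda>h. h \<bullet> g z)) (at z)"
  shows "integrable lborel (\<lambda>z. norm (fst z) powr \<sigma>1 * (u T z * transport_form T \<phi> g z))" (is ?int)
    and "(\<integral>z. norm (fst z) powr \<sigma>1 * (u T z * transport_form T \<phi> g z) \<partial>lborel) = 0"
proof -
  define W where "W z = norm (fst z) powr \<sigma>1 * (u T z * transport_form T \<phi> g z)" for z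
  have tc: "continuous_on (UNIV \<times> {..<T}) (transport_form T \<phi> g)"
    unfolding transport_form_def
    by (intro continuous_intros continuous_on_subset[OF cont(1)] continuous_on_subset[OF cont(2)]) auto
  have tz: "transport_form T \<phi> g (x, t) = 0" if "\<not> (norm x \<le> R' \<and> t \<in> {t0..t1})" for x t
    using z[OF that] by (simp add: transport_form_def)
  show int: ?int
    by (rule integrable_weighted_continuous[OF _ _ R'(1,4), of _ _ t0])
       (use \<sigma> tz in \<open>auto intro!: continuous_intros u_cont tc\<close>)
  define \<Theta> where "\<Theta> y = (T - snd y) powr (- c) * transport_form T \<phi> g ((T - snd y) powr (- \<beta>) *\<^sub>R fst y, snd y)" for y
  have \<Theta>c: "continuous_on (UNIV \<times> {..<T}) \<Theta>"
    unfolding \<Theta>_def by (intro continuous_intros continuous_on_compose2[OF tc]) auto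
  have \<Theta>z: "\<Theta> (y, t) = 0" if "t \<notin> {t0..t1}" for y t using that tz by (simp add: \<Theta>_def)
  have slice: "(\<integral>x. W (x, t) \<partial>lborel) = (\<integral>y. norm y powr \<sigma>1 * (f (norm y) * \<Theta> (y, t)) \<partial>lborel)" for t
  proof (cases "t < T")
    case False
    then have "t \<notin> {t0..t1}" using R' by auto
    then show ?thesis using tz \<Theta>z by (simp add: W_def)
  next
    case True
    define \<tau> where "\<tau> = T - t"
    have \<tau>: "0 < \<tau>" using True by (simp add: \<tau>_def)
    define r where "r = \<tau> powr (- \<beta>)"
    have r: "0 < r" using \<tau> by (simp add: r_def)
    have cW: "continuous_on UNIV (\<lambda>x. u T (x, t) * transport_form T \<phi> g (x, t))"
      by (intro continuous_intros continuous_on_compose2[OF u_cont] continuous_on_compose2[OF tc]) (use True in auto)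
    have [measurable]: "(\<lambda>x. u T (x, t) * transport_form T \<phi> g (x, t)) \<in> borel_measurable borel"
      by (rule borel_measurable_continuous_onI[OF cW])
    have "(\<lambda>x. W (x, t)) \<in> borel_measurable borel" unfolding W_def fst_conv by measurable
    then have "(\<integral>x. W (x, t) \<partial>lborel) = r ^ DIM('a) * (\<integral>y. W (r *\<^sub>R y, t) \<partial>lborel)"
      using lborel_scale[OF r] by blast
    also have "\<dots> = (\<integral>y. r ^ DIM('a) * W (r *\<^sub>R y, t) \<partial>lborel)" by simp
    also have "(\<lambda>y. r ^ DIM('a) * W (r *\<^sub>R y, t)) = (\<lambda>y. norm y powr \<sigma>1 * (f (norm y) * \<Theta> (y, t)))"
    proof
      fix y :: 'a
      have n: "norm (r *\<^sub>R y) * \<tau> powr \<beta> = norm y"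
        using \<tau> r by (simp add: r_def powr_minus)
      have "r ^ DIM('a) = \<tau> powr (- \<beta> * N)" using r by (simp add: r_def N_def powr_powr flip: powr_realpow)
      moreover have "norm (r *\<^sub>R y) powr \<sigma>1 = \<tau> powr (- \<beta> * \<sigma>1) * norm y powr \<sigma>1"
        using r by (simp add: powr_mult) (simp add: r_def powr_powr)
      moreover have "u T (r *\<^sub>R y, t) = \<tau> powr (- \<alpha>) * f (norm y)"
        unfolding n[symmetric] by (simp only: u_def fst_conv snd_conv \<tau>_def)
      ultimately have "r ^ DIM('a) * W (r *\<^sub>R y, t) =
          (\<tau> powr (- \<beta> * N) * \<tau> powr (- \<beta> * \<sigma>1) * \<tau> powr (- \<alpha>)) * (norm y powr \<sigma>1 * (f (norm y) * transport_form T \<phi> g (r *\<^sub>R y, t)))"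
        by (simp add: W_def)
      \<comment> \<open>Jacobian, weight and amplitude contribute \<open>\<beta> * N\<close>,
        \<open>\<beta> * \<sigma>1\<close> and \<open>\<alpha>\<close>, which add up to
        \<open>c\<close>.\<close>
      also have "\<tau> powr (- \<beta> * N) * \<tau> powr (- \<beta> * \<sigma>1) * \<tau> powr (- \<alpha>) = \<tau> powr (- c)"
        by (simp add: c(2) algebra_simps flip: powr_add)
      finally show "r ^ DIM('a) * W (r *\<^sub>R y, t) = norm y powr \<sigma>1 * (f (norm y) * \<Theta> (y, t))"
        by (simp add: \<Theta>_def \<tau>_def r_def)
    qed
    finally show ?thesis .
  qed
  \<comment> \<open>In the similarity variable the support of \<open>f\<close> bounds
    \<open>y\<close> by \<open>R\<close> for all times; this integrability justifies exchanging the
    two integrals.\<close>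
  have int\<Theta>: "integrable lborel (\<lambda>y. norm (fst y) powr \<sigma>1 * (f (norm (fst y)) * \<Theta> y))"
  proof (rule integrable_weighted_continuous[OF _ _ R R'(4), of _ _ t0])
    show "continuous_on (UNIV \<times> {..<T}) (\<lambda>y. f (norm (fst y)) * \<Theta> y)"
      by (intro continuous_intros \<Theta>c continuous_on_compose2[OF f_cont]) auto
    show "- N < \<sigma>1" using \<sigma> by simp
    show "f (norm (fst (x, t))) * \<Theta> (x, t) = 0" if "\<not> (norm x \<le> R \<and> t \<in> {t0..t1})" for x t
      using that \<Theta>z[of t x] f_supp[of "norm x"] by auto
  qed
  have time: "(\<integral>t. \<Theta> (y, t) \<partial>lborel) = 0" for y
  proof -
    define \<psi> where "\<psi> t = (T - t) powr (- c) * \<phi> ((T - t) powr (- \<beta>) *\<^sub>R y, t)" for t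
    \<comment> \<open>\<open>a\<close> and \<open>b\<close> lie strictly outside
      \<open>{t0..t1}\<close> on either side, with \<open>b < T\<close>, so \<open>\<psi>\<close> is
      differentiable on \<open>{a..b}\<close> and vanishes at both ends.\<close>
    define a b where "a = t0 / 2" and "b = (t1 + T) / 2"
    have ab: "a < t0" "t1 < b" "b < T" "a \<le> b" using R' by (auto simp: a_def b_def)
    have d\<psi>: "(\<psi> has_real_derivative \<Theta> (y, t)) (at t)" if "t < T" for t
    proof -
      define \<tau> where "\<tau> = T - t"
      have \<tau>: "0 < \<tau>" using that by (simp add: \<tau>_def)
      have dp: "((\<lambda>t. (T - t) powr q) has_real_derivative - q * \<tau> powr (q - 1)) (at t)" for q
      proof -
        have "((\<lambda>t. T - t) has_real_derivative - 1) (at t)" by (auto intro!: derivative_eq_intros)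
        from has_real_derivative_powr_comp[OF this, of q] \<tau> show ?thesis by (simp add: \<tau>_def)
      qed
      have dx: "((\<lambda>t. (T - t) powr (- \<beta>) *\<^sub>R y) has_vector_derivative (\<beta> * \<tau> powr (- \<beta> - 1)) *\<^sub>R y) (at t)"
        using has_vector_derivative_scaleR[OF dp[of "- \<beta>"] has_vector_derivative_const[of y]] by simp
      have d\<phi>: "((\<lambda>t. \<phi> ((T - t) powr (- \<beta>) *\<^sub>R y, t)) has_real_derivative
          ((\<beta> * \<tau> powr (- \<beta> - 1)) *\<^sub>R y) \<bullet> fst (g (\<tau> powr (- \<beta>) *\<^sub>R y, t)) + 1 * snd (g (\<tau> powr (- \<beta>) *\<^sub>R y, t))) (at t)"
        unfolding \<tau>_def
        by (rule path_derivative[where g = g and x = "\<lambda>t. (T - t) powr (- \<beta>) *\<^sub>R y" and t = "\<lambda>t. t" and s = t])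
          (rule der dx[unfolded \<tau>_def] DERIV_ident)+
      have eq: "- (- c) * \<tau> powr (- c - 1) * \<phi> (\<tau> powr (- \<beta>) *\<^sub>R y, t) +
          (((\<beta> * \<tau> powr (- \<beta> - 1)) *\<^sub>R y) \<bullet> fst (g (\<tau> powr (- \<beta>) *\<^sub>R y, t)) +
            1 * snd (g (\<tau> powr (- \<beta>) *\<^sub>R y, t))) * \<tau> powr (- c) = \<Theta> (y, t)"
        using \<tau> unfolding \<Theta>_def transport_form_def fst_conv snd_conv \<tau>_def[symmetric] powr_diff
        by (simp add: algebra_simps)
      from DERIV_mult[OF dp[of "- c"] d\<phi>] show ?thesis
        unfolding \<psi>_def eq[symmetric] \<tau>_def[symmetric] by (simp only: \<tau>_def)
    qed
    have cont\<Theta>: "isCont (\<lambda>t. \<Theta> (y, t)) t" if "t < T" for t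
    proof -
      have "continuous_on {..<T} (\<lambda>t. \<Theta> (y, t))"
        by (rule continuous_on_compose2[OF \<Theta>c]) (auto intro: continuous_intros)
      then show ?thesis using that by (simp add: continuous_on_eq_continuous_at)
    qed
    have "has_bochner_integral lborel (\<lambda>t. \<Theta> (y, t) * indicator {a..b} t) (\<psi> b - \<psi> a)"
      by (rule has_bochner_integral_FTC_Icc_real) (use ab d\<psi> cont\<Theta> in auto)
    moreover have "\<Theta> (y, t) * indicator {a..b} t = \<Theta> (y, t)" for t
    proof (cases "t \<in> {t0..t1}")
      case True
      then have "t \<in> {a..b}" using ab by simp
      then show ?thesis by simp
    next
      case False
      then show ?thesis using \<Theta>z[of t y] by simp
    qed
    moreover have "\<psi> b - \<psi> a = 0"
      using z[of "(T - b) powr (- \<beta>) *\<^sub>R y" b] z[of "(T - a) powr (- \<beta>) *\<^sub>R y" a] ab by (auto simp: \<psi>_def)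
    ultimately show ?thesis by (simp add: has_bochner_integral_integral_eq)
  qed
  have "integral\<^sup>L lborel W = (\<integral>t. (\<integral>x. W (x, t) \<partial>lborel) \<partial>lborel)"
    using lborel_pair.integral_snd[of "\<lambda>x t. W (x, t)"] int
    by (simp add: lborel_prod W_def[abs_def] split_beta')
  also have "\<dots> = (\<integral>t. (\<integral>y. norm y powr \<sigma>1 * (f (norm y) * \<Theta> (y, t)) \<partial>lborel) \<partial>lborel)" by (simp only: slice)
  also have "\<dots> = (\<integral>y. (\<integral>t. norm y powr \<sigma>1 * (f (norm y) * \<Theta> (y, t)) \<partial>lborel) \<partial>lborel)"
    using lborel_pair.Fubini_integral[of "\<lambda>y t. norm y powr \<sigma>1 * (f (norm y) * \<Theta> (y, t))"] int\<Theta>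
    by (simp add: lborel_prod split_beta')
  also have "\<dots> = 0" using time by simp
  finally show "(\<integral>z. norm (fst z) powr \<sigma>1 * (u T z * transport_form T \<phi> g z) \<partial>lborel) = 0"
    by (simp only: W_def[abs_def])
qed

text \<open>The integrand splits into the weighted transport form minus the flux form. The former
  has zero integral in time at each fixed similarity variable, the latter zero integral in space at
  each fixed time.\<close>

lemma weak_solution:
  assumes T: "0 < T"
  shows "weak_solution m p \<sigma>1 \<sigma>2 T (backward_self_similar T \<alpha> \<beta> f :: 'a \<times> real \<Rightarrow> real)"
  unfolding u_eq weak_solution_def
proof (intro conjI exI[of _ "G T"])
  show "\<forall>z\<in>space_time T. 0 \<le> u T z" by (simp add: u_nonneg)
  show "weak_spatial_gradient (space_time T) (\<lambda>z. u T z powr m) (G T)"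
    "locally_integrable_on (\<lambda>z. (norm (G T z))\<^sup>2) (space_time T)"
    by (rule weak_gradient[OF T])+
  have li: "locally_integrable_on (\<lambda>z. norm (fst z) powr s * u T z powr q) (space_time T)"
    if s: "- N < s" and q: "0 < q" for s q
  proof (rule locally_integrable_weighted[OF _ _ T, of _ s])
    have [measurable]: "f \<in> borel_measurable borel" by (rule borel_measurable_continuous_onI[OF f_cont])
    have [measurable]: "(fst :: 'a \<times> real \<Rightarrow> 'a) \<in> borel_measurable borel" "(snd :: 'a \<times> real \<Rightarrow> real) \<in> borel_measurable borel"
      by (auto intro!: borel_measurable_continuous_onI continuous_intros)
    show "(\<lambda>z. norm (fst z) powr s * u T z powr q) \<in> borel_measurable borel" unfolding u_def by measurable
    show "- real DIM('a) < s" using s by (simp add: N_def)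
    fix R t0 t1 :: real assume "t1 < T"
    then have "bounded ((\<lambda>z. u T z powr q) ` (cball 0 R \<times> {t0..t1}))"
      by (intro compact_imp_bounded compact_continuous_image continuous_on_subset[OF u_powr_cont[OF q]] compact_Times) auto
    then obtain M where M: "\<forall>z\<in>cball 0 R \<times> {t0..t1}. \<bar>u T z powr q\<bar> \<le> M" unfolding bounded_iff by auto
    have "norm (norm (fst (x, t)) powr s * u T (x, t) powr q) \<le> M * norm x powr s"
      if "norm x \<le> R" "t \<in> {t0..t1}" for x t
    proof -
      have "\<bar>u T (x, t) powr q\<bar> \<le> M" using that by (intro bspec[OF M]) auto
      then have "\<bar>u T (x, t) powr q\<bar> * norm x powr s \<le> M * norm x powr s" by (intro mult_right_mono) auto
      then show ?thesis by (simp add: abs_mult mult.commute)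
    qed
    then show "\<exists>C. \<forall>x t. norm x \<le> R \<longrightarrow> t \<in> {t0..t1} \<longrightarrow> norm (norm (fst (x, t)) powr s * u T (x, t) powr q) \<le> C * norm x powr s"
      by blast
  qed
  show "locally_integrable_on (\<lambda>z. norm (fst z) powr \<sigma>1 * u T z) (space_time T)"
    using li[of \<sigma>1 1] \<sigma> u_nonneg by simp
  show "locally_integrable_on (\<lambda>z. norm (fst z) powr \<sigma>2 * u T z powr p) (space_time T)"
    using li[of \<sigma>2 p] \<sigma> p by simp
  show "\<not> (AE z in lborel. z \<in> space_time T \<longrightarrow> u T z = 0)"
  proof
    assume AE: "AE z in lborel. z \<in> space_time T \<longrightarrow> u T z = 0"
    obtain r where r: "0 < r" "0 < f r" using f_nontriv by blast
    obtain b :: 'a where b: "b \<in> Basis" using nonempty_Basis by blast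
    define t where "t = T / 2"
    define x where "x = (r / (T - t) powr \<beta>) *\<^sub>R b"
    have t: "0 < t" "t < T" using T by (auto simp: t_def)
    have nx: "norm x * (T - t) powr \<beta> = r" using b t r by (simp add: x_def)
    have ux: "0 < u T (x, t)" using nx r t by (simp add: u_def)
    \<comment> \<open>By continuity the positivity set of \<open>u\<close> is open, and a nonempty
      open set is not negligible; one point of positivity therefore suffices.\<close>
    define S where "S = {z \<in> (UNIV :: 'a set) \<times> {0<..<T}. u T z \<in> {0<..}}"
    have "open S"
      unfolding S_def
      by (rule continuous_open_preimage[OF continuous_on_subset[OF u_cont], unfolded vimage_def Int_def mem_Collect_eq])
         (auto intro!: open_Times)
    moreover have "(x, t) \<in> S" using ux t by (simp add: S_def)
    ultimately have "\<not> negligible S" by (intro open_not_negligible) auto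
    moreover have "AE z in lborel. z \<notin> S"
      using AE by eventually_elim (auto simp: S_def space_time_def)
    then have "S \<in> null_sets lborel"
      using \<open>open S\<close> by (subst AE_iff_null_sets) auto
    then have "negligible S" unfolding negligible_iff_null_sets by (rule null_sets_completionI)
    ultimately show False by simp
  qed
  show "\<forall>\<phi> g. test_function (space_time T) \<phi> g \<longrightarrow>
      (LINT z:space_time T|lborel. norm (fst z) powr \<sigma>1 * u T z * snd (g z) - G T z \<bullet> fst (g z)
        + norm (fst z) powr \<sigma>2 * u T z powr p * \<phi> z) = 0"
  proof (intro allI impI)
    fix \<phi> :: "'a \<times> real \<Rightarrow> real" and g assume tf: "test_function (space_time T) \<phi> g"
    obtain R' t0 t1 where R': "0 < R'" "0 < t0" "t0 \<le> t1" "t1 < T"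
      and z: "\<And>x t. \<not> (norm x \<le> R' \<and> t \<in> {t0..t1}) \<Longrightarrow> \<phi> (x, t) = 0 \<and> g (x, t) = 0"
      and cont: "continuous_on UNIV \<phi>" "continuous_on UNIV g"
      and der: "\<And>z. (\<phi> has_derivative (\<lambda>h. h \<bullet> g z)) (at z)"
      using test_functionD[OF tf T] by metis
    have out: "\<phi> z = 0 \<and> g z = 0" if "z \<notin> space_time T" for z
    proof -
      have "\<not> snd z \<in> {t0..t1}" using that R' by (cases z) (auto simp: space_time_def)
      then show ?thesis using z[of "fst z" "snd z"] by simp
    qed
    define I0 where "I0 z = norm (fst z) powr \<sigma>1 * u T z * snd (g z) - G T z \<bullet> fst (g z)
        + norm (fst z) powr \<sigma>2 * u T z powr p * \<phi> z" for z
    define W where "W z = norm (fst z) powr \<sigma>1 * (u T z * transport_form T \<phi> g z)" for z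
    define S where "S = flux_form T \<phi> (\<lambda>z. fst (g z))"
    note tr = transport_integral[OF R' z cont der, folded W_def]
    have I0: "I0 z = W z - S z" for z
      by (simp add: I0_def W_def S_def transport_form_def flux_form_def inner_add_left algebra_simps)
    have i1: "integrable lborel (\<lambda>z. norm (fst z) powr \<sigma>1 * (u T z * snd (g z)))"
      by (rule integrable_weighted_continuous[OF _ _ R'(1,4), of _ _ t0])
         (use \<sigma> z in \<open>auto intro!: continuous_intros u_cont continuous_on_subset[OF cont(2)]\<close>)
    have i3: "integrable lborel (\<lambda>z. norm (fst z) powr \<sigma>2 * (u T z powr p * \<phi> z))"
      by (rule integrable_weighted_continuous[OF _ _ R'(1,4), of _ _ t0])
         (use \<sigma> p z in \<open>auto intro!: continuous_intros u_powr_cont continuous_on_subset[OF cont(1)]\<close>)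
    have i2: "integrable lborel (\<lambda>z. G T z \<bullet> fst (g z))"
    proof -
      have "bounded (g ` (cball 0 R' \<times> {t0..t1}))"
        by (intro compact_imp_bounded compact_continuous_image continuous_on_subset[OF cont(2)] compact_Times) auto
      then obtain P where P: "\<forall>z\<in>cball 0 R' \<times> {t0..t1}. norm (g z) \<le> P" unfolding bounded_iff by auto
      obtain M where M: "0 \<le> M" "\<And>x t. t \<in> {t0..t1} \<Longrightarrow> norm (G T (x, t)) \<le> M * norm x powr (1 + \<mu>)"
        using G_bound[OF R'(4)] by metis
      show ?thesis
      proof (rule integrable_weighted[OF _ _ R'(1), where s = "1 + \<mu>" and ?t0.0 = t0 and ?t1.0 = t1 and C = "M * P"])
        have "(\<lambda>z. fst (g z)) \<in> borel_measurable borel"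
          by (rule borel_measurable_continuous_onI) (intro continuous_intros cont)
        then show "(\<lambda>z. G T z \<bullet> fst (g z)) \<in> borel_measurable borel"
          using G_measurable by (rule borel_measurable_inner[rotated])
        show "- real DIM('a) < 1 + \<mu>" using \<mu> by (simp add: N_def)
        show "norm (G T (x, t) \<bullet> fst (g (x, t))) \<le> M * P * norm x powr (1 + \<mu>)" if "norm x \<le> R'" "t \<in> {t0..t1}" for x t
        proof -
          have "norm (g (x, t)) \<le> P" using that by (intro bspec[OF P]) auto
          then have fg: "norm (fst (g (x, t))) \<le> P"
            using norm_fst_le[of "fst (g (x, t))" "snd (g (x, t))"] by simp
          have "\<bar>G T (x, t) \<bullet> fst (g (x, t))\<bar> \<le> norm (G T (x, t)) * norm (fst (g (x, t)))"
            by (rule Cauchy_Schwarz_ineq2)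
          also have "\<dots> \<le> (M * norm x powr (1 + \<mu>)) * P"
            using M(2)[OF that(2)] fg by (intro mult_mono) (auto intro: order_trans[OF norm_ge_zero])
          finally show ?thesis by (simp add: mult_ac)
        qed
      qed (use z in auto)
    qed
    have iI0: "integrable lborel I0"
    proof -
      have "integrable lborel (\<lambda>z. norm (fst z) powr \<sigma>1 * (u T z * snd (g z)) - G T z \<bullet> fst (g z)
          + norm (fst z) powr \<sigma>2 * (u T z powr p * \<phi> z))"
        by (intro Bochner_Integration.integrable_add Bochner_Integration.integrable_diff i1 i2 i3)
      then show ?thesis by (simp add: I0_def[abs_def] mult.assoc)
    qed
    \<comment> \<open>Integrability of the flux form is inherited from the other two functions, so
      Fubini applies to it.\<close>
    have S_eq: "S = (\<lambda>z. W z - I0 z)" using I0 by (auto simp: fun_eq_iff)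
    have iW: "integrable lborel W" using tr(1) by (simp add: W_def[abs_def])
    have iS: "integrable lborel S" unfolding S_eq by (intro Bochner_Integration.integrable_diff iW iI0)
    have slice0: "(\<integral>x. S (x, t) \<partial>lborel) = 0" for t
    proof (cases "t < T")
      case True
      show ?thesis unfolding S_def
      proof (rule slice_flux[OF True _ _ _ _ R'(1)])
        show "continuous_on UNIV (\<lambda>x. \<phi> (x, t))" "continuous_on UNIV (\<lambda>x. fst (g (x, t)))"
          by (intro continuous_intros continuous_on_compose2[OF cont(1)] continuous_on_compose2[OF cont(2)]; simp)+
        show "((\<lambda>s. \<phi> (x + s *\<^sub>R b, t)) has_real_derivative fst (g (x, t)) \<bullet> b) (at 0)" for x b
        proof -
          have "((\<lambda>s. x + s *\<^sub>R b) has_vector_derivative b) (at 0)"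
            by (auto intro!: derivative_eq_intros)
          from path_derivative[where g = g and x = "\<lambda>s. x + s *\<^sub>R b" and t = "\<lambda>_. t" and s = 0, OF _ this DERIV_const] der
          show ?thesis by (simp add: inner_commute)
        qed
        show "\<phi> (x, t) = 0 \<and> fst (g (x, t)) = 0" if "R' < norm x" for x using z[of x t] that by auto
      qed
    next
      case False
      then have "\<phi> (x, t) = 0 \<and> g (x, t) = 0" for x using z[of x t] R' by auto
      then show ?thesis by (simp add: S_def flux_form_def)
    qed
    have "integral\<^sup>L lborel S = (\<integral>t. (\<integral>x. S (x, t) \<partial>lborel) \<partial>lborel)"
      using lborel_pair.integral_snd[of "\<lambda>x t. S (x, t)"] iS by (simp add: lborel_prod)
    also have "\<dots> = 0" by (simp only: slice0) simp
    finally have S0: "integral\<^sup>L lborel S = 0" .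
    have "integral\<^sup>L lborel I0 = integral\<^sup>L lborel (\<lambda>z. W z - S z)" using I0 by (simp add: I0[abs_def])
    also have "\<dots> = integral\<^sup>L lborel W - integral\<^sup>L lborel S"
      by (intro Bochner_Integration.integral_diff iW iS)
    also have "\<dots> = 0" using tr(2) S0 by (simp add: W_def[abs_def])
    finally have "integral\<^sup>L lborel I0 = 0" .
    moreover have "(LINT z:space_time T|lborel. I0 z) = integral\<^sup>L lborel I0"
      by (rule set_lebesgue_integral_supported) (use out in \<open>auto simp: I0_def\<close>)
    ultimately show "(LINT z:space_time T|lborel. norm (fst z) powr \<sigma>1 * u T z * snd (g z) - G T z \<bullet> fst (g z)
        + norm (fst z) powr \<sigma>2 * u T z powr p * \<phi> z) = 0"
      by (simp add: I0_def)
  qed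
qed

end

text \<open>Only \<open>1\<close> is critical: there \<open>w\<close> and its one-sided derivative
  both vanish, so the zero function continues it differentiably.\<close>

lemma glue_zero_derivative:
  fixes w D :: "real \<Rightarrow> real"
  assumes w: "\<And>s. s \<in> {0<..1} \<Longrightarrow> (w has_real_derivative D s) (at s within {0<..1})"
    and "w 1 = 0" "D 1 = 0" and s: "0 < s"
  shows "((\<lambda>s. if s \<le> 1 then w s else 0) has_real_derivative (if s \<le> 1 then D s else 0)) (at s)"
proof -
  consider "s < 1" | "s = 1" | "1 < s" by linarith
  then show ?thesis
  proof cases
    case 1
    have "at s within {0<..1} = at s within UNIV"
      by (rule at_within_nhd[where S = "{0<..<1}"]) (use 1 s in auto)
    then have "(w has_real_derivative D s) (at s)" using w[of s] 1 s by simp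
    then have "((\<lambda>s. if s \<le> 1 then w s else 0) has_real_derivative D s) (at s)"
      by (rule has_field_derivative_transform_within_open[where S = "{0<..<1}"]) (use 1 s in auto)
    then show ?thesis using 1 by simp
  next
    case 2
    let ?W = "\<lambda>s. if s \<le> 1 then w s else 0"
    have "(w has_real_derivative 0) (at 1 within {0<..1})" using w[of 1] assms(3) by simp
    then have l: "(?W has_real_derivative 0) (at 1 within {0<..1})"
      by (rule has_field_derivative_transform_within[OF _ zero_less_one]) auto
    have "((\<lambda>_. 0) has_real_derivative 0) (at 1 within {1..})" by simp
    then have r: "(?W has_real_derivative 0) (at 1 within {1..})"
      by (rule has_field_derivative_transform_within[OF _ zero_less_one]) (use assms(2) in auto)
    have "(?W has_real_derivative 0) (at 1 within ({0<..1} \<union> {1..}))"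
      using l r unfolding has_field_derivative_iff unfolding at_within_union by (rule filterlim_sup)
    moreover have "at 1 within ({0<..1} \<union> {1..}) = at (1::real) within UNIV"
      by (rule at_within_nhd[where S = "{0<..}"]) auto
    ultimately show ?thesis using 2 assms(3) by simp
  next
    case 3
    have "((\<lambda>_. 0) has_real_derivative 0) (at s)" by simp
    then have "((\<lambda>s. if s \<le> 1 then w s else 0) has_real_derivative 0) (at s)"
      by (rule has_field_derivative_transform_within_open[where S = "{1<..}"]) (use 3 in auto)
    then show ?thesis using 3 by simp
  qed
qed

lemma DERIV_dilation:
  fixes w :: "real \<Rightarrow> real"
  assumes "(w has_real_derivative D) (at (r / \<xi>))"
  shows "((\<lambda>r. K * w (r / \<xi>)) has_real_derivative K * (D / \<xi>)) (at r)"
proof -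
  have "((\<lambda>r. r / \<xi>) has_real_derivative 1 / \<xi>) (at r)" by (rule DERIV_cdivide[OF DERIV_ident])
  from DERIV_cmult[OF DERIV_chain2[OF assms this], of K] show ?thesis by simp
qed

text \<open>\<open>\<kappa>\<close> makes the diffusion and transport terms scale alike, and the dilation \<open>\<xi>\<close> then turns \<open>l\<close> into \<open>1\<close>.\<close>

lemma self_similar_profile_exists:
  fixes N m p \<sigma>1 \<sigma>2 \<alpha> \<beta> :: real
  assumes N: "N = real DIM('a::euclidean_space)"
    and m: "1 < m" and p: "1 \<le> p" "p < m"
    and \<sigma>: "-2 < \<sigma>1" "-2 < \<sigma>2" "0 < N + \<sigma>1" "0 < N + \<sigma>2"
    and L: "0 < L_exponent m p \<sigma>1 \<sigma>2"
    and \<alpha>: "\<alpha> = (\<sigma>2 + 2) / L_exponent m p \<sigma>1 \<sigma>2"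
    and \<beta>: "\<beta> = (m - p) / L_exponent m p \<sigma>1 \<sigma>2"
  shows "\<exists>R C f Y. self_similar_profile TYPE('a) N m p \<sigma>1 \<sigma>2 \<alpha> \<beta> (\<alpha> + \<beta> * (N + \<sigma>1)) R C f Y"
proof -
  define \<Lambda> where "\<Lambda> = L_exponent m p \<sigma>1 \<sigma>2"
  define c where "c = \<alpha> + \<beta> * (N + \<sigma>1)"
  have \<Lambda>: "0 < \<Lambda>" using L by (simp add: \<Lambda>_def)
  have \<alpha>0: "0 < \<alpha>" and \<beta>0: "0 < \<beta>" using \<alpha> \<beta> \<sigma> p \<Lambda> by (auto simp: \<Lambda>_def)
  have c0: "0 < c" using \<alpha>0 \<beta>0 \<sigma> by (simp add: c_def add_pos_pos)
  have N1: "1 \<le> N" using DIM_positive[where 'a = 'a] unfolding N by linarith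
  interpret weighted_shooting N \<beta> c m p \<sigma>1 \<sigma>2
    by standard (use N1 \<beta>0 c0 m p \<sigma> in auto)
  obtain l v y C where l: "0 < l" and v: "continuous_on {0..1} v" "\<And>s. s \<in> {0..1} \<Longrightarrow> 0 \<le> v s" "v 1 = 0"
    and y1: "y 1 = 0" and nontriv: "\<exists>s\<in>{0<..<1}. 0 < v s"
    and dv: "\<And>s. s \<in> {0<..1} \<Longrightarrow> (v has_real_derivative wA s * y s - wB s * v s powr (1 / m)) (at s within {0<..1})"
    and dy: "\<And>s. s \<in> {0<..1} \<Longrightarrow> (y has_real_derivative
       wP s * v s powr (1 / m) - l * wQ s * v s powr (p / m)) (at s within {0<..1})"
    and yC: "\<And>s. s \<in> {0<..1} \<Longrightarrow> \<bar>y s\<bar> \<le> C * s powr (N + \<mu>)"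
    using profile_exists by metis
  define \<kappa> where "\<kappa> = (\<sigma>1 + 2) / (m - 1)"
  define \<xi> where "\<xi> = l powr ((m - 1) / \<Lambda>)"
  have \<xi>: "0 < \<xi>" using l by (simp add: \<xi>_def)
  \<comment> \<open>\<open>vv\<close> continues \<open>v\<close> by \<open>0\<close> beyond the
    interface and by \<open>v 0\<close> to negative arguments, which gives continuity on the whole
    line.\<close>
  define vv where "vv s = v (min 1 (max 0 s))" for s
  have vv0: "0 \<le> vv s" for s unfolding vv_def by (rule v(2)) auto
  have vv_pos: "vv s = (if s \<le> 1 then v s else 0)" if "0 < s" for s using that v(3) by (auto simp: vv_def)
  have vv_cont: "continuous_on UNIV vv"
    unfolding vv_def by (rule continuous_on_compose2[OF v(1)]) (auto intro!: continuous_intros)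
  define yy where "yy s = (if s \<le> 1 then y s else 0)" for s
  define f where "f r = \<xi> powr \<kappa> * vv (r / \<xi>) powr (1 / m)" for r
  define Y where "Y r = (if r \<le> 0 then 0 else \<xi> powr (\<kappa> * m + N - 2) * yy (r / \<xi>))" for r
  have k1: "\<kappa> * m = \<kappa> + \<sigma>1 + 2" using m by (simp add: \<kappa>_def field_simps)
  \<comment> \<open>This is the condition for \<open>l\<close> to disappear from the rescaled
    equation. The two exponents differ by \<open>\<Lambda> / (m - 1)\<close>, and
    \<open>\<xi>\<close> is the solution because \<open>\<Lambda>\<close> is positive.\<close>
  have k2: "l * \<xi> powr (\<kappa> * m - 2) = \<xi> powr (\<sigma>2 + \<kappa> * p)"
  proof -
    have "\<Lambda> / (m - 1) = \<sigma>2 + \<kappa> * p - (\<kappa> * m - 2)"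
    proof -
      have "(\<sigma>2 + \<kappa> * p - (\<kappa> * m - 2)) * (m - 1) = (\<sigma>2 - \<sigma>1) * (m - 1) + (\<kappa> * (m - 1)) * (p - 1)"
        unfolding k1 by (simp add: algebra_simps)
      also have "\<kappa> * (m - 1) = \<sigma>1 + 2" using m by (simp add: \<kappa>_def)
      also have "(\<sigma>2 - \<sigma>1) * (m - 1) + (\<sigma>1 + 2) * (p - 1) = \<Lambda>"
        by (simp add: \<Lambda>_def L_exponent_def algebra_simps)
      finally have "\<Lambda> / (m - 1) = (\<sigma>2 + \<kappa> * p - (\<kappa> * m - 2)) * (m - 1) / (m - 1)" by (simp only:)
      then show ?thesis using m by simp
    qed
    moreover have "l = \<xi> powr (\<Lambda> / (m - 1))" using l m \<Lambda> by (simp add: \<xi>_def powr_powr)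
    ultimately have "l = \<xi> powr (\<sigma>2 + \<kappa> * p - (\<kappa> * m - 2))" by simp
    then show ?thesis by (simp flip: powr_add)
  qed
  have fm: "f r powr m = \<xi> powr (\<kappa> * m) * vv (r / \<xi>)" for r
    using m vv0[of "r / \<xi>"] by (simp add: f_def powr_mult powr_powr)
  have fp: "f r powr p = \<xi> powr (\<kappa> * p) * vv (r / \<xi>) powr (p / m)" for r
    using vv0[of "r / \<xi>"] by (simp add: f_def powr_mult powr_powr)
  have rs: "(s * \<xi>) powr e = \<xi> powr e * s powr e" if "0 < s" for s e
    using that \<xi> by (simp add: powr_mult mult.commute)
  have dvv: "(vv has_real_derivative wA s * yy s - wB s * vv s powr (1 / m)) (at s)" if s: "0 < s" for s
  proof -
    have "((\<lambda>s. if s \<le> 1 then v s else 0) has_real_derivative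
        (if s \<le> 1 then wA s * y s - wB s * v s powr (1 / m) else 0)) (at s)"
      by (rule glue_zero_derivative[OF dv]) (use v y1 s in auto)
    then have "(vv has_real_derivative (if s \<le> 1 then wA s * y s - wB s * v s powr (1 / m) else 0)) (at s)"
      by (rule has_field_derivative_transform_within_open[where S = "{0<..}"]) (use s vv_pos in auto)
    then show ?thesis using vv_pos[OF s] by (simp add: yy_def split: if_splits)
  qed
  have dyy: "(yy has_real_derivative wP s * vv s powr (1 / m) - l * wQ s * vv s powr (p / m)) (at s)" if s: "0 < s" for s
  proof -
    have "((\<lambda>s. if s \<le> 1 then y s else 0) has_real_derivative
        (if s \<le> 1 then wP s * v s powr (1 / m) - l * wQ s * v s powr (p / m) else 0)) (at s)"
      by (rule glue_zero_derivative[OF dy]) (use v y1 s in auto)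
    then show ?thesis using vv_pos[OF s] by (simp add: yy_def[abs_def] split: if_splits)
  qed
  have C0: "0 \<le> C" using yC[of 1] by simp
  have "self_similar_profile TYPE('a) N m p \<sigma>1 \<sigma>2 \<alpha> \<beta> c \<xi> (\<xi> powr (\<kappa> * m + N - 2) * C * \<xi> powr - (N + \<mu>)) f Y"
  proof
    show "N = real DIM('a)" by (rule assms(1))
    show "c = \<alpha> + \<beta> * (N + \<sigma>1)" by (rule c_def)
    have \<alpha>': "\<alpha> * \<Lambda> = \<sigma>2 + 2" and \<beta>': "\<beta> * \<Lambda> = m - p" using \<Lambda> unfolding \<Lambda>_def assms(10,11) by simp_all
    \<comment> \<open>Both exponent relations are checked after multiplication by
      \<open>\<Lambda>\<close>, which turns \<open>\<alpha>\<close> and \<open>\<beta>\<close> into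
      polynomials in the data.\<close>
    have "(\<alpha> * m) * \<Lambda> = (\<alpha> + 1 + \<beta> * (2 + \<sigma>1)) * \<Lambda>"
    proof -
      have "(\<alpha> * m) * \<Lambda> = (\<sigma>2 + 2) * m" using \<alpha>' by (simp add: mult_ac)
      also have "\<dots> = (\<sigma>2 + 2) + \<Lambda> + (m - p) * (2 + \<sigma>1)" by (simp add: \<Lambda>_def L_exponent_def algebra_simps)
      also have "\<dots> = (\<alpha> + 1 + \<beta> * (2 + \<sigma>1)) * \<Lambda>" unfolding \<alpha>'[symmetric] \<beta>'[symmetric] by (simp add: algebra_simps)
      finally show ?thesis .
    qed
    then show "\<alpha> * m = \<alpha> + 1 + \<beta> * (2 + \<sigma>1)" using \<Lambda> by simp
    have "(\<alpha> * m) * \<Lambda> = (\<alpha> * p + \<beta> * (2 + \<sigma>2)) * \<Lambda>"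
    proof -
      have "(\<alpha> * m) * \<Lambda> = (\<alpha> * \<Lambda>) * p + (\<alpha> * \<Lambda>) * (m - p)" by (simp add: algebra_simps)
      also have "\<dots> = (\<alpha> * \<Lambda>) * p + (2 + \<sigma>2) * (\<beta> * \<Lambda>)" by (simp add: \<alpha>' \<beta>' add.commute)
      finally show ?thesis by (simp add: algebra_simps)
    qed
    then show "\<alpha> * m = \<alpha> * p + \<beta> * (2 + \<sigma>2)" using \<Lambda> by simp
    show "continuous_on UNIV f"
      unfolding f_def using m vv0 \<xi>
      by (intro continuous_on_mult continuous_on_const continuous_on_powr' continuous_on_compose2[OF vv_cont] continuous_intros) auto
    show "0 \<le> f r" for r by (simp add: f_def)
    show "f r = 0" if "\<xi> \<le> r" for r
    proof -
      have "1 \<le> r / \<xi>" using that \<xi> by simp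
      then have "vv (r / \<xi>) = 0" using v(3) by (simp add: vv_def)
      then show ?thesis by (simp add: f_def)
    qed
    obtain s where s: "0 < s" "s < 1" "0 < v s" using nontriv by auto
    have "0 < f (s * \<xi>)" using s \<xi> vv_pos[of s] by (simp add: f_def)
    then show "\<exists>r>0. 0 < f r" using s \<xi> by (intro exI[of _ "s * \<xi>"]) simp
  next
    fix r :: real assume r: "0 < r"
    define s where "s = r / \<xi>"
    have s: "0 < s" and rs': "r = s * \<xi>" using r \<xi> by (auto simp: s_def)
    have Yr: "Y r = \<xi> powr (\<kappa> * m + N - 2) * yy s" using r by (simp add: Y_def s_def)
    have fr: "f r = \<xi> powr \<kappa> * vv s powr (1 / m)" by (simp add: f_def s_def)
    have "((\<lambda>r. \<xi> powr (\<kappa> * m) * vv (r / \<xi>)) has_real_derivative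
        \<xi> powr (\<kappa> * m) * ((wA s * yy s - wB s * vv s powr (1 / m)) / \<xi>)) (at r)"
      using DERIV_dilation[OF dvv[OF s, unfolded s_def]] by (simp add: s_def)
    moreover have "\<xi> powr (\<kappa> * m) * ((wA s * yy s - wB s * vv s powr (1 / m)) / \<xi>) =
        r powr (1 - N) * Y r - \<beta> * r powr (1 + \<sigma>1) * f r"
    proof -
      have 1: "r powr (1 - N) * Y r = \<xi> powr (\<kappa> * m) / \<xi> * (wA s * yy s)"
      proof -
        have "r powr (1 - N) * Y r = (\<xi> powr (1 - N) * \<xi> powr (\<kappa> * m + N - 2)) * (s powr (1 - N) * yy s)"
          unfolding Yr unfolding rs' rs[OF s] by simp
        also have "\<xi> powr (1 - N) * \<xi> powr (\<kappa> * m + N - 2) = \<xi> powr (\<kappa> * m - 1)" by (simp flip: powr_add)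
        also have "\<dots> = \<xi> powr (\<kappa> * m) / \<xi>" using \<xi> by (simp add: powr_diff)
        finally show ?thesis by (simp add: wA_def)
      qed
      have 2: "\<beta> * r powr (1 + \<sigma>1) * f r = \<xi> powr (\<kappa> * m) / \<xi> * (wB s * vv s powr (1 / m))"
      proof -
        have "\<beta> * r powr (1 + \<sigma>1) * f r = (\<xi> powr (1 + \<sigma>1) * \<xi> powr \<kappa>) * (\<beta> * s powr (1 + \<sigma>1) * vv s powr (1 / m))"
          unfolding fr unfolding rs' rs[OF s] by simp
        also have "\<xi> powr (1 + \<sigma>1) * \<xi> powr \<kappa> = \<xi> powr (\<kappa> * m - 1)" by (simp add: k1 add_ac flip: powr_add)
        also have "\<dots> = \<xi> powr (\<kappa> * m) / \<xi>" using \<xi> by (simp add: powr_diff)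
        finally show ?thesis by (simp add: wB_def)
      qed
      show ?thesis unfolding 1 2 by (simp add: right_diff_distrib diff_divide_distrib)
    qed
    ultimately show "((\<lambda>r. f r powr m) has_real_derivative r powr (1 - N) * Y r - \<beta> * r powr (1 + \<sigma>1) * f r) (at r)"
      unfolding fm by (simp only:)
    have "((\<lambda>r. \<xi> powr (\<kappa> * m + N - 2) * yy (r / \<xi>)) has_real_derivative
        \<xi> powr (\<kappa> * m + N - 2) * ((wP s * vv s powr (1 / m) - l * wQ s * vv s powr (p / m)) / \<xi>)) (at r)"
      using DERIV_dilation[OF dyy[OF s, unfolded s_def]] by (simp add: s_def)
    then have "(Y has_real_derivative
        \<xi> powr (\<kappa> * m + N - 2) * ((wP s * vv s powr (1 / m) - l * wQ s * vv s powr (p / m)) / \<xi>)) (at r)"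
      by (rule has_field_derivative_transform_within_open[where S = "{0<..}"]) (use r in \<open>auto simp: Y_def\<close>)
    moreover have "\<xi> powr (\<kappa> * m + N - 2) * ((wP s * vv s powr (1 / m) - l * wQ s * vv s powr (p / m)) / \<xi>) =
        r powr (N - 1) * (c * r powr \<sigma>1 * f r - r powr \<sigma>2 * f r powr p)"
    proof -
      have e: "\<xi> powr (\<kappa> * m + N - 2) / \<xi> = \<xi> powr (N - 1) * \<xi> powr (\<kappa> * m - 2)"
      proof -
        have "\<xi> powr (\<kappa> * m + N - 2) / \<xi> = \<xi> powr (\<kappa> * m + N - 2 - 1)"
          unfolding powr_diff[of \<xi> "\<kappa> * m + N - 2" 1] using \<xi> by simp
        also have "\<kappa> * m + N - 2 - 1 = (N - 1) + (\<kappa> * m - 2)" by simp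
        finally show ?thesis by (simp only: powr_add)
      qed
      have e': "\<xi> powr (\<kappa> * m - 2) = \<xi> powr \<sigma>1 * \<xi> powr \<kappa>" by (simp add: k1 add_ac flip: powr_add)
      have "\<xi> powr (\<kappa> * m + N - 2) * ((wP s * vv s powr (1 / m) - l * wQ s * vv s powr (p / m)) / \<xi>) =
          (\<xi> powr (\<kappa> * m + N - 2) / \<xi>) * (wP s * vv s powr (1 / m) - l * wQ s * vv s powr (p / m))" by simp
      also have "\<dots> = \<xi> powr (N - 1) * (\<xi> powr (\<kappa> * m - 2) * (wP s * vv s powr (1 / m))
          - (l * \<xi> powr (\<kappa> * m - 2)) * (wQ s * vv s powr (p / m)))"
        unfolding e by (simp add: algebra_simps)
      also have "\<dots> = \<xi> powr (N - 1) * ((\<xi> powr \<sigma>1 * \<xi> powr \<kappa>) * (c * (s powr (N - 1) * s powr \<sigma>1) * vv s powr (1 / m))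
          - (\<xi> powr \<sigma>2 * \<xi> powr (\<kappa> * p)) * ((s powr (N - 1) * s powr \<sigma>2) * vv s powr (p / m)))"
        unfolding k2 unfolding e' wP_def wQ_def powr_add ..
      also have "\<dots> = r powr (N - 1) * (c * r powr \<sigma>1 * f r - r powr \<sigma>2 * f r powr p)"
        unfolding fp unfolding fr unfolding rs' rs[OF s] using \<xi> by (simp add: algebra_simps)
      finally show ?thesis .
    qed
    ultimately show "(Y has_real_derivative r powr (N - 1) * (c * r powr \<sigma>1 * f r - r powr \<sigma>2 * f r powr p)) (at r)"
      by (simp only:)
    show "\<bar>Y r\<bar> \<le> \<xi> powr (\<kappa> * m + N - 2) * C * \<xi> powr - (N + \<mu>) * r powr (N + min \<sigma>1 \<sigma>2)"
    proof -
      have "\<bar>yy s\<bar> \<le> C * s powr (N + \<mu>)" using yC[of s] s C0 by (auto simp: yy_def)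
      moreover have "s powr (N + \<mu>) = \<xi> powr - (N + \<mu>) * r powr (N + \<mu>)"
      proof -
        have "\<xi> powr - (N + \<mu>) * \<xi> powr (N + \<mu>) = 1" using \<xi> by (simp flip: powr_add)
        then show ?thesis unfolding rs' rs[OF s] by (simp flip: mult.assoc)
      qed
      ultimately have "\<bar>yy s\<bar> \<le> C * (\<xi> powr - (N + \<mu>) * r powr (N + \<mu>))" by simp
      then have "\<xi> powr (\<kappa> * m + N - 2) * \<bar>yy s\<bar> \<le> \<xi> powr (\<kappa> * m + N - 2) * (C * (\<xi> powr - (N + \<mu>) * r powr (N + \<mu>)))"
        by (intro mult_left_mono) auto
      then show ?thesis by (simp add: Yr abs_mult mult.assoc \<mu>_def)
    qed
  next
    show "Y r = 0" if "\<xi> \<le> r" for r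
    proof -
      have "1 \<le> r / \<xi>" using that \<xi> by simp
      then have "yy (r / \<xi>) = 0" using y1 by (cases "r / \<xi> = 1") (auto simp: yy_def)
      then show ?thesis by (simp add: Y_def)
    qed
    show "Y r = 0" if "r \<le> 0" for r using that by (simp add: Y_def)
  qed (use m p \<sigma> \<beta>0 c0 \<xi> in auto)
  then show ?thesis unfolding c_def by blast
qed

theorem theorem5p2:
  fixes m p \<sigma>1 \<sigma>2 \<alpha> \<beta> :: real
  assumes "m > 1" and "1 \<le> p" and "p < m"
    and "(CARD('n::finite) \<ge> 2 \<and> \<sigma>1 > -2 \<and> \<sigma>2 > -2) \<or> (CARD('n) = 1 \<and> \<sigma>1 \<ge> 0 \<and> \<sigma>2 > -1)"
    and "L_exponent m p \<sigma>1 \<sigma>2 > 0"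
    and "\<alpha> = (\<sigma>2 + 2) / L_exponent m p \<sigma>1 \<sigma>2"
    and "\<beta> = (m - p) / L_exponent m p \<sigma>1 \<sigma>2"
  shows "\<alpha> > 0 \<and> \<beta> > 0 \<and>
    (\<exists>f. compactly_supported_profile f \<and>
      (\<forall>T>0. weak_solution m p \<sigma>1 \<sigma>2 T
        (backward_self_similar T \<alpha> \<beta> f :: (real ^ 'n) \<times> real \<Rightarrow> real)))"
proof -
  define N where "N = real DIM(real ^ 'n)"
  \<comment> \<open>Either alternative on the dimension yields the same four bounds; in dimension
    one \<open>\<sigma>2 > -1\<close> is the condition \<open>0 < N + \<sigma>2\<close>.\<close>
  have \<sigma>: "-2 < \<sigma>1" "-2 < \<sigma>2" "0 < N + \<sigma>1" "0 < N + \<sigma>2"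
    using assms(4) by (auto simp: N_def)
  obtain R C f Y where "self_similar_profile TYPE(real ^ 'n) N m p \<sigma>1 \<sigma>2 \<alpha> \<beta> (\<alpha> + \<beta> * (N + \<sigma>1)) R C f Y"
    using self_similar_profile_exists[OF N_def assms(1-3) \<sigma> assms(5-7)] by blast
  then interpret self_similar_profile "TYPE(real ^ 'n)" N m p \<sigma>1 \<sigma>2 \<alpha> \<beta> "\<alpha> + \<beta> * (N + \<sigma>1)" R C f Y .
  have "{r \<in> {0..}. f r \<noteq> 0} \<subseteq> {0..R}" using f_supp by auto (metis linorder_le_cases)
  then have "compactly_supported_profile f"
    unfolding compactly_supported_profile_def compact_closure
    using f_cont_on bounded_subset[OF bounded_closed_interval] by blast
  moreover have "0 < \<alpha>" "0 < \<beta>" using assms \<sigma> by auto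
  ultimately show ?thesis using weak_solution by blast
qed

end
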